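(* Let $\phi:(0,\infty)\to\mathbb{C}$ be proper. Then: (i) If the Riemann hypothesis holds, then for every $\epsilon>0$, $\mathbf{G}\phi(x)=O_\epsilon(x^{-1/2+\epsilon})$ as $x\to+\infty$. (ii) If for every $\epsilon>0$, $\mathbf{G}\phi(x)=O_\epsilon(x^{-1/2+\epsilon})$ as $x\to+\infty$, then for every $s$ with $\Re s>-\tfrac12$ such that $\zeta(s+1)=0$ we have $\phi^\wedge(s)=0$. (iii) Consequently, if $\phi$ is mellin-proper, then the Riemann hypothesis holds if and only if for every $\epsilon>0$, $\mathbf{G}\phi(x)=O_\epsilon(x^{-1/2+\epsilon})$ as $x\to+\infty$.
   Context: $\mu$ is the Möbius function and $g(x):=\sum_{n\le x}\mu(n)n^{-1}$ for $x>0$. For $a\in\mathbb{R}$, $N_a(f):=\int_0^\infty t^{-a-1}|f(t)|\,dt$. The (left-)Mellin transform of $f:(0,\infty)\to\mathbb{C}$ is $f^\wedge(s):=\int_0^\infty t^{-s-1}f(t)\,dt$ where the integral converges absolutely. $\phi$ is called proper if $N_\sigma(\phi)<\infty$ for all $\sigma\in(-\tfrac12,1]$, and mellin-proper if it is proper and $\phi^\wedge(s)\neq0$ for all $s$ with $-\tfrac12<\Re s<0$. For measurable $\phi$ and $x>0$, $\mathbf{G}\phi(x):=\int_0^\infty g(xt)\phi(t^{-1})t^{-1}\,dt$ whenever this integral converges absolutely. *)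

theory Defs
  imports
    "HOL-Complex_Analysis.Complex_Analysis"
    "HOL-Computational_Algebra.Computational_Algebra"
    "HOL-Library.Landau_Symbols"
begin

definition moebius_mu :: "nat \<Rightarrow> int" where
  "moebius_mu n = (if squarefree n then (- 1) ^ card (prime_factors n) else 0)"

definition g_sum :: "real \<Rightarrow> real" where
  "g_sum x = (\<Sum>n | 1 \<le> n \<and> real n \<le> x. of_int (moebius_mu n) / real n)"

(* The analytic continuation of the Dirichlet series to the punctured plane. By the identity
   theorem its values away from 1 are uniquely determined; the value at the pole 1 is left
   unspecified, so statements about zeros must exclude that point. *)
definition riemann_zeta :: "complex \<Rightarrow> complex" where
  "riemann_zeta = (SOME f. f holomorphic_on - {1} \<and>
     (\<forall>s. Re s > 1 \<longrightarrow> (\<lambda>n. 1 / of_nat (Suc n) powr s) sums f s))"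

definition riemann_hypothesis :: bool where
  "riemann_hypothesis \<longleftrightarrow>
     (\<forall>s. 0 < Re s \<and> Re s < 1 \<and> riemann_zeta s = 0 \<longrightarrow> Re s = 1 / 2)"

(* A function on (0,\<infinity>) is a total function on the reals of which only the values on {0<..} are
   ever used. *)

definition N_norm :: "real \<Rightarrow> (real \<Rightarrow> complex) \<Rightarrow> ennreal" where
  "N_norm a f =
     (\<integral>\<^sup>+t. ennreal (t powr (- a - 1) * norm (f t)) \<partial>lebesgue_on {0<..})"

(* Here and in G_op the Bochner integral is 0 if the integrand is not absolutely integrable.
   For proper functions this does not occur: the Mellin integral then converges for
   -1/2 < Re s <= 1, and the one defining G_op for all x > 0, as g_sum is bounded. *)
definition mellin :: "(real \<Rightarrow> complex) \<Rightarrow> complex \<Rightarrow> complex" where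
  "mellin f s = (\<integral>t. of_real t powr (- s - 1) * f t \<partial>lebesgue_on {0<..})"

definition proper :: "(real \<Rightarrow> complex) \<Rightarrow> bool" where
  "proper \<phi> \<longleftrightarrow> \<phi> \<in> borel_measurable (lebesgue_on {0<..}) \<and>
     (\<forall>\<sigma>. - 1 / 2 < \<sigma> \<and> \<sigma> \<le> 1 \<longrightarrow> N_norm \<sigma> \<phi> < \<infinity>)"

definition mellin_proper :: "(real \<Rightarrow> complex) \<Rightarrow> bool" where
  "mellin_proper \<phi> \<longleftrightarrow> proper \<phi> \<and>
     (\<forall>s. - 1 / 2 < Re s \<and> Re s < 0 \<longrightarrow> mellin \<phi> s \<noteq> 0)"

definition G_op :: "(real \<Rightarrow> complex) \<Rightarrow> real \<Rightarrow> complex" where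
  "G_op \<phi> x =
     (\<integral>t. of_real (g_sum (x * t)) * \<phi> (inverse t) * of_real (inverse t) \<partial>lebesgue_on {0<..})"

end

theory Submission
  imports Defs "HOL-Number_Theory.Prime_Powers" "HOL-Real_Asymp.Real_Asymp"
begin

text \<open>
  Write $\phi^\wedge$ for the Mellin transform. Since $g^\wedge(s) = 1/(s\,\zeta(s+1))$ for
  $\Re s > 0$ and $\mathbf{G}\phi$ is the multiplicative convolution of $g$ and $\phi$, one has
  $\zeta(s+1)\, s\,(\mathbf{G}\phi)^\wedge(s) = \phi^\wedge(s)$ for $0 < \Re s \le 1$. A bound
  $\mathbf{G}\phi(x) = O_\epsilon(x^{-1/2+\epsilon})$ continues $(\mathbf{G}\phi)^\wedge$ to
  $-1/2 < \Re s < 1$, where the identity persists, so $\phi^\wedge$ vanishes wherever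
  $\zeta(s+1)$ does. Zeros to the left of the critical line are reflected to the right by the
  functional equation.

  Conversely, the Riemann hypothesis implies $\zeta(s)^{-1} = O(|t|^\epsilon)$ to the right of the
  critical line. Shifting the line of integration in Perron's formula for the Riesz means of
  $\mu(n)/n$ and differencing over $[x, x + \sqrt{x}]$ then gives $g(x) = O(x^{-1/2+\epsilon})$,
  which integrates against $\phi$.
\<close>

subsection \<open>Absolutely convergent Mellin transforms\<close>

text \<open>\<open>riemann_zeta\<close> is a choice, so nothing is known of it before a continuation
  has been exhibited; this, the functional equation and the nonvanishing on Re s = 1 are all derived
  here. The common tool is the absolutely convergent Mellin transform: most explicit transforms are
  computed at real exponents, where they are real integrals, and the identity theorem does the rest.
  The pole at 1 is removed by working with \<open>zeta_reg\<close>, that is (s - 1) zeta(s), so that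
  the transform of g is 1/zeta_reg(s + 1). Under the Riemann hypothesis the available bound for this
  transform is |t|^(\<epsilon> - 1), which is not integrable on a vertical line. Hence the Riesz
  mean, whose extra factor 1/(s + 1) restores absolute convergence, and hence the differencing that
  leads back to g. The nonvanishing on Re s = 1 serves both directions: the Riemann hypothesis
  speaks of the open strip only, while the bounds on 1/zeta reach beyond it; and in (ii) it leaves
  no zeros with Re s \<ge> 0 to be treated.\<close>

abbreviation Lpos :: "real measure" where "Lpos \<equiv> lebesgue_on {0<..}"

text \<open>Absolute convergence on the whole line Re s = a. Measurability of \<open>f\<close> is
  carried along, since integrability of the norm does not imply it.\<close>

definition mellin_conv :: "(real \<Rightarrow> complex) \<Rightarrow> real \<Rightarrow> bool" where
  "mellin_conv f a \<longleftrightarrow> f \<in> borel_measurable Lpos \<and>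
     integrable Lpos (\<lambda>t. t powr (- a - 1) * norm (f t))"

lemma AE_Lpos_pos: "AE t in Lpos. t > 0"
  by (rule AE_I2) (auto simp: space_restrict_space)

lemma borel_imp_Lpos:
  assumes "f \<in> borel_measurable borel"
  shows "f \<in> borel_measurable Lpos"
  using assms by (intro measurable_restrict_space1 measurable_completion) simp

lemma id_Lpos_borel: "(\<lambda>x. x) \<in> Lpos \<rightarrow>\<^sub>M borel"
  by (intro measurable_restrict_space1 measurable_completion) simp

lemma Lpos_measurable_powr [measurable]:
  "(\<lambda>t. t powr a) \<in> borel_measurable Lpos"
  "(\<lambda>t. complex_of_real t powr z) \<in> borel_measurable Lpos"
  "(\<lambda>t. ln t) \<in> borel_measurable Lpos"
proof -
  show "(\<lambda>t. t powr a) \<in> borel_measurable Lpos" "(\<lambda>t. ln t) \<in> borel_measurable Lpos"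
    by (rule borel_imp_Lpos, measurable)+
  have "complex_of_real \<in> borel_measurable borel"
    by (intro borel_measurable_continuous_onI continuous_intros)
  then show "(\<lambda>t. complex_of_real t powr z) \<in> borel_measurable Lpos"
    by (intro borel_imp_Lpos powr_complex_measurable) auto
qed

lemma sigma_finite_Lpos: "sigma_finite_measure Lpos"
proof (rule sigma_finite_measure_restrict_space)
  obtain A :: "real set set" where A: "countable A" "A \<subseteq> sets lborel" "\<Union>A = space lborel"
     "\<forall>a\<in>A. emeasure lborel a \<noteq> \<infinity>"
    using sigma_finite_measure.sigma_finite_countable[OF sigma_finite_lborel] by blast
  show "sigma_finite_measure (lebesgue :: real measure)"
  proof
    show "\<exists>A::real set set. countable A \<and> A \<subseteq> sets lebesgue \<and> \<Union> A = space lebesgue \<and>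
       (\<forall>a\<in>A. emeasure lebesgue a \<noteq> \<infinity>)"
      using A by (intro exI[of _ A]) (auto simp: subset_iff)
  qed
qed auto

lemma mellin_convI:
  assumes "f \<in> borel_measurable Lpos" "N_norm a f < \<infinity>"
  shows "mellin_conv f a"
proof -
  have [measurable]: "f \<in> borel_measurable Lpos" by fact
  show ?thesis unfolding mellin_conv_def
  proof (intro conjI assms integrableI_bounded)
    show "(\<lambda>t. t powr (- a - 1) * norm (f t)) \<in> borel_measurable Lpos"
      by measurable
    show "(\<integral>\<^sup>+ x. ennreal (norm (x powr (- a - 1) * cmod (f x))) \<partial>Lpos) < \<infinity>"
      using assms(2) by (simp add: N_norm_def)
  qed
qed

lemma mellin_conv_proper:
  assumes "proper \<phi>" "- 1 / 2 < a" "a \<le> 1"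
  shows "mellin_conv \<phi> a"
  using assms by (intro mellin_convI) (auto simp: proper_def)

lemma norm_mellin_kernel:
  fixes s z :: complex
  assumes "t > 0"
  shows "norm (of_real t powr (- s - 1) * z) = t powr (- Re s - 1) * norm z"
  using assms by (simp add: norm_mult norm_powr_real_powr)

lemma mellin_measurable:
  assumes "f \<in> borel_measurable Lpos"
  shows "(\<lambda>t. complex_of_real t powr (- s - 1) * f t) \<in> borel_measurable Lpos"
proof -
  have [measurable]: "f \<in> borel_measurable Lpos" by fact
  show ?thesis by measurable
qed

lemma mellin_conv_integrable:
  assumes "mellin_conv f (Re s)"
  shows "integrable Lpos (\<lambda>t. of_real t powr (- s - 1) * f t)"
proof (rule Bochner_Integration.integrable_bound)
  show "integrable Lpos (\<lambda>t. t powr (- Re s - 1) * norm (f t))"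
    using assms by (simp add: mellin_conv_def)
  show "(\<lambda>t. of_real t powr (- s - 1) * f t) \<in> borel_measurable Lpos"
    using assms by (intro mellin_measurable) (simp add: mellin_conv_def)
  show "AE x in Lpos. cmod (complex_of_real x powr (- s - 1) * f x) \<le> norm (x powr (- Re s - 1) * cmod (f x))"
    using AE_Lpos_pos
  proof eventually_elim
    case (elim x)
    show ?case unfolding norm_mellin_kernel[OF elim] by simp
  qed
qed

lemma mellin_conv_bound:
  assumes "mellin_conv f a" "g \<in> borel_measurable Lpos"
    "\<And>t. t > 0 \<Longrightarrow> t powr (- b - 1) * norm (g t) \<le> C * (t powr (- a - 1) * norm (f t))"
  shows "mellin_conv g b"
proof -
  have [measurable]: "g \<in> borel_measurable Lpos" by fact
  show ?thesis unfolding mellin_conv_def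
  proof (rule conjI[OF assms(2)], rule Bochner_Integration.integrable_bound)
    show "integrable Lpos (\<lambda>t. C * (t powr (- a - 1) * norm (f t)))"
      using assms by (simp add: mellin_conv_def)
    show "(\<lambda>t. t powr (- b - 1) * norm (g t)) \<in> borel_measurable Lpos" by measurable
    show "AE x in Lpos. norm (x powr (- b - 1) * cmod (g x)) \<le> norm (C * (x powr (- a - 1) * cmod (f x)))"
      using AE_Lpos_pos
    proof eventually_elim
      case (elim x)
      from assms(3)[OF this] show ?case by simp
    qed
  qed
qed

text \<open>The larger of the two endpoint powers changes at t = 1; their sum is a majorant uniform
  in x, which makes the set of admissible exponents an interval.\<close>

lemma powr_between:
  assumes "(t::real) > 0" "a \<le> x" "x \<le> b"
  shows "t powr x \<le> t powr a + t powr b"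
proof (cases "t \<ge> 1")
  case True
  then have "t powr x \<le> t powr b" using assms by (intro powr_mono) auto
  then show ?thesis by (simp add: add_increasing)
next
  case False
  then have "t powr x \<le> t powr a" using assms by (intro powr_mono') auto
  then show ?thesis by (simp add: add_increasing2)
qed

lemma mellin_conv_between:
  assumes "mellin_conv f a" "mellin_conv f b" "a \<le> x" "x \<le> b"
  shows "mellin_conv f x"
proof -
  have [measurable]: "f \<in> borel_measurable Lpos" using assms by (simp add: mellin_conv_def)
  show ?thesis unfolding mellin_conv_def
  proof (rule conjI, fact, rule Bochner_Integration.integrable_bound)
    show "integrable Lpos (\<lambda>t. t powr (- a - 1) * norm (f t) + t powr (- b - 1) * norm (f t))"
      using assms by (simp add: mellin_conv_def)
    show "(\<lambda>t. t powr (- x - 1) * norm (f t)) \<in> borel_measurable Lpos" by measurable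
    show "AE t in Lpos. norm (t powr (- x - 1) * cmod (f t)) \<le>
            norm (t powr (- a - 1) * norm (f t) + t powr (- b - 1) * norm (f t))"
      using AE_Lpos_pos
    proof eventually_elim
      case (elim t)
      have "t powr (- x - 1) * norm (f t) \<le> (t powr (- b - 1) + t powr (- a - 1)) * norm (f t)"
        using elim assms by (intro mult_right_mono powr_between) auto
      then show ?case by (simp add: algebra_simps)
    qed
  qed
qed

lemma open_Re_strip: "open {s. a < Re s \<and> Re s < b}"
  and connected_Re_strip: "connected {s. a < Re s \<and> Re s < b}"
proof -
  have "{s. a < Re s \<and> Re s < b} = {s. a < Re s} \<inter> {s. Re s < b}" by auto
  then show "open {s. a < Re s \<and> Re s < b}" "connected {s. a < Re s \<and> Re s < b}"
    by (simp_all add: open_Int open_halfspace_Re_gt open_halfspace_Re_lt convex_connected convex_Int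
        convex_halfspace_Re_gt convex_halfspace_Re_lt)
qed

text \<open>Expanding $t^{-(w - z)} = \sum_n (-\ln t)^n (w-z)^n / n!$ under the integral sign
  gives a power series; the partial sums are dominated by $t^r + t^{-r}$.\<close>

lemma mellin_holomorphic:
  assumes "mellin_conv f a" "mellin_conv f b"
  shows "mellin f holomorphic_on {s. a < Re s \<and> Re s < b}"
proof -
  have [measurable]: "f \<in> borel_measurable Lpos" using assms by (simp add: mellin_conv_def)
  have "\<exists>r>0. mellin f holomorphic_on ball z r" if z: "a < Re z" "Re z < b" for z
  proof -
    \<comment> \<open>The largest radius for which Re z - r and Re z + r stay in [a, b], so that the
      majorant \<open>W\<close> is integrable.\<close>
    define r where "r = min (Re z - a) (b - Re z)"
    have r: "r > 0" "a \<le> Re z - r" "Re z + r \<le> b" using z by (auto simp: r_def)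
    define u where "u = (\<lambda>n t. of_real t powr (- z - 1) * f t * ((- of_real (ln t)) ^ n / fact n))"
    have u_meas [measurable]: "u n \<in> borel_measurable Lpos" for n
      unfolding u_def by measurable
    define W where "W = (\<lambda>t. (t powr (- (Re z + r) - 1) + t powr (- (Re z - r) - 1)) * norm (f t))"
    have W: "integrable Lpos W"
    proof -
      have "mellin_conv f (Re z + r)" "mellin_conv f (Re z - r)"
        using mellin_conv_between[OF assms] r by auto
      then show ?thesis unfolding W_def mellin_conv_def by (simp add: algebra_simps)
    qed
    \<comment> \<open>Used twice: with q = r it makes each coefficient \<open>u n\<close>
      integrable, with q = |w - z| it dominates the partial sums.\<close>
    have bd: "(\<Sum>n<N. norm (u n t) * q ^ n) \<le> W t" if "t > 0" "0 \<le> q" "q \<le> r" for N t q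
    proof -
      have "(\<Sum>n<N. norm (u n t) * q ^ n)
          = t powr (- Re z - 1) * norm (f t) * (\<Sum>n<N. (q * \<bar>ln t\<bar>) ^ n / fact n)"
        using that by (simp add: u_def norm_mult norm_powr_real_powr norm_divide norm_power
            sum_distrib_left power_mult_distrib mult_ac)
      also have "\<dots> \<le> t powr (- Re z - 1) * norm (f t) * exp (q * \<bar>ln t\<bar>)"
      proof (intro mult_left_mono)
        have "(\<lambda>n. (q * \<bar>ln t\<bar>) ^ n / fact n) sums exp (q * \<bar>ln t\<bar>)"
          using exp_converges[of "q * \<bar>ln t\<bar>"] by (simp add: divide_inverse mult.commute)
        then show "(\<Sum>n<N. (q * \<bar>ln t\<bar>) ^ n / fact n) \<le> exp (q * \<bar>ln t\<bar>)"
          using that by (intro sum_le_suminf[THEN order_trans[OF _ eq_refl]] sums_unique[symmetric]) (auto intro: sums_summable)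
      qed auto
      also have "exp (q * \<bar>ln t\<bar>) \<le> exp (r * \<bar>ln t\<bar>)" using that by (simp add: mult_right_mono)
      also have "exp (r * \<bar>ln t\<bar>) \<le> t powr r + t powr (- r)"
        using that by (cases "ln t \<ge> 0") (auto simp: powr_def)
      finally have "(\<Sum>n<N. norm (u n t) * q ^ n) \<le> t powr (- Re z - 1) * norm (f t) * (t powr r + t powr (- r))"
        by (simp add: mult_left_mono)
      also have "\<dots> = W t" by (simp add: W_def algebra_simps flip: powr_add)
      finally show ?thesis .
    qed
    have ui: "integrable Lpos (u n)" for n
    proof (rule Bochner_Integration.integrable_bound)
      show "integrable Lpos (\<lambda>t. W t / r ^ n)" using W by simp
      show "AE t in Lpos. norm (u n t) \<le> norm (W t / r ^ n)"
        using AE_Lpos_pos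
      proof eventually_elim
        case (elim t)
        have "norm (u n t) * r ^ n \<le> (\<Sum>k<Suc n. norm (u k t) * r ^ k)"
          using r by (intro member_le_sum) auto
        also have "\<dots> \<le> W t" using elim r by (intro bd) auto
        finally show ?case using r by (simp add: field_simps)
      qed
    qed measurable
    have "(\<lambda>n. integral\<^sup>L Lpos (u n) * (w - z) ^ n) sums mellin f w" if w: "w \<in> ball z r" for w
    proof -
      have nw: "norm (w - z) \<le> r" using w by (simp add: dist_norm norm_minus_commute)
      have "(\<lambda>N. integral\<^sup>L Lpos (\<lambda>t. \<Sum>n<N. u n t * (w - z) ^ n)) \<longlonglongrightarrow>
            integral\<^sup>L Lpos (\<lambda>t. of_real t powr (- w - 1) * f t)"
      proof (rule integral_dominated_convergence[where w = W])
        show "AE t in Lpos. (\<lambda>N. \<Sum>n<N. u n t * (w - z) ^ n) \<longlonglongrightarrow> of_real t powr (- w - 1) * f t"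
          using AE_Lpos_pos
        proof eventually_elim
          case (elim t)
          have e1: "(\<lambda>n. of_real t powr (- z - 1) * f t * ((- of_real (ln t) * (w - z)) ^ n /\<^sub>R fact n)) sums
             (of_real t powr (- z - 1) * f t * exp (- of_real (ln t) * (w - z)))"
            by (intro sums_mult exp_converges)
          have e2: "of_real t powr (- z - 1) * f t * exp (- of_real (ln t) * (w - z)) = of_real t powr (- w - 1) * f t"
            using elim by (simp add: powr_def Ln_of_real flip: exp_add)
              (intro disjI2 arg_cong[of _ _ exp], simp add: algebra_simps)
          have e3: "of_real t powr (- z - 1) * f t * ((- of_real (ln t) * (w - z)) ^ n /\<^sub>R fact n) = u n t * (w - z) ^ n" for n
            unfolding u_def power_mult_distrib scaleR_conv_of_real by (simp add: divide_inverse mult_ac)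
          show ?case using e1 unfolding e2 e3 sums_def .
        qed
        show "AE t in Lpos. norm (\<Sum>n<N. u n t * (w - z) ^ n) \<le> W t" for N
          using AE_Lpos_pos
        proof eventually_elim
          case (elim t)
          have "norm (\<Sum>n<N. u n t * (w - z) ^ n) \<le> (\<Sum>n<N. norm (u n t) * norm (w - z) ^ n)"
            by (intro sum_norm_le) (simp add: norm_mult norm_power)
          also have "\<dots> \<le> W t" using elim nw by (intro bd) auto
          finally show ?case .
        qed
      qed (use W in measurable)
      then show ?thesis
        using ui by (simp add: sums_def mellin_def)
    qed
    then show ?thesis using r by (intro exI[of _ r] conjI power_series_holomorphic) auto
  qed
  then show ?thesis
    by (metis (mono_tags, lifting) analytic_imp_holomorphic analytic_on_def mem_Collect_eq)
qed

text \<open>Local form for sets such as half-planes, which no single pair of exponents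
  covers.\<close>

lemma mellin_holomorphic_on:
  assumes "\<And>s. s \<in> S \<Longrightarrow> \<exists>a b. a < Re s \<and> Re s < b \<and> mellin_conv f a \<and> mellin_conv f b"
  shows "mellin f holomorphic_on S"
proof (rule analytic_imp_holomorphic, unfold analytic_on_holomorphic, rule exI)
  define U where "U = \<Union>{{s. a < Re s \<and> Re s < b} |a b. mellin_conv f a \<and> mellin_conv f b}"
  have "open U" unfolding U_def using open_Re_strip by blast
  moreover have "S \<subseteq> U" using assms unfolding U_def by blast
  moreover have "\<exists>r>0. mellin f holomorphic_on ball s r" if "s \<in> U" for s
  proof -
    obtain a b where ab: "s \<in> {s. a < Re s \<and> Re s < b}" "mellin_conv f a" "mellin_conv f b"
      using \<open>s \<in> U\<close> by (auto simp: U_def)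
    then obtain r where "r > 0" "ball s r \<subseteq> {s. a < Re s \<and> Re s < b}"
      using open_Re_strip open_contains_ball by metis
    then show ?thesis using mellin_holomorphic[OF ab(2,3)] holomorphic_on_subset by blast
  qed
  then have "mellin f holomorphic_on U"
    by (auto intro: analytic_imp_holomorphic simp: analytic_on_def)
  ultimately show "open U \<and> S \<subseteq> U \<and> mellin f holomorphic_on U" by blast
qed

section \<open>Changes of variable on the half-line and multiplicative convolution\<close>

lemma Lpos_substitution:
  fixes f :: "real \<Rightarrow> 'a :: euclidean_space"
  assumes "\<And>x. x > 0 \<Longrightarrow> (g has_field_derivative h x) (at x)" "inj_on g {0<..}" "g ` {0<..} = {0<..}"
  shows "integrable Lpos f \<longleftrightarrow> integrable Lpos (\<lambda>x. \<bar>h x\<bar> *\<^sub>R f (g x))"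
    and "integral\<^sup>L Lpos f = integral\<^sup>L Lpos (\<lambda>x. \<bar>h x\<bar> *\<^sub>R f (g x))"
proof -
  have *: "integrable Lpos k \<longleftrightarrow> k absolutely_integrable_on {0<..}" for k :: "real \<Rightarrow> 'a"
    by (simp add: integrable_restrict_space set_integrable_def)
  have **: "integral\<^sup>L Lpos k = integral {0<..} k" if "k absolutely_integrable_on {0<..}" for k :: "real \<Rightarrow> 'a"
    using set_lebesgue_integral_eq_integral(2)[OF that]
    by (simp add: integral_restrict_space set_lebesgue_integral_def)
  have d: "(g has_field_derivative h x) (at x within {0<..})" if "x \<in> {0<..}" for x
    using assms(1)[of x] that by (auto intro: DERIV_subset)
  have S: "{0::real<..} \<in> sets lebesgue" by auto
  show 1: "integrable Lpos f \<longleftrightarrow> integrable Lpos (\<lambda>x. \<bar>h x\<bar> *\<^sub>R f (g x))"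
    unfolding * using absolutely_integrable_change_of_variables_real[OF S d assms(2), of f] assms(3) by simp
  show "integral\<^sup>L Lpos f = integral\<^sup>L Lpos (\<lambda>x. \<bar>h x\<bar> *\<^sub>R f (g x))"
  proof (cases "integrable Lpos f")
    case True
    with 1 show ?thesis
      using has_absolute_integral_change_of_variables_real[OF S d assms(2), of f "integral {0<..} f"] assms(3) **
      by (auto simp: *)
  \<comment> \<open>Without integrability both sides are the default value 0, by the first
    claim.\<close>
  qed (use 1 in \<open>auto simp: not_integrable_integral_eq\<close>)
qed

lemma Lpos_scale:
  fixes f :: "real \<Rightarrow> 'a :: euclidean_space"
  assumes "c > 0"
  shows "integrable Lpos f \<longleftrightarrow> integrable Lpos (\<lambda>x. f (c * x))"
    and "integral\<^sup>L Lpos f = c *\<^sub>R integral\<^sup>L Lpos (\<lambda>x. f (c * x))"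
proof -
  have im: "(*) c ` {0<..} = {0<..}"
  proof safe
    fix x :: real assume "x > 0"
    then show "x \<in> (*) c ` {0<..}" using assms by (intro image_eqI[of _ _ "x / c"]) auto
  qed (use assms in auto)
  note * = Lpos_substitution[of "(*) c" "\<lambda>_. c" f, OF _ _ im]
  show "integrable Lpos f \<longleftrightarrow> integrable Lpos (\<lambda>x. f (c * x))"
  proof -
    have "integrable Lpos (\<lambda>x. f (c * x))" if "integrable Lpos (\<lambda>x. c *\<^sub>R f (c * x))"
      using integrable_scaleR_right[of "inverse c", OF that] assms by simp
    then show ?thesis
      using assms by (subst *(1)) (auto intro!: derivative_eq_intros simp: inj_on_def)
  qed
  show "integral\<^sup>L Lpos f = c *\<^sub>R integral\<^sup>L Lpos (\<lambda>x. f (c * x))"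
    using assms by (subst *(2)) (auto intro!: derivative_eq_intros simp: inj_on_def)
qed

lemma Lpos_inverse:
  fixes f :: "real \<Rightarrow> 'a :: euclidean_space"
  shows "integral\<^sup>L Lpos f = integral\<^sup>L Lpos (\<lambda>x. inverse (x ^ 2) *\<^sub>R f (inverse x))"
proof -
  have im: "inverse ` {0<..} = {0::real<..}"
  proof safe
    fix x :: real assume "x > 0"
    then show "x \<in> inverse ` {0<..}" by (intro image_eqI[of _ _ "inverse x"]) auto
  qed auto
  show ?thesis
    by (subst Lpos_substitution(2)[of inverse "\<lambda>x. - inverse (x ^ 2)", OF _ _ im])
       (auto intro!: derivative_eq_intros simp: inj_on_def power2_eq_square)
qed

text \<open>Convolution for the Haar measure du/u. The substitution t = 1/u brings
  \<open>G_op\<close> to this form, with \<phi> evaluated at u itself.\<close>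

definition mult_conv :: "(real \<Rightarrow> complex) \<Rightarrow> (real \<Rightarrow> complex) \<Rightarrow> real \<Rightarrow> complex" where
  "mult_conv f h x = (\<integral>u. f (x / u) * h u / of_real u \<partial>Lpos)"

text \<open>A dilation by c multiplies the transform by c^(-s). The version for absolute values
  supplies the bounds for Fubini and for termwise integration.\<close>

lemma mellin_scale:
  assumes c: "c > 0"
  shows "mellin_conv f a \<Longrightarrow> integrable Lpos (\<lambda>t. t powr (- a - 1) * norm (f (t / c)))"
    and "(\<integral>t. t powr (- a - 1) * norm (f (t / c)) \<partial>Lpos) = c powr (- a) * (\<integral>t. t powr (- a - 1) * norm (f t) \<partial>Lpos)"
    and "(\<integral>t. of_real t powr (- s - 1) * f (t / c) \<partial>Lpos) = of_real c powr (- s) * mellin f s"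
proof -
  show "integrable Lpos (\<lambda>t. t powr (- a - 1) * norm (f (t / c)))" if "mellin_conv f a"
  proof (subst Lpos_scale(1)[OF c])
    have "integrable Lpos (\<lambda>x. c powr (- a - 1) * (x powr (- a - 1) * norm (f x)))"
      using that by (simp add: mellin_conv_def)
    then show "integrable Lpos (\<lambda>x. (c * x) powr (- a - 1) * cmod (f (c * x / c)))"
      by (rule Bochner_Integration.integrable_cong[THEN iffD1, rotated 2])
         (use c in \<open>auto simp: powr_mult space_restrict_space\<close>)
  qed
  show "(\<integral>t. t powr (- a - 1) * norm (f (t / c)) \<partial>Lpos) = c powr (- a) * (\<integral>t. t powr (- a - 1) * norm (f t) \<partial>Lpos)"
  proof -
    have "(\<integral>t. t powr (- a - 1) * norm (f (t / c)) \<partial>Lpos) = c * (\<integral>x. (c * x) powr (- a - 1) * norm (f x) \<partial>Lpos)"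
      using c by (subst Lpos_scale(2)[OF c]) simp
    also have "(\<integral>x. (c * x) powr (- a - 1) * norm (f x) \<partial>Lpos) = 
        (\<integral>x. c powr (- a - 1) * (x powr (- a - 1) * norm (f x)) \<partial>Lpos)"
      using c by (intro Bochner_Integration.integral_cong) (auto simp: powr_mult space_restrict_space)
    also have "c * \<dots> = c powr (1 + (-a-1)) * (\<integral>t. t powr (- a - 1) * norm (f t) \<partial>Lpos)"
      using c by (simp only: powr_add) simp
    finally show ?thesis by simp
  qed
  show "(\<integral>t. of_real t powr (- s - 1) * f (t / c) \<partial>Lpos) = of_real c powr (- s) * mellin f s"
  proof -
    have "(\<integral>t. of_real t powr (- s - 1) * f (t / c) \<partial>Lpos) = c *\<^sub>R (\<integral>x. of_real (c * x) powr (- s - 1) * f x \<partial>Lpos)"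
      using c by (subst Lpos_scale(2)[OF c]) simp
    also have "(\<integral>x. of_real (c * x) powr (- s - 1) * f x \<partial>Lpos) = 
        (\<integral>x. of_real c powr (- s - 1) * (of_real x powr (- s - 1) * f x) \<partial>Lpos)"
      using c by (intro Bochner_Integration.integral_cong) (auto simp: powr_times_real space_restrict_space)
    also have "c *\<^sub>R \<dots> = of_real c powr (1 + (-s-1)) * mellin f s"
      using c by (simp only: powr_add) (simp add: mellin_def scaleR_conv_of_real)
    finally show ?thesis by simp
  qed
qed

text \<open>Fubini after the dilation x = u t. Taking \<open>f\<close> Borel makes (x, u) -> f(x/u)
  measurable for the product sigma-algebra by mere composition.\<close>

lemma mellin_mult_conv:
  assumes f: "f \<in> borel_measurable borel" "mellin_conv f (Re s)" and h: "mellin_conv h (Re s)"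
  shows "mellin_conv (mult_conv f h) (Re s)"
    and "mellin (mult_conv f h) s = mellin f s * mellin h s"
proof -
  note [measurable] = f(1)
  have hm [measurable]: "h \<in> borel_measurable Lpos" using h by (simp add: mellin_conv_def)
  interpret L: sigma_finite_measure Lpos by (rule sigma_finite_Lpos)
  interpret P: pair_sigma_finite Lpos Lpos ..
  have idm: "(\<lambda>p. fst p) \<in> Lpos \<Otimes>\<^sub>M Lpos \<rightarrow>\<^sub>M borel" "(\<lambda>p. snd p) \<in> Lpos \<Otimes>\<^sub>M Lpos \<rightarrow>\<^sub>M borel"
    by (rule measurable_compose[OF _ id_Lpos_borel], simp)+
  note [measurable] = idm
  define F where "F = (\<lambda>u x. of_real x powr (- s - 1) * (f (x / u) * h u / of_real u))"
  have hsnd: "(\<lambda>p. h (fst p)) \<in> borel_measurable (Lpos \<Otimes>\<^sub>M Lpos)" "(\<lambda>p. h (snd p)) \<in> borel_measurable (Lpos \<Otimes>\<^sub>M Lpos)"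
    by (rule measurable_compose[OF _ hm], simp)+
  note [measurable] = hsnd
  have Fm: "case_prod F \<in> borel_measurable (Lpos \<Otimes>\<^sub>M Lpos)"
    unfolding F_def case_prod_unfold by measurable
  have Cm: "mult_conv f h \<in> borel_measurable Lpos"
    unfolding mult_conv_def by (rule L.borel_measurable_lebesgue_integral) (simp add: case_prod_unfold)
  have nF: "norm (F u x) = norm (h u) / u * (x powr (- Re s - 1) * norm (f (x / u)))" if "x > 0" "u > 0" for u x
    using that by (simp add: F_def norm_mult norm_powr_real_powr norm_divide)
  have int: "integrable (Lpos \<Otimes>\<^sub>M Lpos) (case_prod F)"
  proof (rule P.Fubini_integrable[OF Fm])
    have e: "(\<integral>x. norm (F u x) \<partial>Lpos) = u powr (- Re s - 1) * norm (h u) * (\<integral>t. t powr (- Re s - 1) * norm (f t) \<partial>Lpos)"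
      if "u > 0" for u
    proof -
      have "(\<integral>x. norm (F u x) \<partial>Lpos) = (\<integral>x. norm (h u) / u * (x powr (- Re s - 1) * norm (f (x / u))) \<partial>Lpos)"
        using that nF by (intro Bochner_Integration.integral_cong) (auto simp: space_restrict_space)
      also have "\<dots> = norm (h u) / u * (u powr (- Re s) * (\<integral>t. t powr (- Re s - 1) * norm (f t) \<partial>Lpos))"
        by (simp only: integral_mult_right_zero mellin_scale(2)[OF that])
      finally show ?thesis using that by (simp add: powr_diff)
    qed
    have "integrable Lpos (\<lambda>u. u powr (- Re s - 1) * norm (h u) * (\<integral>t. t powr (- Re s - 1) * norm (f t) \<partial>Lpos))"
      using h by (simp add: mellin_conv_def)
    then show "integrable Lpos (\<lambda>u. \<integral>x. norm (case_prod F (u, x)) \<partial>Lpos)"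
      by (rule Bochner_Integration.integrable_cong[THEN iffD1, rotated 2]) (auto simp: e space_restrict_space)
    show "AE u in Lpos. integrable Lpos (\<lambda>x. case_prod F (u, x))"
      using AE_Lpos_pos
    proof eventually_elim
      case (elim u)
      have "integrable Lpos (\<lambda>x. norm (h u) / u * (x powr (- Re s - 1) * norm (f (x / u))))"
        using mellin_scale(1)[OF elim f(2)] by simp
      then show ?case
      proof (rule Bochner_Integration.integrable_bound)
        have [measurable]: "(\<lambda>x. f (x / u)) \<in> borel_measurable Lpos"
          by (rule borel_imp_Lpos) measurable
        show "(\<lambda>x. case_prod F (u, x)) \<in> borel_measurable Lpos"
          unfolding F_def case_prod_conv by measurable
        show "AE x in Lpos. norm (case_prod F (u, x)) \<le> norm (norm (h u) / u * (x powr (- Re s - 1) * norm (f (x / u))))"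
          using AE_Lpos_pos by eventually_elim (simp add: nF elim abs_of_pos[OF elim])
      qed
    qed
  qed
  have FC: "(\<integral>u. F u x \<partial>Lpos) = of_real x powr (- s - 1) * mult_conv f h x" for x
    unfolding F_def mult_conv_def by (rule integral_mult_right_zero)
  have "integrable Lpos (\<lambda>x. of_real x powr (- s - 1) * mult_conv f h x)"
    using P.integrable_snd[OF int] by (simp add: FC)
  then have "integrable Lpos (\<lambda>x. norm (of_real x powr (- s - 1) * mult_conv f h x))"
    by (rule integrable_norm)
  then have "integrable Lpos (\<lambda>x. x powr (- Re s - 1) * norm (mult_conv f h x))"
    by (rule Bochner_Integration.integrable_cong[THEN iffD1, rotated 2])
       (auto simp: space_restrict_space norm_mellin_kernel)
  with Cm show "mellin_conv (mult_conv f h) (Re s)" by (simp add: mellin_conv_def)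
  have "mellin (mult_conv f h) s = (\<integral>x. (\<integral>u. F u x \<partial>Lpos) \<partial>Lpos)"
    by (simp add: mellin_def FC)
  also have "\<dots> = (\<integral>u. (\<integral>x. F u x \<partial>Lpos) \<partial>Lpos)"
    by (rule P.Fubini_integral[OF int])
  also have "\<dots> = (\<integral>u. mellin f s * (of_real u powr (- s - 1) * h u) \<partial>Lpos)"
  proof (intro Bochner_Integration.integral_cong refl)
    fix u assume "u \<in> space Lpos"
    then have u: "u > 0" by (simp add: space_restrict_space)
    have "(\<integral>x. F u x \<partial>Lpos) = (\<integral>x. h u / of_real u * (of_real x powr (- s - 1) * f (x / u)) \<partial>Lpos)"
      by (simp add: F_def mult_ac)
    also have "\<dots> = h u / of_real u * (of_real u powr (- s) * mellin f s)"
      by (simp only: integral_mult_right_zero mellin_scale(3)[OF u])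
    finally show "(\<integral>x. F u x \<partial>Lpos) = mellin f s * (of_real u powr (- s - 1) * h u)"
      using u by (simp add: powr_diff)
  qed
  also have "\<dots> = mellin f s * mellin h s"
    by (simp add: mellin_def)
  finally show "mellin (mult_conv f h) s = mellin f s * mellin h s" .
qed

lemma G_op_eq_mult_conv:
  assumes "x > 0"
  shows "G_op \<phi> x = mult_conv (\<lambda>t. of_real (g_sum t)) \<phi> x"
proof -
  have "G_op \<phi> x = (\<integral>t. inverse (t ^ 2) *\<^sub>R (of_real (g_sum (x * inverse t)) * \<phi> (inverse (inverse t)) * of_real (inverse (inverse t))) \<partial>Lpos)"
    unfolding G_op_def by (rule Lpos_inverse)
  also have "\<dots> = mult_conv (\<lambda>t. of_real (g_sum t)) \<phi> x"
    unfolding mult_conv_def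
    by (intro Bochner_Integration.integral_cong)
       (auto simp: space_restrict_space field_simps power2_eq_square scaleR_conv_of_real)
  finally show ?thesis .
qed

subsection \<open>Dirichlet series\<close>

lemma identity_real_interval:
  assumes "f holomorphic_on S" "g holomorphic_on S" "open S" "connected S" "of_real a \<in> S" "a < b"
    and eq: "\<And>x. a < x \<Longrightarrow> x < b \<Longrightarrow> of_real x \<in> S \<Longrightarrow> f (of_real x) = g (of_real x)"
    and z: "z \<in> S"
  shows "f z = (g z :: complex)"
proof -
  define U where "U = S \<inter> of_real ` {a<..<b}"
  have lim: "(of_real a :: complex) islimpt U"
    unfolding islimpt_approachable
  proof safe
    fix e :: real assume e: "e > 0"
    obtain d where d: "d > 0" "ball (of_real a) d \<subseteq> S"
      using assms(3,5) open_contains_ball by blast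
    define x where "x = a + min (min e d) (b - a) / 2"
    have x: "a < x" "x < b" "x - a < e" "x - a < d" using e d \<open>a < b\<close> by (auto simp: x_def min_def field_simps)
    have "dist (of_real x) (of_real a :: complex) = x - a"
      using x by (simp only: dist_of_real) (simp add: dist_real_def)
    then show "\<exists>x'\<in>U. x' \<noteq> of_real a \<and> dist x' (of_real a) < e"
      using x d by (intro bexI[of _ "of_real x"]) (auto simp: U_def dist_commute)
  qed
  have "f z - g z = 0"
  proof (rule analytic_continuation[OF _ assms(3,4) _ assms(5) lim _ z])
    show "(\<lambda>z. f z - g z) holomorphic_on S" using assms(1,2) by (rule holomorphic_on_diff)
  qed (auto simp: U_def eq)
  then show ?thesis by simp
qed

text \<open>A fixed prime p dividing n pairs each squarefree divisor d prime to p with p d, and the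
  two members of a pair have opposite signs.\<close>

lemma sum_divisors_moebius_mu:
  assumes "n > 0"
  shows "(\<Sum>d | d dvd n. moebius_mu d) = (if n = 1 then 1 else 0)"
proof (cases "n = 1")
  case True
  then show ?thesis by (simp add: moebius_mu_def)
next
  case False
  with assms obtain p where p: "prime p" "p dvd n" using prime_factor_nat by blast
  define S where "S = {d. d dvd n \<and> squarefree d}"
  define S0 where "S0 = {d\<in>S. \<not> p dvd d}"
  define S1 where "S1 = {d\<in>S. p dvd d}"
  have fin: "finite {d. d dvd n}" using assms by simp
  have finS: "finite S" "finite S0" "finite S1"
    by (rule finite_subset[OF _ fin], auto simp: S_def S0_def S1_def)+
  have "(\<Sum>d | d dvd n. moebius_mu d) = sum moebius_mu S"
    using fin by (intro sum.mono_neutral_right) (auto simp: S_def moebius_mu_def)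
  also have "S = S0 \<union> S1" by (auto simp: S0_def S1_def)
  also have "sum moebius_mu (S0 \<union> S1) = sum moebius_mu S0 + sum moebius_mu S1"
    using finS by (intro sum.union_disjoint) (auto simp: S0_def S1_def)
  also have "sum moebius_mu S1 = (\<Sum>d\<in>S0. moebius_mu (p * d))"
  proof (rule sum.reindex_bij_betw[symmetric])
    show "bij_betw ((*) p) S0 S1"
    proof (rule bij_betw_byWitness[where f' = "\<lambda>d. d div p"])
      show "(*) p ` S0 \<subseteq> S1"
      proof safe
        fix d assume "d \<in> S0"
        then have d: "d dvd n" "squarefree d" "\<not> p dvd d" by (auto simp: S0_def S_def)
        then have c: "coprime p d" using p prime_imp_coprime by blast
        have "squarefree (p * d)" by (rule squarefree_mult_coprime[OF c squarefree_prime[OF p(1)] d(2)])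
        moreover have "p * d dvd n" using c d p by (intro divides_mult)
        ultimately show "p * d \<in> S1" by (simp add: S1_def S_def)
      qed
      show "(\<lambda>d. d div p) ` S1 \<subseteq> S0"
      proof safe
        fix e assume "e \<in> S1"
        then have e: "e dvd n" "squarefree e" "p dvd e" by (auto simp: S1_def S_def)
        then obtain d where d: "e = p * d" by blast
        have "p > 0" using p(1) by (rule prime_gt_0_nat)
        have "\<not> p dvd d"
        proof
          assume "p dvd d"
          then have "p ^ 2 dvd e" unfolding d power2_eq_square by (intro mult_dvd_mono) auto
          then have "p dvd 1" using e(2) squarefreeD by blast
          then show False using p(1) by simp
        qed
        moreover have "d dvd n" "squarefree d"
          using e(1) d squarefree_mono[of d e] e(2) dvd_mult_right[of p d n] by auto
        ultimately show "e div p \<in> S0" using d \<open>p > 0\<close> by (simp add: S0_def S_def)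
      qed
    qed (use prime_gt_0_nat[OF p(1)] in \<open>auto simp: S1_def\<close>)
  qed
  also have "\<dots> = (\<Sum>d\<in>S0. - moebius_mu d)"
  proof (intro sum.cong refl)
    fix d assume "d \<in> S0"
    then have d: "d dvd n" "squarefree d" "\<not> p dvd d" by (auto simp: S0_def S_def)
    then have c: "coprime p d" using p prime_imp_coprime by blast
    have "squarefree (p * d)" by (rule squarefree_mult_coprime[OF c squarefree_prime[OF p(1)] d(2)])
    moreover have "d \<noteq> 0" using d by (intro notI) simp
    then have "prime_factors (p * d) = insert p (prime_factors d)"
      using p(1) prime_gt_0_nat[OF p(1)] by (subst prime_factors_product) (auto simp: prime_factorization_prime)
    moreover have "p \<notin> prime_factors d" using d by (auto simp: prime_factors_dvd)
    ultimately show "moebius_mu (p * d) = - moebius_mu d"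
      using d by (simp add: moebius_mu_def)
  qed
  finally show ?thesis using False by (simp add: sum_negf)
qed

lemma abs_moebius_mu_le: "\<bar>moebius_mu n\<bar> \<le> 1"
  by (auto simp: moebius_mu_def)

section \<open>Absolutely convergent Dirichlet series for zeta, its inverse and its logarithmic
  derivative\<close>

definition dirichlet :: "(nat \<Rightarrow> complex) \<Rightarrow> complex \<Rightarrow> complex" where
  "dirichlet a s = (\<Sum>n. a (Suc n) / of_nat (Suc n) powr s)"

definition dirichlet_conv :: "(nat \<Rightarrow> complex) \<Rightarrow> complex \<Rightarrow> bool" where
  "dirichlet_conv a s \<longleftrightarrow> summable (\<lambda>n. norm (a (Suc n)) / real (Suc n) powr Re s)"

lemma norm_dirichlet_term: "norm (a / of_nat (Suc n) powr s) = norm a / real (Suc n) powr Re s"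
  by (simp add: norm_divide norm_powr_real_powr)

lemma dirichlet_sums: "dirichlet_conv a s \<Longrightarrow> (\<lambda>n. a (Suc n) / of_nat (Suc n) powr s) sums dirichlet a s"
  unfolding dirichlet_def dirichlet_conv_def
  by (rule summable_sums, rule summable_norm_cancel) (simp only: norm_dirichlet_term)

lemma bij_Suc: "bij_betw Suc UNIV {0<..}"
  by (auto simp: bij_betw_def image_iff intro: gr0_implies_Suc)

text \<open>Passes to unordered sums over the positive integers, so that products of series can be
  regrouped.\<close>

lemma dirichlet_has_sum:
  assumes "dirichlet_conv a s"
  shows "((\<lambda>n. a n / of_nat n powr s) has_sum dirichlet a s) {0<..}"
    and "(\<lambda>n. norm (a n / of_nat n powr s)) summable_on {0<..}"
proof -
  have "((\<lambda>n. a (Suc n) / of_nat (Suc n) powr s) has_sum dirichlet a s) UNIV"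
    using assms by (intro norm_summable_imp_has_sum dirichlet_sums) (simp_all only: norm_dirichlet_term dirichlet_conv_def)
  then show "((\<lambda>n. a n / of_nat n powr s) has_sum dirichlet a s) {0<..}"
    by (subst has_sum_reindex_bij_betw[OF bij_Suc, symmetric])
  have "(\<lambda>n. norm (a (Suc n) / of_nat (Suc n) powr s)) summable_on UNIV"
    using assms by (intro norm_summable_imp_summable_on) (simp only: norm_dirichlet_term dirichlet_conv_def, simp)
  then show "(\<lambda>n. norm (a n / of_nat n powr s)) summable_on {0<..}"
    by (subst summable_on_reindex_bij_betw[OF bij_Suc, symmetric])
qed

lemma dirichlet_mult:
  assumes "dirichlet_conv a s" "dirichlet_conv b s"
  shows "(\<lambda>n. (\<Sum>d | d dvd Suc n. a d * b (Suc n div d)) / of_nat (Suc n) powr s) sums (dirichlet a s * dirichlet b s)"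
proof -
  define A where "A = (\<lambda>n. a n / of_nat n powr s)"
  define B where "B = (\<lambda>n. b n / of_nat n powr s)"
  define N where "N = {0::nat<..}"
  have A: "(A has_sum dirichlet a s) N" "(\<lambda>n. norm (A n)) summable_on N" and B: "(B has_sum dirichlet b s) N" "(\<lambda>n. norm (B n)) summable_on N"
    using dirichlet_has_sum[OF assms(1)] dirichlet_has_sum[OF assms(2)] by (simp_all add: A_def B_def N_def)
  define F where "F = (\<lambda>(m,k). A m * B k)"
  have "(\<lambda>x. norm (F x)) summable_on N \<times> N"
    unfolding Infinite_Sum.abs_summable_on_Sigma_iff F_def
    using A(2) B(2)
    by (auto simp: norm_mult infsum_cmult_right' abs_mult infsum_nonneg
             intro!: summable_on_cmult_right summable_on_cmult_left)
  then have "F summable_on N \<times> N" by (rule Infinite_Sum.abs_summable_summable)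
  then have "(F has_sum (dirichlet a s * dirichlet b s)) (N \<times> N)"
    by (intro has_sum_SigmaI[where g = "\<lambda>m. A m * dirichlet b s"])
       (auto simp: F_def intro!: has_sum_cmult_right has_sum_cmult_left A B)
  \<comment> \<open>Pairs (m, k) are regrouped by their product n, with m running through the
    divisors of n.\<close>
  moreover have bij: "bij_betw (\<lambda>(n,d). (d, n div d)) (Sigma N (\<lambda>n. {d. d dvd n})) (N \<times> N)"
    by (rule bij_betw_byWitness[where f' = "\<lambda>(m,k). (m * k, m)"]) (auto simp: N_def elim!: dvdE)
  ultimately have "((\<lambda>(n,d). F (d, n div d)) has_sum (dirichlet a s * dirichlet b s)) (Sigma N (\<lambda>n. {d. d dvd n}))"
    using has_sum_reindex_bij_betw[OF bij, of F] by (simp add: case_prod_unfold)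
  then have "((\<lambda>n. \<Sum>d | d dvd n. F (d, n div d)) has_sum (dirichlet a s * dirichlet b s)) N"
    by (rule has_sum_SigmaD) (auto simp: N_def intro!: has_sum_finiteI)
  moreover have "(\<Sum>d | d dvd n. F (d, n div d)) = (\<Sum>d | d dvd n. a d * b (n div d)) / of_nat n powr s"
    if "n \<in> N" for n
  proof -
    have "F (d, n div d) = a d * b (n div d) / of_nat n powr s" if d: "d dvd n" for d
    proof -
      have "n = d * (n div d)" using d by simp
      then have "(of_nat n :: complex) powr s = of_nat d powr s * of_nat (n div d) powr s"
        by (metis of_nat_mult of_real_of_nat_eq powr_times_real of_nat_0_le_iff Re_complex_of_real Reals_of_real)
      then show ?thesis by (simp add: F_def A_def B_def)
    qed
    then show ?thesis by (simp add: sum_divide_distrib)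
  qed
  ultimately have "((\<lambda>n. (\<Sum>d | d dvd n. a d * b (n div d)) / of_nat n powr s) has_sum (dirichlet a s * dirichlet b s)) N"
    by (simp cong: has_sum_cong)
  then have "((\<lambda>n. (\<Sum>d | d dvd Suc n. a d * b (Suc n div d)) / of_nat (Suc n) powr s) has_sum (dirichlet a s * dirichlet b s)) UNIV"
    unfolding N_def by (subst has_sum_reindex_bij_betw[OF bij_Suc])
  then show ?thesis by (rule has_sum_imp_sums)
qed

lemma summable_Suc_powr: "\<sigma> > 1 \<Longrightarrow> summable (\<lambda>n. 1 / real (Suc n) powr \<sigma>)"
  using summable_real_powr_iff[of "-\<sigma>"]
  by (subst (asm) summable_Suc_iff[symmetric]) (simp add: powr_minus divide_inverse)

lemma dirichlet_conv_bounded: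
  assumes "\<And>n. norm (a n) \<le> C" "Re s > 1"
  shows "dirichlet_conv a s"
  unfolding dirichlet_conv_def
proof (rule summable_comparison_test')
  show "summable (\<lambda>n. C * (1 / real (Suc n) powr Re s))"
    using assms by (intro summable_mult summable_Suc_powr)
  show "norm (norm (a (Suc n)) / real (Suc n) powr Re s) \<le> C * (1 / real (Suc n) powr Re s)" for n
    using assms(1)[of "Suc n"] by (simp add: divide_right_mono)
qed

lemma dirichlet_conv_log_bounded:
  assumes "\<And>n. norm (a n) \<le> ln (real n)" "Re s > 1"
  shows "dirichlet_conv a s"
  unfolding dirichlet_conv_def
proof (rule summable_comparison_test')
  \<comment> \<open>Half of the excess of Re s over 1 absorbs the logarithm, by ln n \<le>
    n^\<delta> / \<delta>; the other half keeps the series convergent.\<close>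
  define \<delta> where "\<delta> = (Re s - 1) / 2"
  have \<delta>: "\<delta> > 0" "Re s - \<delta> > 1" using assms by (auto simp: \<delta>_def field_simps)
  show "summable (\<lambda>n. 1 / \<delta> * (1 / real (Suc n) powr (Re s - \<delta>)))"
    using \<delta> by (intro summable_mult summable_Suc_powr)
  fix n
  have "norm (a (Suc n)) \<le> ln (real (Suc n))" by (rule assms)
  also have "\<dots> \<le> real (Suc n) powr \<delta> / \<delta>" using \<delta> ln_powr_bound[of "real (Suc n)" \<delta>] by simp
  finally have "norm (a (Suc n)) / real (Suc n) powr Re s \<le> real (Suc n) powr \<delta> / \<delta> / real (Suc n) powr Re s"
    by (intro divide_right_mono) auto
  also have "\<dots> = 1 / \<delta> * (1 / real (Suc n) powr (Re s - \<delta>))"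
    by (simp add: powr_diff)
  finally show "norm (norm (a (Suc n)) / real (Suc n) powr Re s) \<le> 1 / \<delta> * (1 / real (Suc n) powr (Re s - \<delta>))"
    by simp
qed

text \<open>Zeta on Re s > 1, before any continuation is known to exist.\<close>

definition zs :: "complex \<Rightarrow> complex" where "zs = dirichlet (\<lambda>_. 1)"

lemma zs_sums: "Re s > 1 \<Longrightarrow> (\<lambda>n. 1 / of_nat (Suc n) powr s) sums zs s"
  unfolding zs_def using dirichlet_sums[of "\<lambda>_. 1" s] dirichlet_conv_bounded[of "\<lambda>_. 1" 1 s] by simp

definition mu_sum :: "complex \<Rightarrow> complex" where "mu_sum = dirichlet (\<lambda>n. of_int (moebius_mu n))"

lemma norm_mu_le: "norm (of_int (moebius_mu n) :: complex) \<le> 1"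
proof -
  have "norm (of_int (moebius_mu n) :: complex) = of_int \<bar>moebius_mu n\<bar>" by simp
  also have "\<dots> \<le> 1" using abs_moebius_mu_le[of n] by linarith
  finally show ?thesis .
qed

lemma zs_mult_mu_sum:
  assumes "Re s > 1"
  shows "zs s * mu_sum s = 1"
proof -
  have "(\<lambda>n. (\<Sum>d | d dvd Suc n. of_int (moebius_mu d) * 1) / of_nat (Suc n) powr s) sums (mu_sum s * zs s)"
    unfolding zs_def mu_sum_def using assms
    by (intro dirichlet_mult dirichlet_conv_bounded[of _ 1] norm_mu_le) auto
  also have "(\<lambda>n. (\<Sum>d | d dvd Suc n. of_int (moebius_mu d) * 1) / of_nat (Suc n) powr s) =
      (\<lambda>n. if n = 0 then 1 else (0::complex))"
  proof
    fix n
    have "(\<Sum>d | d dvd Suc n. of_int (moebius_mu d) * 1 :: complex) = of_int (\<Sum>d | d dvd Suc n. moebius_mu d)"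
      by simp
    also have "\<dots> = (if n = 0 then 1 else 0)"
      by (subst sum_divisors_moebius_mu) auto
    finally show "(\<Sum>d | d dvd Suc n. of_int (moebius_mu d) * 1) / of_nat (Suc n) powr s = (if n = 0 then 1 else (0::complex))"
      by simp
  qed
  finally have "(\<lambda>n. if n = 0 then 1 else (0::complex)) sums (mu_sum s * zs s)" .
  moreover have "(\<lambda>n. if n = 0 then 1 else (0::complex)) sums 1"
    using sums_If_finite_set[of "{0}" "\<lambda>_. 1::complex"] by simp
  ultimately show ?thesis by (metis mult.commute sums_unique2)
qed

text \<open>As the two functions are reciprocal, these upper bounds confine |zeta(s)| between
  1/zeta(2) and zeta(2) on Re s \<ge> 2.\<close>

lemma norm_zs_le:
  assumes "Re s \<ge> 2"
  shows "norm (zs s) \<le> Re (zs 2)" "norm (mu_sum s) \<le> Re (zs 2)"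
proof -
  have *: "norm (dirichlet a s) \<le> Re (zs 2)" if a: "\<And>n. norm (a n) \<le> 1" for a
  proof -
    have s2: "(\<lambda>n. 1 / real (Suc n) powr 2) sums Re (zs 2)"
    proof -
      have "(\<lambda>n. Re (1 / of_nat (Suc n) powr 2)) sums Re (zs 2)"
        using zs_sums[of 2] by (intro sums_Re) simp
      also have "(\<lambda>n. Re (1 / of_nat (Suc n) powr 2)) = (\<lambda>n. 1 / real (Suc n) powr 2)"
      proof
        fix n
        have "1 / of_nat (Suc n) powr (2::complex) = of_real (1 / real (Suc n) powr 2)"
          by (simp only: of_real_divide of_real_1 powr_of_real[symmetric] of_nat_0_le_iff of_real_of_nat_eq of_real_numeral)
        then show "Re (1 / of_nat (Suc n) powr 2) = 1 / real (Suc n) powr 2"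
          by (simp only: Re_complex_of_real)
      qed
      finally show ?thesis .
    qed
    have d: "dirichlet_conv a s" using a assms by (intro dirichlet_conv_bounded[of _ 1]) auto
    have le: "norm (a (Suc n)) / real (Suc n) powr Re s \<le> 1 / real (Suc n) powr 2" for n
      using a assms by (intro frac_le powr_mono) auto
    have "norm (dirichlet a s) \<le> (\<Sum>n. norm (a (Suc n)) / real (Suc n) powr Re s)"
      unfolding dirichlet_def norm_dirichlet_term[symmetric]
      using d by (intro summable_norm) (simp only: norm_dirichlet_term dirichlet_conv_def)
    also have "\<dots> \<le> (\<Sum>n. 1 / real (Suc n) powr 2)"
      using d s2 le by (intro suminf_le) (auto simp: dirichlet_conv_def sums_iff)
    also have "\<dots> = Re (zs 2)" using s2 by (simp add: sums_iff)
    finally show ?thesis .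
  qed
  show "norm (zs s) \<le> Re (zs 2)" "norm (mu_sum s) \<le> Re (zs 2)"
    unfolding mu_sum_def by (subst zs_def, rule *, simp) (rule *, rule norm_mu_le)
qed

lemma powr_minus_has_field_derivative:
  fixes c s :: complex
  assumes "c \<noteq> 0"
  shows "((\<lambda>s. c powr (- s)) has_field_derivative - Ln c * c powr (- s)) (at s)"
  using assms by (simp add: powr_def) (auto intro!: derivative_eq_intros)

lemma zs_deriv:
  shows zs_holomorphic: "zs holomorphic_on {s. Re s > 1}"
    and "Re s > 1 \<Longrightarrow> (\<lambda>n. - of_real (ln (real (Suc n))) / of_nat (Suc n) powr s) sums deriv zs s"
proof -
  have "\<exists>g g'. \<forall>s\<in>{s. Re s > 1}. ((\<lambda>n. 1 / of_nat (Suc n) powr s) sums g s) \<and>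
       ((\<lambda>n. - of_real (ln (real (Suc n))) / of_nat (Suc n) powr s) sums g' s) \<and> (g has_field_derivative g' s) (at s)"
  proof (rule series_and_derivative_comparison_complex)
    show "open {s. Re s > 1}" by (rule open_halfspace_Re_gt)
    show "((\<lambda>s. 1 / of_nat (Suc n) powr s) has_field_derivative - of_real (ln (real (Suc n))) / of_nat (Suc n) powr s) (at s)" for n and s :: complex
    proof -
      have "Ln (of_nat (Suc n)) = of_real (ln (real (Suc n)))"
        by (metis Ln_of_nat of_nat_0_less_iff zero_less_Suc of_real_of_nat_eq Ln_of_real)
      moreover have "((\<lambda>s. of_nat (Suc n) powr (- s)) has_field_derivative (- Ln (of_nat (Suc n)) * of_nat (Suc n) powr (- s))) (at s)"
        by (rule powr_minus_has_field_derivative) (simp del: of_nat_Suc)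
      ultimately show ?thesis by (simp add: powr_minus divide_inverse)
    qed
    fix s :: complex assume "s \<in> {s. Re s > 1}"
    then have s: "Re s > 1" by simp
    define \<delta> where "\<delta> = (Re s - 1) / 2"
    have \<delta>: "\<delta> > 0" "Re s - \<delta> > 1" using s by (auto simp: \<delta>_def field_simps)
    define h where "h = (\<lambda>n. complex_of_real (1 / real (Suc n) powr (Re s - \<delta>)))"
    have "summable h" unfolding h_def using summable_Suc_powr[OF \<delta>(2)] by (rule summable_of_real)
    moreover have "range h \<subseteq> \<real>\<^sub>\<ge>\<^sub>0" by (auto simp: h_def simp del: of_real_divide of_nat_Suc)
    moreover have "norm (1 / of_nat (Suc n) powr y) \<le> norm (h n)" if "y \<in> ball s \<delta>" for n y
    proof -
      have "\<bar>Re s - Re y\<bar> \<le> norm (s - y)" using abs_Re_le_cmod[of "s - y"] by simp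
      then have "Re s - \<delta> \<le> Re y" using that by (simp add: dist_norm)
      then have "1 / real (Suc n) powr Re y \<le> 1 / real (Suc n) powr (Re s - \<delta>)"
        by (intro divide_left_mono powr_mono) auto
      then show ?thesis unfolding norm_dirichlet_term h_def norm_of_real by simp
    qed
    ultimately show "\<exists>d (h :: nat \<Rightarrow> complex). 0 < d \<and> summable h \<and> range h \<subseteq> \<real>\<^sub>\<ge>\<^sub>0 \<and>
        (\<forall>\<^sub>F n in sequentially. \<forall>y\<in>ball s d \<inter> {s. Re s > 1}. norm (1 / of_nat (Suc n) powr y) \<le> norm (h n))"
      using \<delta> by (intro exI[of _ \<delta>] exI[of _ h]) auto
  qed
  then obtain g g' where g: "\<And>s. Re s > 1 \<Longrightarrow> (\<lambda>n. 1 / of_nat (Suc n) powr s) sums g s"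
     "\<And>s. Re s > 1 \<Longrightarrow> (\<lambda>n. - of_real (ln (real (Suc n))) / of_nat (Suc n) powr s) sums g' s"
     "\<And>s. Re s > 1 \<Longrightarrow> (g has_field_derivative g' s) (at s)"
    by blast
  have gz: "g s = zs s" if "Re s > 1" for s using g(1)[OF that] zs_sums[OF that] sums_unique2 by blast
  have d: "(zs has_field_derivative g' s) (at s)" if "Re s > 1" for s
    using g(3)[OF that]
    by (rule has_field_derivative_transform_within_open[of _ _ _ "{s. Re s > 1}"])
       (use that gz open_halfspace_Re_gt in auto)
  show "zs holomorphic_on {s. Re s > 1}"
    using d by (subst holomorphic_on_open) (auto simp: open_halfspace_Re_gt)
  show "(\<lambda>n. - of_real (ln (real (Suc n))) / of_nat (Suc n) powr s) sums deriv zs s" if "Re s > 1"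
    using g(2)[OF that] DERIV_imp_deriv[OF d[OF that]] by simp
qed

definition mangoldt_series :: "complex \<Rightarrow> complex" where "mangoldt_series = dirichlet mangoldt"

lemma mangoldt_bounds: "0 \<le> (mangoldt n :: real)" "mangoldt n \<le> ln (real n)"
proof -
  have nonneg: "0 \<le> (mangoldt n :: real)" for n
  proof (cases "primepow n")
    case True
    then have "aprimedivisor n > 0" using primepow_gt_Suc_0[of n] by (intro aprimedivisor_pos_nat) simp
    then show ?thesis using True by (simp add: mangoldt_def)
  qed (simp add: mangoldt_def)
  then show "0 \<le> (mangoldt n :: real)" .
  have "mangoldt n \<le> (\<Sum>d | d dvd n. mangoldt d :: real)" if "n > 0"
    using that by (intro member_le_sum nonneg) auto
  then show "mangoldt n \<le> ln (real n)"
    by (cases "n = 0") (auto simp: mangoldt_sum)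
qed

lemma norm_mangoldt_le: "norm (mangoldt n :: complex) \<le> ln (real n)"
  using mangoldt_bounds[of n] by (subst of_real_mangoldt[symmetric]) (simp del: of_real_mangoldt)

text \<open>By \<open>mangoldt_sum\<close> the product has the coefficients ln n, which up to sign
  are those of the differentiated series.\<close>

lemma zs_mult_mangoldt_sum:
  assumes "Re s > 1"
  shows "zs s * mangoldt_series s = - deriv zs s"
proof -
  have "(\<lambda>n. (\<Sum>d | d dvd Suc n. mangoldt d * 1) / of_nat (Suc n) powr s) sums (mangoldt_series s * zs s)"
    unfolding zs_def mangoldt_series_def using assms
    by (intro dirichlet_mult dirichlet_conv_log_bounded norm_mangoldt_le dirichlet_conv_bounded[of _ 1]) auto
  then have "(\<lambda>n. of_real (ln (real (Suc n))) / of_nat (Suc n) powr s) sums (mangoldt_series s * zs s)"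
    unfolding mult_1_right by (subst (asm) mangoldt_sum) auto
  from sums_minus[OF this] have "(\<lambda>n. - of_real (ln (real (Suc n))) / of_nat (Suc n) powr s) sums - (mangoldt_series s * zs s)"
    by (simp del: of_nat_Suc)
  with zs_deriv(2)[OF assms] have "deriv zs s = - (mangoldt_series s * zs s)"
    by (rule sums_unique2)
  then show ?thesis by (simp add: mult.commute)
qed

section \<open>Mellin transforms of step functions, summatory functions and sums of dilates\<close>

definition ustep :: "real \<Rightarrow> complex" where "ustep t = (if t \<ge> 1 then 1 else 0)"

lemma ustep_measurable [measurable]: "ustep \<in> borel_measurable borel"
  unfolding ustep_def by measurable

lemma ustep_eq_norm: "ustep t = of_real (norm (ustep t))"
  by (simp add: ustep_def)

lemma mellin_conv_ustep:
  assumes "a > 0"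
  shows "mellin_conv ustep a" "(\<integral>t. t powr (- a - 1) * norm (ustep t) \<partial>Lpos) = 1 / a"
proof -
  have hi: "((\<lambda>x. x powr (- a - 1)) has_integral 1 / a) {1..}"
    using has_integral_powr_to_inf[of "- a - 1" 1] assms by simp
  then have ai: "(\<lambda>x. x powr (- a - 1)) absolutely_integrable_on {1..}"
    by (intro nonnegative_absolutely_integrable_1) auto
  have e: "indicator {0<..} t * (t powr (- a - 1) * norm (ustep t)) = indicator {1..} t * t powr (- a - 1)" for t :: real
    by (auto simp: indicator_def ustep_def)
  have "integrable Lpos (\<lambda>t. t powr (- a - 1) * norm (ustep t))"
    using ai by (simp add: integrable_restrict_space e set_integrable_def)
  then show "mellin_conv ustep a"
    by (simp add: mellin_conv_def borel_imp_Lpos ustep_measurable)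
  show "(\<integral>t. t powr (- a - 1) * norm (ustep t) \<partial>Lpos) = 1 / a"
    using set_lebesgue_integral_eq_integral(2)[OF ai] integral_unique[OF hi]
    by (simp add: integral_restrict_space e set_lebesgue_integral_def)
qed

text \<open>The hypothesis says that f has nonnegative real values; then the integral that decides
  absolute convergence is the transform itself.\<close>

lemma mellin_of_real_exponent:
  assumes "\<And>t. f t = of_real (norm (f t))"
  shows "mellin f (of_real a) = of_real (\<integral>t. t powr (- a - 1) * norm (f t) \<partial>Lpos)"
  unfolding mellin_def
proof (subst integral_complex_of_real[symmetric], intro Bochner_Integration.integral_cong refl)
  fix t assume "t \<in> space Lpos"
  then have "t > 0" by (simp add: space_restrict_space)
  have "complex_of_real t powr (- of_real a - 1) = of_real (t powr (- a - 1))"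
    using \<open>t > 0\<close> powr_of_real[of t "- a - 1"] by simp
  then show "complex_of_real t powr (- of_real a - 1) * f t = of_real (t powr (- a - 1) * norm (f t))"
    using assms[of t] by simp
qed

lemma mellin_ustep:
  assumes "Re s > 0"
  shows "mellin ustep s = 1 / s"
proof (rule identity_real_interval[where f = "mellin ustep" and g = "\<lambda>s. 1 / s"])
  define S where "S = {z. Re s / 2 < Re z \<and> Re z < Re s + 2}"
  show "mellin ustep holomorphic_on S"
    unfolding S_def using assms by (intro mellin_holomorphic mellin_conv_ustep) auto
  show "(\<lambda>s. 1 / s) holomorphic_on S"
    using assms by (intro holomorphic_intros) (auto simp: S_def)
  show "open S" "connected S" unfolding S_def by (rule open_Re_strip connected_Re_strip)+
  show "of_real (Re s) \<in> S" "s \<in> S" "Re s < Re s + 1" using assms by (auto simp: S_def)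
  show "mellin ustep (of_real x) = 1 / of_real x" if "Re s < x" for x
    using that assms by (subst mellin_of_real_exponent) (auto simp: mellin_conv_ustep intro: ustep_eq_norm)
qed

definition sumfun :: "(nat \<Rightarrow> complex) \<Rightarrow> real \<Rightarrow> complex" where
  "sumfun a t = (\<Sum>n | 1 \<le> n \<and> real n \<le> t. a n)"

lemma finite_le_real: "finite {n. 1 \<le> n \<and> real n \<le> t}"
  by (rule finite_subset[of _ "{..nat \<lfloor>t\<rfloor>}"]) (auto simp: le_nat_floor)

text \<open>The finite sum becomes a series of dilates of a single step. This is the input of
  \<open>mellin_series\<close> and also yields Borel measurability.\<close>

lemma sumfun_sums: "(\<lambda>n. a (Suc n) * ustep (t / real (Suc n))) sums sumfun a t"
proof -
  have fin: "finite {n. real (Suc n) \<le> t}"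
    by (rule finite_subset[of _ "{..nat \<lfloor>t\<rfloor>}"]) (auto simp: le_nat_floor intro: Suc_leD)
  have "(\<lambda>n. if n \<in> {n. real (Suc n) \<le> t} then a (Suc n) else 0) sums (\<Sum>n | real (Suc n) \<le> t. a (Suc n))"
    by (rule sums_If_finite_set[OF fin])
  also have "(\<lambda>n. if n \<in> {n. real (Suc n) \<le> t} then a (Suc n) else 0) = (\<lambda>n. a (Suc n) * ustep (t / real (Suc n)))"
    by (auto simp: fun_eq_iff ustep_def field_simps)
  also have "(\<Sum>n | real (Suc n) \<le> t. a (Suc n)) = sumfun a t"
    unfolding sumfun_def
    by (rule sum.reindex_bij_witness[of _ "\<lambda>n. n - 1" Suc]) auto
  finally show ?thesis .
qed

lemma sumfun_measurable [measurable]: "sumfun a \<in> borel_measurable borel"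
proof -
  have "sumfun a = (\<lambda>t. \<Sum>n. a (Suc n) * ustep (t / real (Suc n)))"
    using sumfun_sums sums_unique by blast
  also have "\<dots> \<in> borel_measurable borel" by measurable
  finally show ?thesis .
qed

text \<open>The common source of three transforms: summatory functions are sums of dilates of
  \<open>ustep\<close>, \<open>bose\<close> of exp(-t), and \<open>coth_kernel\<close> of
  \<open>cauchy_kernel\<close>. Hypothesis \<open>sm\<close> is exactly the summability of the
  integrals of the absolute values, by \<open>mellin_scale\<close>.\<close>

lemma mellin_series:
  assumes f: "f \<in> borel_measurable borel" "mellin_conv f (Re s)"
    and c: "\<And>n::nat. c n > 0"
    and sm: "summable (\<lambda>n. norm (a n) * c n powr (- Re s))"
    and F: "F \<in> borel_measurable Lpos"
    and sums: "\<And>t. t > 0 \<Longrightarrow> (\<lambda>n. a n * f (t / c n)) sums F t"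
    and asums: "\<And>t. t > 0 \<Longrightarrow> summable (\<lambda>n. norm (a n * f (t / c n)))"
  shows "mellin_conv F (Re s)"
    and "(\<lambda>n. a n * of_real (c n) powr (- s) * mellin f s) sums mellin F s"
proof -
  note [measurable] = f(1)
  define K where "K = (\<integral>t. t powr (- Re s - 1) * norm (f t) \<partial>Lpos)"
  define u where "u = (\<lambda>n t. of_real t powr (- s - 1) * (a n * f (t / c n)))"
  have nf: "norm (u n t) = norm (a n) * (t powr (- Re s - 1) * norm (f (t / c n)))" if "t > 0" for n t
    unfolding u_def using that by (subst norm_mellin_kernel) (auto simp: norm_mult)
  have nf': "(\<integral>t. norm (u n t) \<partial>Lpos) = norm (a n) * c n powr (- Re s) * K" for n
  proof -
    have "(\<integral>t. norm (u n t) \<partial>Lpos) = (\<integral>t. norm (a n) * (t powr (- Re s - 1) * norm (f (t / c n))) \<partial>Lpos)"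
      by (intro Bochner_Integration.integral_cong refl nf) (simp add: space_restrict_space)
    also have "\<dots> = norm (a n) * (c n powr (- Re s) * K)"
      by (simp only: integral_mult_right_zero mellin_scale(2)[OF c] K_def)
    finally show ?thesis by simp
  qed
  have um: "u n \<in> borel_measurable Lpos" for n
    unfolding u_def by (intro mellin_measurable borel_imp_Lpos) measurable
  have ui: "integrable Lpos (u n)" for n
  proof (rule Bochner_Integration.integrable_bound)
    show "integrable Lpos (\<lambda>t. norm (a n) * (t powr (- Re s - 1) * norm (f (t / c n))))"
      using mellin_scale(1)[OF c f(2)] by simp
    show "AE t in Lpos. norm (u n t) \<le> norm (norm (a n) * (t powr (- Re s - 1) * norm (f (t / c n))))"
      using AE_Lpos_pos by eventually_elim (simp only: nf, simp)
  qed (rule um)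
  have S: "(\<Sum>n. u n t) = of_real t powr (- s - 1) * F t" if "t > 0" for t
    unfolding u_def using sums_mult[OF sums[OF that]] by (simp add: sums_iff)
  have AS: "AE t in Lpos. summable (\<lambda>n. norm (u n t))"
    using AE_Lpos_pos
  proof eventually_elim
    case (elim t)
    show ?case unfolding u_def using summable_mult[OF asums[OF elim]] by (simp add: norm_mult)
  qed
  have ss: "summable (\<lambda>n. \<integral>t. norm (u n t) \<partial>Lpos)"
    unfolding nf' using sm by (rule summable_mult2)
  note * = ui AS ss
  have "integrable Lpos (\<lambda>t. norm (\<Sum>n. u n t))"
    by (rule integrable_norm, rule integrable_suminf[OF *])
  then have "integrable Lpos (\<lambda>x. x powr (- Re s - 1) * norm (F x))"
    by (rule Bochner_Integration.integrable_cong[THEN iffD1, rotated 2])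
       (auto simp: space_restrict_space norm_mellin_kernel S)
  then show "mellin_conv F (Re s)"
    using F by (simp add: mellin_conv_def)
  have "(\<lambda>n. integral\<^sup>L Lpos (u n)) sums (\<integral>t. (\<Sum>n. u n t) \<partial>Lpos)"
    by (rule sums_integral[OF *])
  also have "(\<integral>t. (\<Sum>n. u n t) \<partial>Lpos) = mellin F s"
    unfolding mellin_def by (intro Bochner_Integration.integral_cong refl S) (simp add: space_restrict_space)
  also have "(\<lambda>n. integral\<^sup>L Lpos (u n)) = (\<lambda>n. a n * of_real (c n) powr (- s) * mellin f s)"
  proof
    fix n
    have "integral\<^sup>L Lpos (u n) = (\<integral>t. a n * (of_real t powr (- s - 1) * f (t / c n)) \<partial>Lpos)"
      unfolding u_def by (intro Bochner_Integration.integral_cong refl) simp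
    also have "\<dots> = a n * (of_real (c n) powr (- s) * mellin f s)"
      by (simp only: integral_mult_right_zero mellin_scale(3)[OF c])
    finally show "integral\<^sup>L Lpos (u n) = a n * of_real (c n) powr (- s) * mellin f s" by simp
  qed
  finally show "(\<lambda>n. a n * of_real (c n) powr (- s) * mellin f s) sums mellin F s" .
qed

lemma mellin_sumfun:
  assumes "dirichlet_conv a s" "Re s > 0"
  shows "mellin_conv (sumfun a) (Re s)" "mellin (sumfun a) s = dirichlet a s / s"
proof -
  have sm: "summable (\<lambda>n. norm (a (Suc n) * ustep (t / real (Suc n))))" for t
  proof (rule summable_finite)
    show "finite {n. real (Suc n) \<le> t}"
      by (rule finite_subset[of _ "{..nat \<lfloor>t\<rfloor>}"]) (auto simp: le_nat_floor intro: Suc_leD)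
    show "norm (a (Suc n) * ustep (t / real (Suc n))) = 0" if "n \<notin> {n. real (Suc n) \<le> t}" for n
      using that by (auto simp: ustep_def field_simps)
  qed
  have sm': "summable (\<lambda>n. norm (a (Suc n)) * real (Suc n) powr (- Re s))"
    using assms(1) by (simp add: dirichlet_conv_def powr_minus divide_inverse del: of_nat_Suc)
  note * = mellin_series[where c = "\<lambda>n. real (Suc n)" and a = "\<lambda>n. a (Suc n)" and s = s,
      OF ustep_measurable mellin_conv_ustep(1)[OF assms(2)] _ sm' borel_imp_Lpos[OF sumfun_measurable]
        sumfun_sums sm, simplified]
  show "mellin_conv (sumfun a) (Re s)" by (rule *)
  have "(\<lambda>n. a (Suc n) / of_nat (Suc n) powr s * (1 / s)) sums mellin (sumfun a) s"
    using *(2) by (simp add: mellin_ustep[OF assms(2)] powr_minus divide_inverse)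
  moreover have "(\<lambda>n. a (Suc n) / of_nat (Suc n) powr s * (1 / s)) sums (dirichlet a s * (1 / s))"
    using assms by (intro sums_mult2 dirichlet_sums)
  ultimately have "mellin (sumfun a) s = dirichlet a s * (1 / s)"
    by (rule sums_unique2)
  then show "mellin (sumfun a) s = dirichlet a s / s" by simp
qed

section \<open>Linearity, shifts and the complementary step\<close>

lemma mellin_add:
  assumes "mellin_conv f (Re s)" "mellin_conv g (Re s)"
  shows "mellin_conv (\<lambda>t. f t + g t) (Re s)" "mellin (\<lambda>t. f t + g t) s = mellin f s + mellin g s"
proof -
  have m [measurable]: "f \<in> borel_measurable Lpos" "g \<in> borel_measurable Lpos"
    using assms by (auto simp: mellin_conv_def)
  have "integrable Lpos (\<lambda>t. t powr (- Re s - 1) * norm (f t + g t))"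
  proof (rule Bochner_Integration.integrable_bound)
    show "integrable Lpos (\<lambda>t. t powr (- Re s - 1) * norm (f t) + t powr (- Re s - 1) * norm (g t))"
      using assms by (simp add: mellin_conv_def)
    show "AE t in Lpos. norm (t powr (- Re s - 1) * norm (f t + g t)) \<le>
        norm (t powr (- Re s - 1) * norm (f t) + t powr (- Re s - 1) * norm (g t))"
      by (rule AE_I2) (simp add: norm_triangle_ineq mult_left_mono flip: distrib_left)
  qed measurable
  then show "mellin_conv (\<lambda>t. f t + g t) (Re s)" by (simp add: mellin_conv_def)
  show "mellin (\<lambda>t. f t + g t) s = mellin f s + mellin g s"
    using assms[THEN mellin_conv_integrable] by (simp add: mellin_def distrib_left)
qed

lemma mellin_cmult:
  shows "mellin_conv f a \<Longrightarrow> mellin_conv (\<lambda>t. c * f t) a" "mellin (\<lambda>t. c * f t) s = c * mellin f s"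
proof -
  show "mellin_conv (\<lambda>t. c * f t) a" if f: "mellin_conv f a"
  proof (rule mellin_conv_bound[OF f, where C = "norm c"])
    have [measurable]: "f \<in> borel_measurable Lpos" using f by (simp add: mellin_conv_def)
    show "(\<lambda>t. c * f t) \<in> borel_measurable Lpos" by measurable
  qed (simp add: norm_mult mult_ac)
  have "mellin (\<lambda>t. c * f t) s = (\<integral>t. c * (of_real t powr (- s - 1) * f t) \<partial>Lpos)"
    unfolding mellin_def by (intro Bochner_Integration.integral_cong refl) simp
  then show "mellin (\<lambda>t. c * f t) s = c * mellin f s"
    by (simp only: integral_mult_right_zero mellin_def)
qed

lemma mellin_cong:
  assumes "\<And>t. t > 0 \<Longrightarrow> f t = g t"
  shows "mellin_conv f a \<longleftrightarrow> mellin_conv g a" "mellin f s = mellin g s"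
  unfolding mellin_conv_def mellin_def using assms
  by (auto intro!: arg_cong2[where f = "(\<and>)"] measurable_cong Bochner_Integration.integrable_cong
      Bochner_Integration.integral_cong simp: space_restrict_space)

lemma mellin_shift:
  shows "mellin_conv f (a - p) \<Longrightarrow> mellin_conv (\<lambda>t. of_real (t powr p) * f t) a"
    "mellin (\<lambda>t. of_real (t powr p) * f t) s = mellin f (s - of_real p)"
proof -
  show "mellin_conv (\<lambda>t. of_real (t powr p) * f t) a" if f: "mellin_conv f (a - p)"
  proof (rule mellin_conv_bound[OF f, where C = 1])
    have [measurable]: "f \<in> borel_measurable Lpos" using f by (simp add: mellin_conv_def)
    show "(\<lambda>t. of_real (t powr p) * f t) \<in> borel_measurable Lpos" by measurable
    show "t powr (- a - 1) * norm (of_real (t powr p) * f t) \<le> 1 * (t powr (- (a - p) - 1) * norm (f t))"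
      if "t > 0" for t
    proof -
      have "t powr (- (a - p) - 1) = t powr (- a - 1) * t powr p" by (simp flip: powr_add add: algebra_simps)
      then show ?thesis by (simp add: norm_mult)
    qed
  qed
  show "mellin (\<lambda>t. of_real (t powr p) * f t) s = mellin f (s - of_real p)"
    unfolding mellin_def
  proof (intro Bochner_Integration.integral_cong refl)
    fix t assume "t \<in> space Lpos"
    then have t: "t > 0" by (simp add: space_restrict_space)
    have "complex_of_real t powr (- (s - of_real p) - 1) = of_real t powr (- s - 1) * of_real t powr of_real p"
      by (simp flip: powr_add add: algebra_simps)
    also have "complex_of_real t powr of_real p = of_real (t powr p)"
      using t by (simp add: powr_of_real)
    finally show "of_real t powr (- s - 1) * (of_real (t powr p) * f t) = of_real t powr (- (s - of_real p) - 1) * f t"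
      by simp
  qed
qed

lemma mellin_conv_compl_ustep:
  assumes "a < 0"
  shows "mellin_conv (\<lambda>t. 1 - ustep t) a"
    "(\<integral>t. t powr (- a - 1) * norm (1 - ustep t) \<partial>Lpos) = - 1 / a"
proof -
  have hi: "((\<lambda>x. x powr (- a - 1)) has_integral - 1 / a) {0<..<1}"
    using has_integral_powr_from_0[of "- a - 1" 1] assms by (simp add: has_integral_Icc_iff_Ioo)
  then have ai: "(\<lambda>x. x powr (- a - 1)) absolutely_integrable_on {0<..<1}"
    by (intro nonnegative_absolutely_integrable_1) auto
  have e: "indicator {0<..} t * (t powr (- a - 1) * norm (1 - ustep t)) = indicator {0<..<1} t * t powr (- a - 1)" for t :: real
    by (auto simp: indicator_def ustep_def)
  have "integrable Lpos (\<lambda>t. t powr (- a - 1) * norm (1 - ustep t))"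
    using ai by (simp add: integrable_restrict_space e set_integrable_def)
  moreover have "(\<lambda>t. 1 - ustep t) \<in> borel_measurable Lpos"
    by (rule borel_imp_Lpos) measurable
  ultimately show "mellin_conv (\<lambda>t. 1 - ustep t) a"
    by (simp add: mellin_conv_def)
  show "(\<integral>t. t powr (- a - 1) * norm (1 - ustep t) \<partial>Lpos) = - 1 / a"
    using set_lebesgue_integral_eq_integral(2)[OF ai] integral_unique[OF hi]
    by (simp add: integral_restrict_space e set_lebesgue_integral_def)
qed

lemma mellin_compl_ustep:
  assumes "Re s < 0"
  shows "mellin_conv (\<lambda>t. 1 - ustep t) (Re s)" "mellin (\<lambda>t. 1 - ustep t) s = - 1 / s"
proof -
  show "mellin_conv (\<lambda>t. 1 - ustep t) (Re s)" by (rule mellin_conv_compl_ustep(1)[OF assms])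
  show "mellin (\<lambda>t. 1 - ustep t) s = - 1 / s"
  proof (rule identity_real_interval[where f = "mellin (\<lambda>t. 1 - ustep t)"])
    define S where "S = {z. Re s - 1 < Re z \<and> Re z < Re s / 2}"
    show "mellin (\<lambda>t. 1 - ustep t) holomorphic_on S"
      unfolding S_def using assms by (intro mellin_holomorphic mellin_conv_compl_ustep) auto
    show "(\<lambda>s. - 1 / s) holomorphic_on S"
      using assms by (intro holomorphic_intros) (auto simp: S_def)
    show "open S" "connected S" unfolding S_def by (rule open_Re_strip connected_Re_strip)+
    show "of_real (Re s) \<in> S" "s \<in> S" "Re s < Re s / 2" using assms by (auto simp: S_def)
    show "mellin (\<lambda>t. 1 - ustep t) (of_real x) = - 1 / of_real x" if "Re s < x" "x < Re s / 2" for x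
    proof -
      have "1 - ustep t = of_real (norm (1 - ustep t))" for t by (simp add: ustep_def)
      from mellin_of_real_exponent[of "\<lambda>t. 1 - ustep t", OF this] show ?thesis
        using that assms by (simp add: mellin_conv_compl_ustep(2))
    qed
  qed
qed

subsection \<open>The hyperbolic cotangent and the integrals behind the functional equation\<close>

text \<open>Logarithmic derivative of the reflection formula for Gamma. On the imaginary axis it
  yields the partial fractions of the hyperbolic cotangent.\<close>

lemma Digamma_reflection:
  fixes z :: complex
  assumes z: "z \<notin> \<int>"
  shows "Digamma z - Digamma (1 - z) = - of_real pi * cos (of_real pi * z) / sin (of_real pi * z)"
proof -
  have n: "z \<notin> \<int>\<^sub>\<le>\<^sub>0" "1 - z \<notin> \<int>\<^sub>\<le>\<^sub>0"
    using z nonpos_Ints_subset_Ints by (auto dest: subsetD[OF nonpos_Ints_subset_Ints])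
  have s0: "sin (of_real pi * z) \<noteq> 0"
    using z by (auto simp: sin_eq_0)
  have D1: "((\<lambda>z. Gamma z * Gamma (1 - z)) has_field_derivative
      (Gamma z * Digamma z * Gamma (1 - z) - Gamma z * (Gamma (1 - z) * Digamma (1 - z)))) (at z)"
    using n by (auto intro!: derivative_eq_intros)
  have D2: "((\<lambda>z. of_real pi / sin (of_real pi * z)) has_field_derivative
      (- of_real pi * (of_real pi * cos (of_real pi * z)) / (sin (of_real pi * z)) ^ 2)) (at z)"
    using s0 by (auto intro!: derivative_eq_intros simp: power2_eq_square field_simps)
  have "(\<lambda>z. Gamma z * Gamma (1 - z)) = (\<lambda>z::complex. of_real pi / sin (of_real pi * z))"
    by (rule ext) (rule Gamma_reflection_complex)
  with D1 D2 have "Gamma z * Digamma z * Gamma (1 - z) - Gamma z * (Gamma (1 - z) * Digamma (1 - z)) =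
      - of_real pi * (of_real pi * cos (of_real pi * z)) / (sin (of_real pi * z)) ^ 2"
    by (metis DERIV_unique)
  then have "Gamma z * Gamma (1 - z) * (Digamma z - Digamma (1 - z)) =
      - of_real pi * (of_real pi * cos (of_real pi * z)) / (sin (of_real pi * z)) ^ 2"
    by (simp add: algebra_simps)
  then have e: "of_real pi / sin (of_real pi * z) * (Digamma z - Digamma (1 - z)) =
      - of_real pi * (of_real pi * cos (of_real pi * z)) / (sin (of_real pi * z)) ^ 2"
    by (simp only: Gamma_reflection_complex)
  have "X = - p * C / S" if "p / S * X = - p * (p * C) / S ^ 2" "p \<noteq> 0" "S \<noteq> 0" for p S C X :: complex
  proof -
    have "X = S / p * (p / S * X)" using that(2,3) by simp
    also have "\<dots> = - p * C / S" using that(2,3) unfolding that(1) by (simp add: power2_eq_square)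
    finally show ?thesis .
  qed
  from this[OF e _ s0] show ?thesis by simp
qed

text \<open>Equals coth(x/2)/2 - 1/x, that is 1/(exp x - 1) without the first two terms 1/x - 1/2 of
  its expansion at 0.\<close>

definition coth_kernel :: "real \<Rightarrow> real" where
  "coth_kernel x = 1 / (exp x - 1) - 1 / x + 1 / 2"

text \<open>Partial fractions of the cotangent at an imaginary point. With y = x/(2 pi), Digamma(iy)
  - Digamma(1 - iy) is i pi coth(pi y) by reflection, while by the series of Digamma its imaginary
  part is the sum of \<open>b k + b (Suc k)\<close>.\<close>

lemma coth_kernel_sums:
  assumes x: "x > 0"
  shows "(\<lambda>n. 2 * x / ((2 * pi * real (Suc n)) ^ 2 + x ^ 2)) sums coth_kernel x"
proof -
  define y where "y = x / (2 * pi)"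
  have y: "y > 0" "x = 2 * pi * y" using x by (auto simp: y_def)
  define z where "z = \<i> * of_real y"
  have z: "z \<notin> \<int>" "z \<noteq> 0" "1 - z \<noteq> 0"
    using y by (auto simp: z_def complex_is_Int_iff complex_eq_iff)
  define b where "b = (\<lambda>k. y / (real k ^ 2 + y ^ 2))"
  have "(\<lambda>k. (inverse (of_nat (Suc k)) - inverse (z + of_nat k)) - (inverse (of_nat (Suc k)) - inverse (1 - z + of_nat k)))
     sums ((Digamma z + euler_mascheroni) - (Digamma (1 - z) + euler_mascheroni))"
    using summable_Digamma[OF z(2)] summable_Digamma[OF z(3)]
    by (intro sums_diff) (simp_all add: Digamma_def summable_sums del: of_nat_Suc)
  then have "(\<lambda>k. inverse (1 - z + of_nat k) - inverse (z + of_nat k)) sums (Digamma z - Digamma (1 - z))"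
    by (simp add: algebra_simps)
  then have "(\<lambda>k. Im (inverse (1 - z + of_nat k) - inverse (z + of_nat k))) sums Im (Digamma z - Digamma (1 - z))"
    by (rule sums_Im)
  also have "(\<lambda>k. Im (inverse (1 - z + of_nat k) - inverse (z + of_nat k))) = (\<lambda>k. b (Suc k) + b k)"
    by (auto simp: fun_eq_iff z_def b_def add.commute)
  also have "Digamma z - Digamma (1 - z) = \<i> * of_real (pi * cosh (pi * y) / sinh (pi * y))"
  proof -
    have e: "of_real pi * z = \<i> * of_real (pi * y)" by (simp add: z_def)
    have c: "cos (of_real pi * z) = of_real (cosh (pi * y))"
    proof -
      have "cosh (complex_of_real (pi * y)) = of_real (cosh (pi * y))"
        unfolding cosh_field_def by (simp add: exp_of_real[symmetric])
      then show ?thesis unfolding e by (simp only: cosh_conv_cos[symmetric])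
    qed
    have "sinh (of_real (pi * y)) = - \<i> * sin (\<i> * complex_of_real (pi * y))"
      by (rule sinh_conv_sin)
    then have s: "sin (of_real pi * z) = \<i> * of_real (sinh (pi * y))"
    proof -
      assume s: "sinh (of_real (pi * y)) = - \<i> * sin (\<i> * complex_of_real (pi * y))"
      have "sinh (complex_of_real (pi * y)) = of_real (sinh (pi * y))"
        unfolding sinh_field_def by (simp add: exp_of_real[symmetric])
      then have "\<i> * of_real (sinh (pi * y)) = \<i> * (- \<i> * sin (\<i> * complex_of_real (pi * y)))"
        unfolding s[symmetric] by simp
      then show ?thesis unfolding e by simp
    qed
    show ?thesis unfolding Digamma_reflection[OF z(1)] c s
      using y by (simp add: field_simps)
  qed
  finally have S: "(\<lambda>k. b (Suc k) + b k) sums (pi * cosh (pi * y) / sinh (pi * y))"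
    by simp
  have b0: "b k \<ge> 0" for k using y by (simp add: b_def)
  have sb: "summable (\<lambda>k. b (Suc k))"
    by (rule summable_comparison_test'[OF sums_summable[OF S], of 0]) (use b0 in auto)
  then have sb': "summable b" by (simp add: summable_Suc_iff)
  \<comment> \<open>Each term occurs twice except \<open>b 0\<close> = 1/y, which becomes the 1/x of
    the kernel.\<close>
  have "pi * cosh (pi * y) / sinh (pi * y) = (\<Sum>k. b (Suc k)) + suminf b"
    using S suminf_add[OF sb sb'] by (simp add: sums_iff)
  also have "suminf b = (\<Sum>k. b (Suc k)) + b 0"
    using suminf_split_head[OF sb'] by simp
  also have "b 0 = 1 / y" using y by (simp add: b_def power2_eq_square)
  finally have "(\<Sum>k. b (Suc k)) = (pi * cosh (pi * y) / sinh (pi * y) - 1 / y) / 2" by simp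
  with sb have "(\<lambda>k. b (Suc k)) sums ((pi * cosh (pi * y) / sinh (pi * y) - 1 / y) / 2)"
    by (simp add: sums_iff)
  then have "(\<lambda>k. 1 / pi * b (Suc k)) sums (1 / pi * ((pi * cosh (pi * y) / sinh (pi * y) - 1 / y) / 2))"
    by (rule sums_mult)
  also have "(\<lambda>k. 1 / pi * b (Suc k)) = (\<lambda>n. 2 * x / ((2 * pi * real (Suc n)) ^ 2 + x ^ 2))"
  proof
    fix n
    have "real (Suc n) ^ 2 + y ^ 2 > 0" using y by (intro add_nonneg_pos) auto
    moreover have "(2 * pi * real (Suc n)) ^ 2 + (2 * pi * y) ^ 2 = 4 * pi ^ 2 * (real (Suc n) ^ 2 + y ^ 2)"
      by (simp add: power_mult_distrib distrib_left del: of_nat_Suc)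
    ultimately show "1 / pi * b (Suc n) = 2 * x / ((2 * pi * real (Suc n)) ^ 2 + x ^ 2)"
      unfolding y(2) b_def by (simp add: power2_eq_square del: of_nat_Suc)
  qed
  also have "1 / pi * ((pi * cosh (pi * y) / sinh (pi * y) - 1 / y) / 2) = coth_kernel x"
  proof -
    define E where "E = exp (pi * y)"
    have E: "E > 1" using y by (simp add: E_def)
    have x': "exp x = E ^ 2" unfolding E_def y(2) by (simp flip: exp_double)
    have "E * E > 1" using E by (metis less_1_mult)
    then have ch: "cosh (pi * y) / sinh (pi * y) = (E ^ 2 + 1) / (E ^ 2 - 1)"
      using E unfolding cosh_def sinh_def E_def[symmetric] exp_minus
      by (simp add: field_simps power2_eq_square)
    have "1 / pi * ((pi * cosh (pi * y) / sinh (pi * y) - 1 / y) / 2) =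
        1 / pi * ((pi * ((E ^ 2 + 1) / (E ^ 2 - 1)) - 1 / y) / 2)"
      unfolding ch[symmetric] by simp
    also have "\<dots> = 1 / (E ^ 2 - 1) - 1 / (2 * pi * y) + 1 / 2"
      using y(1) \<open>E * E > 1\<close> by (simp add: field_simps power2_eq_square)
    also have "\<dots> = coth_kernel x"
      unfolding coth_kernel_def x' unfolding y(2) ..
    finally show ?thesis .
  qed
  finally show ?thesis .
qed

text \<open>The partial fractions are positive, and the n-th one is at most 2x/(2 pi n)^2. The
  linear bound near 0 is what carries the continuation to Re s > -1.\<close>

lemma coth_kernel_bounds:
  obtains C where "C > 0" "\<And>x. x > 0 \<Longrightarrow> 0 \<le> coth_kernel x" "\<And>x. x > 0 \<Longrightarrow> coth_kernel x \<le> C * x"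
proof -
  define c where "c = (\<lambda>n. 2 / (2 * pi) ^ 2 * (1 / real (Suc n) powr 2))"
  have sc: "summable c" unfolding c_def by (intro summable_mult summable_Suc_powr) simp
  show ?thesis
  proof (rule that)
    show "suminf c > 0" by (rule suminf_pos[OF sc]) (simp add: c_def)
    show "0 \<le> coth_kernel x" if "x > 0" for x
      using that by (intro sums_le[OF _ sums_zero coth_kernel_sums[OF that]]) auto
    show "coth_kernel x \<le> suminf c * x" if x: "x > 0" for x
    proof -
      have le: "2 * x / ((2 * pi * real (Suc n)) ^ 2 + x ^ 2) \<le> c n * x" for n
      proof -
        have "2 * x / ((2 * pi * real (Suc n)) ^ 2 + x ^ 2) \<le> 2 * x / (2 * pi * real (Suc n)) ^ 2"
          using x by (intro divide_left_mono mult_pos_pos add_pos_nonneg) auto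
        also have "\<dots> = c n * x" by (simp add: c_def power_mult_distrib powr_numeral)
        finally show ?thesis .
      qed
      have "coth_kernel x = (\<Sum>n. 2 * x / ((2 * pi * real (Suc n)) ^ 2 + x ^ 2))"
        using coth_kernel_sums[OF x] by (simp add: sums_iff)
      also have "\<dots> \<le> (\<Sum>n. c n * x)"
        using coth_kernel_sums[OF x] sc le by (intro suminf_le) (auto simp: sums_iff intro: summable_mult2)
      also have "\<dots> = suminf c * x" by (rule suminf_mult2[symmetric, OF sc])
      finally show ?thesis .
    qed
  qed
qed

lemma mellin_exp_minus:
  assumes "Re s < 0"
  shows "mellin_conv (\<lambda>t. of_real (exp (- t))) (Re s)" "mellin (\<lambda>t. of_real (exp (- t))) s = Gamma (- s)"
proof -
  have e: "complex_of_real t powr (- s - 1) / of_real (exp t) = of_real t powr (- s - 1) * of_real (exp (- t))" for t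
    by (simp add: exp_minus divide_inverse)
  have ai: "(\<lambda>t. complex_of_real t powr (- s - 1) * of_real (exp (- t))) absolutely_integrable_on {0<..}"
    using absolutely_integrable_Gamma_integral'[of "- s"] assms unfolding e by simp
  have hi: "((\<lambda>t. complex_of_real t powr (- s - 1) * of_real (exp (- t))) has_integral Gamma (- s)) {0<..}"
    using Gamma_integral_complex'[of "- s"] assms unfolding e by simp
  have i: "integrable Lpos (\<lambda>t. complex_of_real t powr (- s - 1) * of_real (exp (- t)))"
    using ai by (simp add: integrable_restrict_space set_integrable_def)
  have m: "(\<lambda>t. complex_of_real (exp (- t))) \<in> borel_measurable Lpos"
    by (intro borel_imp_Lpos borel_measurable_continuous_onI continuous_intros)
  have "integrable Lpos (\<lambda>x. x powr (- Re s - 1) * norm (complex_of_real (exp (- x))))"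
    by (rule Bochner_Integration.integrable_cong[THEN iffD1, rotated 2, OF integrable_norm[OF i]])
       (auto simp only: space_restrict_space norm_mellin_kernel greaterThan_iff Int_iff)
  then show "mellin_conv (\<lambda>t. of_real (exp (- t))) (Re s)"
    using m by (simp add: mellin_conv_def)
  show "mellin (\<lambda>t. of_real (exp (- t))) s = Gamma (- s)"
    using set_lebesgue_integral_eq_integral(2)[OF ai] integral_unique[OF hi]
    by (simp add: mellin_def integral_restrict_space set_lebesgue_integral_def)
qed

lemma of_real_inverse_powr:
  assumes "r > 0"
  shows "complex_of_real (1 / r) powr s = 1 / of_real r powr s"
proof -
  have "complex_of_real (1 / r) powr s * of_real r powr s = of_real (1 / r * r) powr s"
    using assms by (subst powr_times_real[symmetric]) auto
  then show ?thesis using assms by (simp add: field_simps)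
qed

definition bose :: "real \<Rightarrow> complex" where "bose t = of_real (1 / (exp t - 1))"

lemma bose_measurable [measurable]: "bose \<in> borel_measurable borel"
  unfolding bose_def by measurable

text \<open>The geometric series of exp(-nt) presents \<open>bose\<close> as a sum of dilates of
  exp(-t) by 1/n, each contributing n^(-s).\<close>

lemma mellin_bose:
  assumes s: "Re s > 1"
  shows "mellin_conv bose (- Re s)" "mellin bose (- s) = Gamma s * zs s"
proof -
  have exm: "(\<lambda>t. complex_of_real (exp (- t))) \<in> borel_measurable borel"
    by (intro borel_measurable_continuous_onI continuous_intros)
  have sm: "summable (\<lambda>n. norm (1 :: complex) * (1 / real (Suc n)) powr (- Re (- s)))"
    using summable_Suc_powr[OF s] by (simp add: powr_divide del: of_nat_Suc)
  have geo: "(\<lambda>n. exp (- t) ^ Suc n) sums (1 / (exp t - 1))" if "t > 0" for t :: real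
  proof -
    have "(\<lambda>n. exp (- t) * exp (- t) ^ n) sums (exp (- t) * (1 / (1 - exp (- t))))"
      using that by (intro sums_mult geometric_sums) simp
    also have "exp (- t) * (1 / (1 - exp (- t))) = 1 / (exp t - 1)"
      using that by (simp add: exp_minus field_simps)
    finally show ?thesis by simp
  qed
  have tr: "1 * complex_of_real (exp (- (t / (1 / real (Suc n))))) = of_real (exp (- t) ^ Suc n)" for t n
  proof -
    have "exp (- (t / (1 / real (Suc n)))) = exp (real (Suc n) * (- t))" by (simp add: mult.commute)
    also have "\<dots> = exp (- t) ^ Suc n" by (rule exp_of_nat_mult)
    finally show ?thesis by (simp only: mult_1)
  qed
  have sums: "(\<lambda>n. 1 * complex_of_real (exp (- (t / (1 / real (Suc n)))))) sums bose t" if "t > 0" for t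
    unfolding tr bose_def using geo[OF that] by (rule sums_of_real)
  have asums: "summable (\<lambda>n. norm (1 * complex_of_real (exp (- (t / (1 / real (Suc n)))))))" if "t > 0" for t
    unfolding tr norm_of_real using sums_summable[OF geo[OF that]] by simp
  have neg: "Re (- s) < 0" using s by simp
  note * = mellin_series[where c = "\<lambda>n. 1 / real (Suc n)" and a = "\<lambda>_. 1" and s = "- s",
     OF exm mellin_exp_minus(1)[OF neg] _ sm borel_imp_Lpos[OF bose_measurable] sums asums]
  have "mellin_conv bose (Re (- s))" by (rule *(1)) auto
  then show "mellin_conv bose (- Re s)" by simp
  have "(\<lambda>n. 1 / of_nat (Suc n) powr s * Gamma s) sums mellin bose (- s)"
  proof -
    have "1 * complex_of_real (1 / real (Suc n)) powr (- (- s)) = 1 / of_nat (Suc n) powr s" for n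
      unfolding minus_minus mult_1 by (subst of_real_inverse_powr) simp_all
    note e = this
    have "(\<lambda>n. 1 * complex_of_real (1 / real (Suc n)) powr (- (- s)) * mellin (\<lambda>t. of_real (exp (- t))) (- s)) sums mellin bose (- s)"
      by (rule *(2)) auto
    then show ?thesis unfolding mellin_exp_minus(2)[OF neg] e unfolding minus_minus .
  qed
  moreover have "(\<lambda>n. 1 / of_nat (Suc n) powr s * Gamma s) sums (zs s * Gamma s)"
    by (intro sums_mult2 zs_sums s)
  ultimately show "mellin bose (- s) = Gamma s * zs s"
    by (metis mult.commute sums_unique2)
qed

text \<open>Its dilates by 2 pi n, divided by 2 pi n, are the partial fractions of
  \<open>coth_kernel\<close>. The absolute value makes it nonnegative on all reals, as
  \<open>mellin_of_real_exponent\<close> demands.\<close>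

definition cauchy_kernel :: "real \<Rightarrow> complex" where "cauchy_kernel t = of_real (2 * \<bar>t\<bar> / (1 + t ^ 2))"

lemma cauchy_kernel_measurable [measurable]: "cauchy_kernel \<in> borel_measurable borel"
  unfolding cauchy_kernel_def by measurable

text \<open>The substitution $u = t^2/(1+t^2)$ turns the Mellin transform into a Beta integral.\<close>

lemma mellin_cauchy_kernel:
  assumes a: "-1 < a" "a < 1"
  shows "mellin_conv cauchy_kernel a" "mellin cauchy_kernel (of_real a) = of_real (pi / cos (pi * a / 2))"
proof -
  \<comment> \<open>Here A + B = 1, so Beta A B is Gamma A times Gamma (1 - A), which the reflection
    formula evaluates.\<close>
  define A where "A = (1 - a) / 2"
  define B where "B = (1 + a) / 2"
  have AB: "A > 0" "B > 0" "B = 1 - A" using a by (auto simp: A_def B_def field_simps)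
  define f where "f = (\<lambda>u::real. u powr (A - 1) * (1 - u) powr (B - 1))"
  define g where "g = (\<lambda>x::real. x ^ 2 / (1 + x ^ 2))"
  define h where "h = (\<lambda>x::real. 2 * x / (1 + x ^ 2) ^ 2)"
  have pos: "1 + x ^ 2 > 0" for x :: real by (simp add: add_pos_nonneg)
  have ne: "1 + x ^ 2 \<noteq> 0" for x :: real using pos[of x] by simp
  have hi: "(f has_integral Beta A B) {0<..<1}"
    using has_integral_Beta_real[OF AB(1,2)] unfolding f_def by (simp add: has_integral_Icc_iff_Ioo)
  then have ai: "f absolutely_integrable_on {0<..<1}"
    by (intro nonnegative_absolutely_integrable_1) (auto simp: f_def)
  have d: "(g has_field_derivative h x) (at x within {0<..})" for x
    unfolding g_def h_def using ne[of x]
    by (auto intro!: derivative_eq_intros simp: power2_eq_square field_simps)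
  have g1: "g x = 1 - 1 / (1 + x ^ 2)" for x using ne[of x] by (simp add: g_def field_simps)
  have inj: "inj_on g {0<..}"
    using ne by (auto simp: inj_on_def g1 power2_eq_iff)
  have im: "g ` {0<..} = {0<..<1}"
  proof safe
    fix x :: real assume "0 < x"
    then show "g x \<in> {0<..<1}" using pos[of x] by (auto simp: g_def field_simps)
  next
    fix u :: real assume u: "u \<in> {0<..<1}"
    then have "u / (1 - u) > 0" by simp
    then have "g (sqrt (u / (1 - u))) = u" using u by (simp add: g_def field_simps)
    then show "u \<in> g ` {0<..}" using \<open>u / (1 - u) > 0\<close> by (metis greaterThan_iff imageI real_sqrt_gt_zero)
  qed
  have "(\<lambda>x. \<bar>h x\<bar> *\<^sub>R f (g x)) absolutely_integrable_on {0<..} \<and> integral {0<..} (\<lambda>x. \<bar>h x\<bar> *\<^sub>R f (g x)) = Beta A B"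
    using has_absolute_integral_change_of_variables_real[of "{0<..}" g h f "Beta A B", OF _ d inj] ai hi
    unfolding im by (auto simp: integral_unique)
  then have *: "(\<lambda>x. \<bar>h x\<bar> *\<^sub>R f (g x)) absolutely_integrable_on {0<..}" "integral {0<..} (\<lambda>x. \<bar>h x\<bar> *\<^sub>R f (g x)) = Beta A B"
    by auto
  have e: "\<bar>h x\<bar> *\<^sub>R f (g x) = x powr (- a - 1) * norm (cauchy_kernel x)" if x: "x > 0" for x
  proof -
    define P where "P = 1 + x ^ 2"
    have P: "P > 0" using pos by (simp add: P_def)
    have "1 - g x = 1 / P" by (simp add: g1 P_def)
    moreover have "g x = x powr 2 / P" using x by (simp add: g_def P_def)
    ultimately have "f (g x) = x powr (2 * (A - 1)) / P powr (A - 1) * (1 / P powr (B - 1))"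
      unfolding f_def using x P by (simp add: powr_divide powr_powr del: powr_numeral)
    moreover have "\<bar>h x\<bar> = 2 * x / P powr 2" using x P by (simp add: h_def P_def)
    ultimately have "\<bar>h x\<bar> *\<^sub>R f (g x) = 2 * x * x powr (2 * (A - 1)) / (P powr 2 * P powr (A - 1) * P powr (B - 1))"
      by simp
    also have "P powr 2 * P powr (A - 1) * P powr (B - 1) = P"
      using P by (simp add: AB(3) flip: powr_add del: powr_numeral)
    also have "2 * (A - 1) = - a - 1" by (simp add: A_def)
    finally have "\<bar>h x\<bar> *\<^sub>R f (g x) = 2 * x * x powr (- a - 1) / P" .
    then show ?thesis using x P unfolding cauchy_kernel_def norm_of_real P_def by simp
  qed
  have i: "integrable Lpos (\<lambda>x. \<bar>h x\<bar> *\<^sub>R f (g x))"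
    using *(1) by (simp add: integrable_restrict_space set_integrable_def)
  have "integrable Lpos (\<lambda>x. x powr (- a - 1) * norm (cauchy_kernel x))"
    by (rule Bochner_Integration.integrable_cong[THEN iffD1, rotated 2, OF i])
       (auto simp only: space_restrict_space e greaterThan_iff Int_iff)
  then show "mellin_conv cauchy_kernel a"
    by (simp add: mellin_conv_def borel_imp_Lpos)
  have "(\<integral>x. x powr (- a - 1) * norm (cauchy_kernel x) \<partial>Lpos) = (\<integral>x. \<bar>h x\<bar> *\<^sub>R f (g x) \<partial>Lpos)"
    by (intro Bochner_Integration.integral_cong refl e[symmetric]) (auto simp: space_restrict_space)
  also have "\<dots> = Beta A B"
    using set_lebesgue_integral_eq_integral(2)[OF *(1)] *(2)
    by (simp add: integral_restrict_space set_lebesgue_integral_def)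
  also have "\<dots> = pi / cos (pi * a / 2)"
  proof -
    have "complex_of_real (Gamma A * Gamma (1 - A)) = Gamma (of_real A) * Gamma (1 - of_real A)"
      by (simp add: Gamma_complex_of_real[symmetric])
    also have "\<dots> = of_real (pi / sin (pi * A))"
      unfolding Gamma_reflection_complex by (simp flip: sin_of_real)
    finally have "Gamma A * Gamma (1 - A) = pi / sin (pi * A)" by (simp only: of_real_eq_iff)
    moreover have "sin (pi * A) = cos (pi * a / 2)"
      by (simp add: A_def cos_sin_eq algebra_simps diff_divide_distrib)
    ultimately show ?thesis by (simp add: Beta_def AB(3))
  qed
  finally have v: "(\<integral>x. x powr (- a - 1) * norm (cauchy_kernel x) \<partial>Lpos) = pi / cos (pi * a / 2)" .
  show "mellin cauchy_kernel (of_real a) = of_real (pi / cos (pi * a / 2))"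
    unfolding v[symmetric]
    by (rule mellin_of_real_exponent) (unfold cauchy_kernel_def norm_of_real, subst abs_of_nonneg, auto)
qed

lemma coth_kernel_measurable [measurable]: "coth_kernel \<in> borel_measurable borel"
  unfolding coth_kernel_def by measurable

text \<open>The n-th partial fraction contributes (2 pi n)^(s - 1), and these sum to a multiple of
  zeta(1 - s): here the reflected argument of the functional equation appears.\<close>

lemma mellin_coth_kernel:
  assumes s: "-1 < s" "s < 0"
  shows "mellin_conv (\<lambda>t. of_real (coth_kernel t)) (- s)"
    and "mellin (\<lambda>t. of_real (coth_kernel t)) (- of_real s) =
           of_real ((2 * pi) powr (s - 1) * (pi / cos (pi * s / 2))) * zs (1 - of_real s)"
proof -
  define c where "c = (\<lambda>n. 2 * pi * real (Suc n))"
  have c: "c n > 0" for n by (simp add: c_def)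
  have re: "Re (- of_real s) = - s" by simp
  have mc: "mellin_conv cauchy_kernel (Re (- of_real s))"
    unfolding re using s by (intro mellin_cauchy_kernel) auto
  have cp: "1 / c n * c n powr s = (2 * pi) powr (s - 1) * (1 / real (Suc n) powr (1 - s))" for n
  proof -
    have "1 / c n * c n powr s = c n powr (s - 1)" using c[of n] by (simp add: powr_diff)
    also have "\<dots> = (2 * pi) powr (s - 1) * real (Suc n) powr (s - 1)" unfolding c_def by (rule powr_mult) 
    also have "real (Suc n) powr (s - 1) = 1 / real (Suc n) powr (1 - s)"
      by (simp add: powr_diff)
    finally show ?thesis .
  qed
  have sm: "summable (\<lambda>n. norm (of_real (1 / c n) :: complex) * c n powr (- Re (- of_real s)))"
  proof -
    have "summable (\<lambda>n. (2 * pi) powr (s - 1) * (1 / real (Suc n) powr (1 - s)))"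
      using s by (intro summable_mult summable_Suc_powr) auto
    moreover have "norm (of_real (1 / c n) :: complex) = 1 / c n" for n
      unfolding norm_of_real using c[of n] by simp
    ultimately show ?thesis unfolding cp[symmetric] re minus_minus by simp
  qed
  have t: "of_real (1 / c n) * cauchy_kernel (t / c n) = of_real (2 * t / (c n ^ 2 + t ^ 2))"
    if "t > 0" for t n
  proof -
    have "1 / c n * (2 * \<bar>t / c n\<bar> / (1 + (t / c n) ^ 2)) = 2 * t / (c n ^ 2 + t ^ 2)"
      using that c[of n] by (simp add: field_simps power2_eq_square)
    then show ?thesis unfolding cauchy_kernel_def by (simp only: of_real_mult[symmetric])
  qed
  have cs: "(\<lambda>n. 2 * t / (c n ^ 2 + t ^ 2)) sums coth_kernel t" if "t > 0" for t
    using coth_kernel_sums[OF that] by (simp only: c_def)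
  have cm: "(\<lambda>t. complex_of_real (coth_kernel t)) \<in> borel_measurable Lpos"
    by (rule borel_imp_Lpos) measurable
  have sums: "(\<lambda>n. of_real (1 / c n) * cauchy_kernel (t / c n)) sums of_real (coth_kernel t)" if "t > 0" for t
    unfolding t[OF that] using cs[OF that] by (rule sums_of_real)
  have asums: "summable (\<lambda>n. norm (of_real (1 / c n) * cauchy_kernel (t / c n)))" if "t > 0" for t
  proof -
    have "norm (of_real (1 / c n) * cauchy_kernel (t / c n)) = 2 * t / (c n ^ 2 + t ^ 2)" for n
      unfolding t[OF that] norm_of_real using that by (intro abs_of_nonneg divide_nonneg_nonneg) auto
    then show ?thesis using sums_summable[OF cs[OF that]] by simp
  qed
  note * = mellin_series[where c = c and a = "\<lambda>n. of_real (1 / c n)" and s = "- of_real s",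
     OF cauchy_kernel_measurable mc c sm cm sums asums]
  have "mellin_conv (\<lambda>t. of_real (coth_kernel t)) (Re (- of_real s))" by (rule *(1)) auto
  then show "mellin_conv (\<lambda>t. of_real (coth_kernel t)) (- s)" unfolding re .
  have ser: "(\<lambda>n. of_real (1 / c n) * of_real (c n) powr (- (- of_real s)) * mellin cauchy_kernel (- of_real s))
      sums mellin (\<lambda>t. of_real (coth_kernel t)) (- of_real s)"
    by (rule *(2)) auto
  have "of_real (1 / c n) * of_real (c n) powr (- (- of_real s)) * mellin cauchy_kernel (- of_real s) =
     of_real ((2 * pi) powr (s - 1) * (pi / cos (pi * s / 2))) * (1 / of_nat (Suc n) powr (1 - of_real s))" for n
  proof -
    have "complex_of_real (1 / c n) * of_real (c n) powr (- (- of_real s)) = of_real (1 / c n * c n powr s)"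
      using c[of n] by (simp add: powr_of_real)
    also have "\<dots> = of_real ((2 * pi) powr (s - 1)) * (1 / of_nat (Suc n) powr (1 - of_real s))"
      unfolding cp using powr_of_real[of "real (Suc n)" "1 - s"] by (simp del: of_nat_Suc)
    finally have 1: "complex_of_real (1 / c n) * of_real (c n) powr (- (- of_real s)) =
        of_real ((2 * pi) powr (s - 1)) * (1 / of_nat (Suc n) powr (1 - of_real s))" .
    have 2: "mellin cauchy_kernel (- of_real s) = of_real (pi / cos (pi * s / 2))"
      using mellin_cauchy_kernel(2)[of "- s"] s by simp
    show ?thesis unfolding 1 2 of_real_mult by (simp only: mult_ac)
  qed
  with ser have "(\<lambda>n. of_real ((2 * pi) powr (s - 1) * (pi / cos (pi * s / 2))) * (1 / of_nat (Suc n) powr (1 - of_real s)))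
      sums mellin (\<lambda>t. of_real (coth_kernel t)) (- of_real s)" by simp
  moreover have "(\<lambda>n. of_real ((2 * pi) powr (s - 1) * (pi / cos (pi * s / 2))) * (1 / of_nat (Suc n) powr (1 - of_real s)))
      sums (of_real ((2 * pi) powr (s - 1) * (pi / cos (pi * s / 2))) * zs (1 - of_real s))"
    using s by (intro sums_mult zs_sums) simp
  ultimately show "mellin (\<lambda>t. of_real (coth_kernel t)) (- of_real s) =
      of_real ((2 * pi) powr (s - 1) * (pi / cos (pi * s / 2))) * zs (1 - of_real s)"
    by (rule sums_unique2)
qed

subsection \<open>Continuation and functional equation of the zeta function\<close>

text \<open>Removing the polar part $1/t - 1/2$ of $1/(e^t - 1)$ on $(0,1)$ continues
  $\Gamma(s)\zeta(s) = \int_0^\infty t^{s-1}/(e^t - 1)\,dt$ to $\Re s > -1$; for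
  $-1 < \Re s < 0$ the same function is $\int_0^\infty t^{s-1} k(t)\,dt$ with the full kernel
  $k(t) = 1/(e^t-1) - 1/t + 1/2$, whose expansion into partial fractions gives the
  functional equation.\<close>

definition zeta_kernel :: "real \<Rightarrow> complex" where
  "zeta_kernel t = (if t < 1 then of_real (coth_kernel t) else bose t)"

lemma zeta_kernel_measurable [measurable]: "zeta_kernel \<in> borel_measurable borel"
  unfolding zeta_kernel_def by measurable

lemma power_le_fact_exp:
  fixes t :: real
  assumes "t \<ge> 0"
  shows "t ^ n \<le> fact n * exp t"
proof -
  have s: "(\<lambda>n. t ^ n /\<^sub>R fact n) sums exp t" by (rule exp_converges)
  have "sum (\<lambda>n. t ^ n /\<^sub>R fact n) {n} \<le> (\<Sum>n. t ^ n /\<^sub>R fact n)"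
    using assms by (intro sum_le_suminf sums_summable[OF s]) auto
  then show ?thesis using s by (simp add: sums_iff field_simps)
qed

lemma mellin_conv_zeta_kernel:
  assumes a: "a < 1"
  shows "mellin_conv zeta_kernel a"
proof -
  obtain n :: nat where n: "real n > - a" using reals_Archimedean2 by blast
  obtain C where C: "C > 0" "\<And>x. x > 0 \<Longrightarrow> 0 \<le> coth_kernel x" "\<And>x. x > 0 \<Longrightarrow> coth_kernel x \<le> C * x"
    using coth_kernel_bounds by blast
  \<comment> \<open>The kernel is O(t) at 0, which admits every a < 1; at infinity it decays faster
    than t^(-n), and n > -a is enough there.\<close>
  define f where "f = (\<lambda>t. of_real (t powr 1) * (1 - ustep t) + of_real (t powr (- real n)) * ustep t)"
  have f: "mellin_conv f a"
  proof -
    have "mellin_conv (\<lambda>t. of_real (t powr 1) * (1 - ustep t)) (Re (of_real a))"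
      using a mellin_compl_ustep(1)[of "of_real (a - 1)"] by (intro mellin_shift) simp
    moreover have "mellin_conv (\<lambda>t. of_real (t powr (- real n)) * ustep t) (Re (of_real a))"
      using n by (intro mellin_shift mellin_conv_ustep) simp
    ultimately show ?thesis unfolding f_def using mellin_add(1) by fastforce
  qed
  have bd: "norm (zeta_kernel t) \<le> max C (2 * fact n) * norm (f t)" if t: "t > 0" for t
  proof (cases "t < 1")
    case True
    have "norm (zeta_kernel t) = coth_kernel t" using True C(2)[OF t] by (simp add: zeta_kernel_def)
    also have "\<dots> \<le> C * t" using C(3)[OF t] .
    also have "\<dots> \<le> max C (2 * fact n) * t" using t by (intro mult_right_mono) auto
    also have "\<dots> = max C (2 * fact n) * norm (f t)" using True t by (simp add: f_def ustep_def)
    finally show ?thesis .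
  next
    case False
    then have t1: "t \<ge> 1" by simp
    have e: "exp t \<ge> 2" using exp_ge_add_one_self[of t] t1 by linarith
    have "norm (zeta_kernel t) = 1 / (exp t - 1)"
      using False e unfolding zeta_kernel_def bose_def
      by (simp only: if_False norm_of_real) (subst abs_of_nonneg, simp_all)
    also have "\<dots> \<le> 1 / (exp t / 2)" using e by (intro frac_le) auto
    also have "\<dots> \<le> 2 * fact n / t ^ n"
      using power_le_fact_exp[of t n] t by (simp add: field_simps)
    also have "\<dots> = 2 * fact n * t powr (- real n)" using t by (simp add: powr_minus powr_realpow divide_inverse)
    also have "\<dots> \<le> max C (2 * fact n) * t powr (- real n)" by (intro mult_right_mono) auto
    also have "\<dots> = max C (2 * fact n) * norm (f t)" using t1 by (simp add: f_def ustep_def)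
    finally show ?thesis .
  qed
  show ?thesis
  proof (rule mellin_conv_bound[OF f])
    show "zeta_kernel \<in> borel_measurable Lpos" by (rule borel_imp_Lpos) measurable
    show "t powr (- a - 1) * norm (zeta_kernel t) \<le> max C (2 * fact n) * (t powr (- a - 1) * norm (f t))"
      if "t > 0" for t
      using mult_left_mono[OF bd[OF that], of "t powr (- a - 1)"] by (simp add: mult_ac)
  qed
qed

lemma mellin_zeta_kernel_holomorphic: "(\<lambda>s. mellin zeta_kernel (- s)) holomorphic_on {s. Re s > -1}"
proof -
  have "mellin zeta_kernel holomorphic_on {s. Re s < 1}"
  proof (rule mellin_holomorphic_on)
    fix s assume "s \<in> {s. Re s < 1}"
    then show "\<exists>a b. a < Re s \<and> Re s < b \<and> mellin_conv zeta_kernel a \<and> mellin_conv zeta_kernel b"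
      by (intro exI[of _ "Re s - 1"] exI[of _ "(Re s + 1) / 2"]) (simp add: mellin_conv_zeta_kernel)
  qed
  then have "mellin zeta_kernel \<circ> uminus holomorphic_on {s. Re s > -1}"
    by (intro holomorphic_on_compose_gen[where t = "{s. Re s < 1}"] holomorphic_intros) auto
  then show ?thesis by (simp add: o_def)
qed

lemma mellin_bose_zeta_kernel:
  assumes s: "Re s > 1"
  shows "mellin bose (- s) = mellin zeta_kernel (- s) + 1 / (s - 1) - 1 / (2 * s)"
proof -
  have c1: "mellin_conv (\<lambda>t. of_real (t powr (-1)) * (1 - ustep t)) (Re (- s))"
    using s mellin_compl_ustep(1)[of "1 - s"] by (intro mellin_shift) simp
  have c2: "mellin_conv (\<lambda>t. - 1 / 2 * (1 - ustep t)) (Re (- s))"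
    using s mellin_compl_ustep(1)[of "- s"] by (intro mellin_cmult) simp
  have c0: "mellin_conv zeta_kernel (Re (- s))" using s by (intro mellin_conv_zeta_kernel) simp
  have "mellin bose (- s) = mellin (\<lambda>t. zeta_kernel t + (of_real (t powr (-1)) * (1 - ustep t) + - 1 / 2 * (1 - ustep t))) (- s)"
    by (rule mellin_cong) (auto simp: zeta_kernel_def ustep_def bose_def coth_kernel_def powr_minus_divide)
  also have "\<dots> = mellin zeta_kernel (- s) + (mellin (\<lambda>t. 1 - ustep t) (- s - of_real (-1)) + - 1 / 2 * mellin (\<lambda>t. 1 - ustep t) (- s))"
    by (simp only: mellin_add(2)[OF c0 mellin_add(1)[OF c1 c2]] mellin_add(2)[OF c1 c2] mellin_shift(2) mellin_cmult(2))
  also have "mellin (\<lambda>t. 1 - ustep t) (- s - of_real (-1)) = - 1 / (- s - of_real (-1))"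
    using s by (intro mellin_compl_ustep) simp
  also have "- 1 / (- s - of_real (-1)) = 1 / (s - 1)"
    by (simp add: divide_simps)
  also have "mellin (\<lambda>t. 1 - ustep t) (- s) = - 1 / (- s)"
    using s by (intro mellin_compl_ustep) simp
  finally show ?thesis by simp
qed

text \<open>The polar part is now split off on t \<ge> 1 with the opposite sign, instead of on t < 1
  as in \<open>mellin_bose_zeta_kernel\<close>. The transforms 1/s and -1/s of the two steps also
  differ in sign, so the same rational correction results, and both kernels belong to one
  continuation.\<close>

lemma mellin_coth_zeta_kernel:
  assumes s: "-1 < Re s" "Re s < 0" "mellin_conv (\<lambda>t. of_real (coth_kernel t)) (Re (- s))"
  shows "mellin (\<lambda>t. of_real (coth_kernel t)) (- s) = mellin zeta_kernel (- s) + 1 / (s - 1) - 1 / (2 * s)"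
proof -
  have c1: "mellin_conv (\<lambda>t. -1 * (of_real (t powr (-1)) * ustep t)) (Re (- s))"
    using s by (intro mellin_cmult mellin_shift mellin_conv_ustep) simp
  have c2: "mellin_conv (\<lambda>t. 1 / 2 * ustep t) (Re (- s))"
    using s by (intro mellin_cmult mellin_conv_ustep) simp
  have c0: "mellin_conv zeta_kernel (Re (- s))" using s by (intro mellin_conv_zeta_kernel) simp
  have "mellin (\<lambda>t. of_real (coth_kernel t)) (- s) =
      mellin (\<lambda>t. zeta_kernel t + (-1 * (of_real (t powr (-1)) * ustep t) + 1 / 2 * ustep t)) (- s)"
    by (rule mellin_cong) (auto simp: zeta_kernel_def ustep_def bose_def coth_kernel_def powr_minus_divide)
  also have "\<dots> = mellin zeta_kernel (- s) + (-1 * mellin ustep (- s - of_real (-1)) + 1 / 2 * mellin ustep (- s))"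
    by (simp only: mellin_add(2)[OF c0 mellin_add(1)[OF c1 c2]] mellin_add(2)[OF c1 c2] mellin_shift(2) mellin_cmult(2))
  also have "mellin ustep (- s - of_real (-1)) = 1 / (- s - of_real (-1))"
    using s by (intro mellin_ustep) simp
  also have "-1 * (1 / (- s - of_real (-1))) = 1 / (s - 1)"
    by (simp add: divide_simps)
  also have "mellin ustep (- s) = 1 / (- s)"
    using s by (intro mellin_ustep) simp
  finally show ?thesis by simp
qed

text \<open>The term rGamma(s)/(2s) is written as rGamma(s + 1)/2, so that there is no singularity
  at 0 to be removed.\<close>

definition zeta_right :: "complex \<Rightarrow> complex" where
  "zeta_right s = rGamma s * (mellin zeta_kernel (- s) + 1 / (s - 1)) - rGamma (s + 1) / 2"

text \<open>The right-hand side of the functional equation. The parameter f is \<open>zs\<close>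
  when the continuation is constructed and \<open>riemann_zeta\<close> once it exists.\<close>

definition zeta_refl :: "(complex \<Rightarrow> complex) \<Rightarrow> complex \<Rightarrow> complex" where
  "zeta_refl f s = 2 * of_real (2 * pi) powr (s - 1) * sin (of_real pi * s / 2) * Gamma (1 - s) * f (1 - s)"

lemma zeta_right_eq:
  assumes "s \<noteq> 0"
  shows "zeta_right s = rGamma s * (mellin zeta_kernel (- s) + 1 / (s - 1) - 1 / (2 * s))"
proof -
  have "rGamma (s + 1) = rGamma s / s" using rGamma_plus1[of s] assms by (simp add: field_simps)
  then show ?thesis using assms by (simp add: zeta_right_def algebra_simps)
qed

lemma zeta_right_eq_zs:
  assumes s: "Re s > 1"
  shows "zeta_right s = zs s"
proof -
  have "s \<noteq> 0" using s by auto
  then have "zeta_right s = rGamma s * (Gamma s * zs s)"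
    using s by (simp add: zeta_right_eq mellin_bose_zeta_kernel[symmetric] mellin_bose)
  also have "s \<notin> \<int>\<^sub>\<le>\<^sub>0" using s by (auto elim!: nonpos_Ints_cases)
  then have "Gamma s \<noteq> 0" by (rule Gamma_nonzero)
  then have "rGamma s * (Gamma s * zs s) = zs s" by (simp add: rGamma_inverse_Gamma)
  finally show ?thesis .
qed

lemma zeta_right_holomorphic: "zeta_right holomorphic_on {s. Re s > -1} - {1}"
  unfolding zeta_right_def
  by (intro holomorphic_intros holomorphic_on_subset[OF mellin_zeta_kernel_holomorphic]) auto

lemma zeta_refl_holomorphic:
  assumes f: "f holomorphic_on (\<lambda>s. 1 - s) ` A" and A: "\<And>s. s \<in> A \<Longrightarrow> Re s < 1"
  shows "zeta_refl f holomorphic_on A"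
proof -
  have "f \<circ> (\<lambda>s. 1 - s) holomorphic_on A"
    by (intro holomorphic_on_compose f holomorphic_intros)
  moreover have "1 - s \<notin> \<int>\<^sub>\<le>\<^sub>0" if "s \<in> A" for s
    using A[OF that] by (auto elim!: nonpos_Ints_cases simp: complex_eq_iff)
  moreover have "complex_of_real (2 * pi) \<noteq> 0" by simp
  ultimately show ?thesis
    unfolding zeta_refl_def o_def by (intro holomorphic_intros) auto
qed

text \<open>The cosine in the denominator, left by the Beta integral, cancels: the reflection
  formula turns rGamma(s) into Gamma(1 - s) sin(pi s)/pi, and sin(pi s) = 2 sin(pi s/2) cos(pi
  s/2).\<close>

lemma zeta_right_eq_refl_real:
  assumes s: "-1 < s" "s < 0"
  shows "zeta_right (of_real s) = zeta_refl zs (of_real s)"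
proof -
  define z where "z = complex_of_real s"
  define u where "u = of_real pi * z / 2"
  have z0: "z \<noteq> 0" using s by (simp add: z_def)
  have conv: "mellin_conv (\<lambda>t. of_real (coth_kernel t)) (Re (- z))"
    using mellin_coth_kernel(1)[OF s] by (simp add: z_def)
  have "mellin zeta_kernel (- z) + 1 / (z - 1) - 1 / (2 * z) = mellin (\<lambda>t. of_real (coth_kernel t)) (- z)"
    using s conv by (subst mellin_coth_zeta_kernel) (auto simp: z_def)
  also have "\<dots> = of_real ((2 * pi) powr (s - 1) * (pi / cos (pi * s / 2))) * zs (1 - z)"
    unfolding z_def by (rule mellin_coth_kernel(2)[OF s])
  also have "of_real ((2 * pi) powr (s - 1) * (pi / cos (pi * s / 2))) = of_real (2 * pi) powr (z - 1) * (of_real pi / cos u)"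
    using powr_of_real[of "2 * pi" "s - 1"] by (simp add: z_def u_def flip: cos_of_real)
  finally have 1: "zeta_right z = rGamma z * (of_real (2 * pi) powr (z - 1) * (of_real pi / cos u) * zs (1 - z))"
    by (simp add: zeta_right_eq z0)
  have "pi * (- 1) < pi * s" "pi * s < pi * 0" using s by (intro mult_strict_left_mono; simp)+
  then have "cos (pi * s / 2) > 0" using s by (intro cos_gt_zero_pi) auto
  moreover have "cos u = of_real (cos (pi * s / 2))" by (simp add: u_def z_def flip: cos_of_real)
  ultimately have c0: "cos u \<noteq> 0" by simp
  have "1 - z \<notin> \<int>\<^sub>\<le>\<^sub>0" using s by (auto elim!: nonpos_Ints_cases simp: z_def complex_eq_iff)
  then have g0: "Gamma (1 - z) \<noteq> 0" by (rule Gamma_nonzero)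
  have "rGamma z * rGamma (1 - z) = sin (of_real pi * z) / of_real pi" by (rule rGamma_reflection_complex)
  moreover have "rGamma z = Gamma (1 - z) * (rGamma z * rGamma (1 - z))"
    using g0 by (simp add: rGamma_inverse_Gamma[of "1 - z"])
  ultimately have "rGamma z = Gamma (1 - z) * sin (of_real pi * z) / of_real pi"
    by simp
  also have "sin (of_real pi * z) = 2 * sin u * cos u"
    using sin_double[of u] by (simp add: u_def)
  finally have "rGamma z * (of_real pi / cos u) = 2 * sin u * Gamma (1 - z)" using c0 by simp
  moreover have "zeta_right z = of_real (2 * pi) powr (z - 1) * (rGamma z * (of_real pi / cos u)) * zs (1 - z)"
    unfolding 1 by (simp only: mult_ac)
  ultimately have "zeta_right z = of_real (2 * pi) powr (z - 1) * (2 * sin u * Gamma (1 - z)) * zs (1 - z)"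
    by simp
  then show ?thesis by (simp add: zeta_refl_def z_def u_def mult_ac)
qed

lemma image_one_minus_Re: "(\<lambda>s. 1 - s) ` {s. Re s < 0} \<subseteq> {s. Re s > 1}"
  by auto

lemma zeta_right_eq_refl:
  assumes "-1 < Re s" "Re s < 0"
  shows "zeta_right s = zeta_refl zs s"
proof (rule identity_real_interval[where f = zeta_right and a = "-1/2" and b = 0])
  define S where "S = {s. -1 < Re s \<and> Re s < 0}"
  show "zeta_right holomorphic_on S"
    by (rule holomorphic_on_subset[OF zeta_right_holomorphic]) (auto simp: S_def)
  show "zeta_refl zs holomorphic_on S"
    by (intro zeta_refl_holomorphic holomorphic_on_subset[OF zs_holomorphic]) (auto simp: S_def)
  show "open S" "connected S" unfolding S_def by (rule open_Re_strip connected_Re_strip)+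
  show "of_real (- 1 / 2) \<in> S" "s \<in> S" using assms by (auto simp: S_def)
  show "zeta_right (of_real x) = zeta_refl zs (of_real x)" if "- 1 / 2 < x" "x < 0" for x
    using that by (intro zeta_right_eq_refl_real) auto
qed simp

text \<open>The existence that gives \<open>riemann_zeta\<close> its meaning.
  \<open>zeta_right\<close> on Re s > -1 and the reflected Dirichlet series on Re s < 0 agree on the
  overlap and together cover the plane without 1.\<close>

lemma zeta_continuation:
  "\<exists>f. f holomorphic_on - {1} \<and> (\<forall>s. Re s > 1 \<longrightarrow> (\<lambda>n. 1 / of_nat (Suc n) powr s) sums f s)"
proof (intro exI conjI allI impI)
  define A where "A = {s. Re s > -1} - {1::complex}"
  define B where "B = {s. Re s < 0}"
  define f where "f = (\<lambda>s. if s \<in> A then zeta_right s else zeta_refl zs s)"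
  have "f holomorphic_on (A \<union> B)"
    unfolding f_def
  proof (rule holomorphic_on_If_Un)
    show "zeta_right holomorphic_on A" unfolding A_def by (rule zeta_right_holomorphic)
    show "zeta_refl zs holomorphic_on B"
      unfolding B_def
      by (intro zeta_refl_holomorphic holomorphic_on_subset[OF zs_holomorphic image_one_minus_Re]) auto
    show "open A" unfolding A_def by (intro open_Diff open_halfspace_Re_gt) auto
    show "open B" unfolding B_def by (rule open_halfspace_Re_lt)
  qed (auto simp: A_def B_def zeta_right_eq_refl)
  also have "A \<union> B = - {1}" by (auto simp: A_def B_def)
  finally show "f holomorphic_on - {1}" .
  fix s :: complex assume s: "Re s > 1"
  then have "f s = zs s" by (auto simp: f_def A_def zeta_right_eq_zs)
  then show "(\<lambda>n. 1 / of_nat (Suc n) powr s) sums f s" using zs_sums[OF s] by simp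
qed

lemma riemann_zeta_holomorphic: "riemann_zeta holomorphic_on - {1}"
  and riemann_zeta_eq_zs: "Re s > 1 \<Longrightarrow> riemann_zeta s = zs s"
proof -
  have *: "riemann_zeta holomorphic_on - {1} \<and> (\<forall>s. Re s > 1 \<longrightarrow> (\<lambda>n. 1 / of_nat (Suc n) powr s) sums riemann_zeta s)"
    unfolding riemann_zeta_def by (rule someI_ex[OF zeta_continuation])
  then show "riemann_zeta holomorphic_on - {1}" by blast
  show "riemann_zeta s = zs s" if "Re s > 1" using * that zs_sums[OF that] sums_unique2 by blast
qed

text \<open>Membership of 2 makes S meet the half-plane of convergence, and S stays connected when
  the point 1 is deleted.\<close>

lemma riemann_zeta_unique:
  assumes f: "f holomorphic_on S - {1}" "\<And>s. Re s > 1 \<Longrightarrow> s \<in> S \<Longrightarrow> f s = zs s"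
    and S: "open S" "connected S" "2 \<in> S" and s: "s \<in> S" "s \<noteq> 1"
  shows "riemann_zeta s = f s"
proof (rule analytic_continuation_open[where s = "S \<inter> {s. Re s > 1}" and s' = "S - {1}" and f = riemann_zeta])
  show "open (S \<inter> {s. Re s > 1})" using S by (intro open_Int open_halfspace_Re_gt)
  show "open (S - {1})" using S by (intro open_Diff) auto
  have "(2::complex) \<in> S \<inter> {s. Re s > 1}" using S by simp
  then show "S \<inter> {s. Re s > 1} \<noteq> {}" by blast
  show "connected (S - {1})" using S by (intro connected_open_delete) auto
  show "riemann_zeta holomorphic_on S - {1}" by (rule holomorphic_on_subset[OF riemann_zeta_holomorphic]) auto
qed (use f s in \<open>auto simp: riemann_zeta_eq_zs\<close>)

lemma riemann_zeta_eq_right: "Re s > -1 \<Longrightarrow> s \<noteq> 1 \<Longrightarrow> riemann_zeta s = zeta_right s"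
  by (rule riemann_zeta_unique[where S = "{s. Re s > -1}"])
     (auto simp: zeta_right_holomorphic zeta_right_eq_zs open_halfspace_Re_gt
       intro!: convex_connected convex_halfspace_Re_gt)

text \<open>At s = 0 the right-hand side would call the unspecified value of
  \<open>riemann_zeta\<close> at 1.\<close>

lemma riemann_zeta_functional_equation:
  assumes s: "Re s < 1" "s \<noteq> 0"
  shows "riemann_zeta s = zeta_refl riemann_zeta s"
proof (rule analytic_continuation_open[where s = "{s. -1 < Re s \<and> Re s < 0}" and s' = "{s. Re s < 1} - {0}" and f = riemann_zeta])
  show "open {s. -1 < Re s \<and> Re s < 0}" by (rule open_Re_strip)
  show "open ({s. Re s < 1} - {0::complex})" by (intro open_Diff open_halfspace_Re_lt) auto
  have "- 1 / 2 \<in> {s. -1 < Re s \<and> Re s < 0}" by simp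
  then show "{s. -1 < Re s \<and> Re s < 0} \<noteq> {}" by blast
  show "connected ({s. Re s < 1} - {0::complex})"
    by (intro connected_open_delete open_halfspace_Re_lt convex_connected convex_halfspace_Re_lt) auto
  show "riemann_zeta holomorphic_on {s. Re s < 1} - {0}"
    by (rule holomorphic_on_subset[OF riemann_zeta_holomorphic]) auto
  show "zeta_refl riemann_zeta holomorphic_on {s. Re s < 1} - {0}"
    by (intro zeta_refl_holomorphic holomorphic_on_subset[OF riemann_zeta_holomorphic]) auto
  fix s :: complex assume "s \<in> {s. -1 < Re s \<and> Re s < 0}"
  then have s: "-1 < Re s" "Re s < 0" by auto
  then have "s \<noteq> 1" by auto
  then have "riemann_zeta s = zeta_refl zs s"
    using s by (simp add: riemann_zeta_eq_right zeta_right_eq_refl)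
  also have "\<dots> = zeta_refl riemann_zeta s"
    using s by (simp add: zeta_refl_def riemann_zeta_eq_zs)
  finally show "riemann_zeta s = zeta_refl riemann_zeta s" .
qed (use s in auto)

lemma riemann_zeta_zero_reflect:
  assumes s: "0 < Re s" "Re s < 1" and z: "riemann_zeta s = 0"
  shows "riemann_zeta (1 - s) = 0"
proof -
  have "s \<noteq> 0" using s by auto
  then have "zeta_refl riemann_zeta s = 0"
    using riemann_zeta_functional_equation[of s] s z by simp
  \<comment> \<open>The sine vanishes only at even integers s, none of which has its real part in
    (0, 1).\<close>
  moreover have "sin (of_real pi * s / 2) \<noteq> 0"
  proof
    assume "sin (of_real pi * s / 2) = 0"
    then obtain n :: int where "of_real pi * s / 2 = of_real (of_int n * pi)" unfolding sin_eq_0 by blast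
    then have "of_real pi * s = of_real pi * of_int (2 * n)" by (simp add: field_simps)
    then have "s = of_int (2 * n)" by (subst (asm) mult_cancel_left) auto
    then have "Re s = of_int (2 * n)" by simp
    then have "0 < 2 * n" "2 * n < 1"
      using s by (simp_all only: of_int_0_less_iff of_int_less_1_iff)
    then show False by presburger
  qed
  moreover have "1 - s \<notin> \<int>\<^sub>\<le>\<^sub>0" using s by (auto elim!: nonpos_Ints_cases simp: complex_eq_iff)
  then have "Gamma (1 - s) \<noteq> 0" by (rule Gamma_nonzero)
  ultimately show ?thesis by (simp add: zeta_refl_def)
qed

section \<open>Zeta on Re s > 0 through fractional parts\<close>

definition frac_step :: "real \<Rightarrow> complex" where "frac_step t = of_real (frac t) * ustep t"

lemma mellin_conv_frac_step:
  assumes "a > 0"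
  shows "mellin_conv frac_step a"
proof (rule mellin_conv_bound[OF mellin_conv_ustep(1)[OF assms], where C = 1])
  have "(\<lambda>t. complex_of_real (frac t) * ustep t) \<in> borel_measurable borel"
    unfolding frac_def by measurable
  then show "frac_step \<in> borel_measurable Lpos"
    unfolding frac_step_def by (rule borel_imp_Lpos)
  show "t powr (- a - 1) * norm (frac_step t) \<le> 1 * (t powr (- a - 1) * norm (ustep t))" for t
    using frac_ge_0[of t] frac_lt_1[of t]
    by (auto simp: frac_step_def norm_mult intro!: mult_left_mono mult_left_le_one_le)
qed

lemma norm_mellin_frac_step_le:
  assumes "Re s > 0"
  shows "norm (mellin frac_step s) \<le> 1 / Re s"
proof -
  have "norm (mellin frac_step s) \<le> (\<integral>t. norm (of_real t powr (- s - 1) * frac_step t) \<partial>Lpos)"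
    unfolding mellin_def by (rule integral_norm_bound)
  also have "\<dots> \<le> (\<integral>t. t powr (- Re s - 1) * norm (ustep t) \<partial>Lpos)"
  proof (rule integral_mono)
    show "integrable Lpos (\<lambda>t. norm (of_real t powr (- s - 1) * frac_step t))"
      using assms by (intro integrable_norm mellin_conv_integrable mellin_conv_frac_step)
    show "integrable Lpos (\<lambda>t. t powr (- Re s - 1) * norm (ustep t))"
      using mellin_conv_ustep(1)[OF assms] by (simp add: mellin_conv_def)
    fix t assume "t \<in> space Lpos"
    then have "t > 0" by (simp add: space_restrict_space)
    then show "norm (of_real t powr (- s - 1) * frac_step t) \<le> t powr (- Re s - 1) * norm (ustep t)"
      using frac_ge_0[of t] frac_lt_1[of t] unfolding norm_mellin_kernel[OF \<open>t > 0\<close>]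
      by (auto simp: frac_step_def norm_mult intro!: mult_left_mono mult_left_le_one_le)
  qed
  also have "\<dots> = 1 / Re s" by (rule mellin_conv_ustep(2)[OF assms])
  finally show ?thesis .
qed

lemma mellin_frac_step_holomorphic: "mellin frac_step holomorphic_on {s. Re s > 0}"
proof (rule mellin_holomorphic_on)
  fix s assume "s \<in> {s. Re s > 0}"
  then show "\<exists>a b. a < Re s \<and> Re s < b \<and> mellin_conv frac_step a \<and> mellin_conv frac_step b"
    by (intro exI[of _ "Re s / 2"] exI[of _ "Re s + 1"]) (simp add: mellin_conv_frac_step)
qed

text \<open>From floor t = t - frac t. This second representation is the one that controls growth in
  Im s: its integral is at most 1/Re s in modulus, whereas \<open>zeta_right\<close> carries the
  rapidly growing factor rGamma.\<close>

lemma riemann_zeta_frac: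
  assumes "Re s > 0" "s \<noteq> 1"
  shows "riemann_zeta s = s / (s - 1) - s * mellin frac_step s"
proof (rule riemann_zeta_unique[where S = "{s. Re s > 0}"])
  show "(\<lambda>s. s / (s - 1) - s * mellin frac_step s) holomorphic_on {s. Re s > 0} - {1}"
    by (intro holomorphic_intros holomorphic_on_subset[OF mellin_frac_step_holomorphic]) auto
  show "open {s. Re s > 0}" "connected {s. Re s > 0}"
    by (auto intro!: open_halfspace_Re_gt convex_connected convex_halfspace_Re_gt)
  fix s assume s: "Re s > 1"
  then have s0: "s \<noteq> 0" "s \<noteq> 1" by auto
  have d: "dirichlet_conv (\<lambda>_. 1) s" using s by (intro dirichlet_conv_bounded[of _ 1]) auto
  have c1: "mellin_conv (\<lambda>t. of_real (t powr 1) * ustep t) (Re s)"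
    using s by (intro mellin_shift mellin_conv_ustep) simp
  have c2: "mellin_conv (\<lambda>t. -1 * frac_step t) (Re s)"
    using s by (intro mellin_cmult mellin_conv_frac_step) simp
  have sf: "sumfun (\<lambda>_. 1) t = of_real (t powr 1) * ustep t + -1 * frac_step t" if "t > 0" for t
  proof -
    have "{n. 1 \<le> n \<and> real n \<le> t} = {1..nat \<lfloor>t\<rfloor>}"
      using that by (auto simp: le_nat_floor le_nat_iff le_floor_iff)
    then have "sumfun (\<lambda>_. 1) t = of_nat (nat \<lfloor>t\<rfloor>)" by (simp add: sumfun_def)
    also have "\<dots> = of_real (real_of_int \<lfloor>t\<rfloor>)" using that by simp
    also have "\<dots> = of_real (t powr 1) * ustep t + -1 * frac_step t"
      using that by (auto simp: ustep_def frac_step_def frac_def floor_eq_iff)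
    finally show ?thesis .
  qed
  have "zs s / s = mellin (sumfun (\<lambda>_. 1)) s"
    using mellin_sumfun(2)[OF d] s by (simp add: zs_def)
  also have "\<dots> = mellin (\<lambda>t. of_real (t powr 1) * ustep t + -1 * frac_step t) s"
    using sf by (rule mellin_cong)
  also have "\<dots> = mellin ustep (s - of_real 1) + -1 * mellin frac_step s"
    by (simp only: mellin_add(2)[OF c1 c2] mellin_shift(2) mellin_cmult(2))
  also have "mellin ustep (s - of_real 1) = 1 / (s - 1)" using s by (subst mellin_ustep) auto
  finally have "zs s = s * (1 / (s - 1) + -1 * mellin frac_step s)" using s0 by (simp add: field_simps)
  then show "s / (s - 1) - s * mellin frac_step s = zs s" using s0 by (simp add: algebra_simps)
qed (use assms in auto)

subsection \<open>Zero-free regions and lower bounds\<close>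

text \<open>The function (s - 1) zeta(s) with the pole cancelled in the formula, so that its value 1
  at s = 1 requires no limit.\<close>

definition zeta_reg :: "complex \<Rightarrow> complex" where
  "zeta_reg s = s - s * (s - 1) * mellin frac_step s"

lemma zeta_reg_holomorphic: "zeta_reg holomorphic_on {s. Re s > 0}"
  unfolding zeta_reg_def
  by (intro holomorphic_intros mellin_frac_step_holomorphic)

lemma zeta_reg_eq:
  assumes "Re s > 0" "s \<noteq> 1"
  shows "zeta_reg s = (s - 1) * riemann_zeta s"
  using assms by (simp add: riemann_zeta_frac zeta_reg_def field_simps)

lemma zeta_reg_1 [simp]: "zeta_reg 1 = 1"
  by (simp add: zeta_reg_def)

lemma zeta_reg_eq_zs: "Re s > 1 \<Longrightarrow> zeta_reg s = (s - 1) * zs s"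
  by (subst zeta_reg_eq) (auto simp: riemann_zeta_eq_zs)

section \<open>Nonvanishing on the closed half-plane Re s \<ge> 1\<close>

lemma zs_nonzero: "Re s > 1 \<Longrightarrow> zs s \<noteq> 0"
  using zs_mult_mu_sum[of s] by auto

lemma mangoldt_series_eq:
  assumes s: "Re s > 1"
  shows "mangoldt_series s = 1 / (s - 1) - deriv zeta_reg s / zeta_reg s"
proof -
  have s1: "s \<noteq> 1" using s by auto
  have "(zs has_field_derivative deriv zs s) (at s)"
    using s by (intro holomorphic_derivI[OF zs_holomorphic open_halfspace_Re_gt]) auto
  then have "((\<lambda>s. (s - 1) * zs s) has_field_derivative (zs s + (s - 1) * deriv zs s)) (at s)"
    by (auto intro!: derivative_eq_intros)
  then have "(zeta_reg has_field_derivative (zs s + (s - 1) * deriv zs s)) (at s)"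
    by (rule has_field_derivative_transform_within_open[of _ _ _ "{s. Re s > 1}"])
       (use s zeta_reg_eq_zs open_halfspace_Re_gt in auto)
  then have "deriv zeta_reg s = zs s + (s - 1) * deriv zs s" by (rule DERIV_imp_deriv)
  also have "deriv zs s = - (zs s * mangoldt_series s)" using zs_mult_mangoldt_sum[OF s] by simp
  finally have d: "deriv zeta_reg s = zs s - (s - 1) * zs s * mangoldt_series s" by simp
  show ?thesis
    using s1 zs_nonzero[OF s] unfolding d zeta_reg_eq_zs[OF s] by (simp add: diff_divide_distrib)
qed

text \<open>Holds termwise, because 3 + 4 cos x + cos 2x = 2 (1 + cos x)^2 and the von Mangoldt
  coefficients are nonnegative.\<close>

lemma mangoldt_series_341:
  assumes \<sigma>: "\<sigma> > 1"
  shows "0 \<le> Re (3 * mangoldt_series (of_real \<sigma>) + 4 * mangoldt_series (Complex \<sigma> t) + mangoldt_series (Complex \<sigma> (2 * t)))"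
proof -
  have tm: "Re (mangoldt (Suc n) / of_nat (Suc n) powr Complex \<sigma> u) =
      mangoldt (Suc n) / real (Suc n) powr \<sigma> * cos (u * ln (real (Suc n)))" for n u
  proof -
    have ne: "complex_of_nat (Suc n) \<noteq> 0" by (rule of_nat_neq_0)
    have ln: "Ln (of_nat (Suc n)) = of_real (ln (real (Suc n)))"
      by (metis of_nat_0_less_iff zero_less_Suc of_real_of_nat_eq Ln_of_real)
    have "1 / of_nat (Suc n) powr Complex \<sigma> u = exp (- (Complex \<sigma> u * of_real (ln (real (Suc n)))))"
      using ne ln by (simp add: powr_def exp_minus divide_inverse del: of_nat_Suc)
    also have "Re \<dots> = exp (- (\<sigma> * ln (real (Suc n)))) * cos (u * ln (real (Suc n)))"
      by (simp add: Re_exp del: of_nat_Suc)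
    also have "exp (- (\<sigma> * ln (real (Suc n)))) = 1 / real (Suc n) powr \<sigma>"
      by (simp add: powr_def exp_minus divide_inverse del: of_nat_Suc)
    finally have 1: "Re (1 / of_nat (Suc n) powr Complex \<sigma> u) = 1 / real (Suc n) powr \<sigma> * cos (u * ln (real (Suc n)))" .
    have "Re (mangoldt (Suc n) / of_nat (Suc n) powr Complex \<sigma> u) =
        Re (of_real (mangoldt (Suc n)) * (1 / of_nat (Suc n) powr Complex \<sigma> u))" by simp
    also have "\<dots> = mangoldt (Suc n) * Re (1 / of_nat (Suc n) powr Complex \<sigma> u)"
    proof -
      have "Re (of_real r * z) = r * Re z" for r z by simp
      then show ?thesis .
    qed
    finally show ?thesis unfolding 1 by simp
  qed
  have S: "(\<lambda>n. mangoldt (Suc n) / real (Suc n) powr \<sigma> * cos (u * ln (real (Suc n)))) sums Re (mangoldt_series (Complex \<sigma> u))" for u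
    unfolding tm[symmetric] mangoldt_series_def
    using \<sigma> by (intro sums_Re dirichlet_sums dirichlet_conv_log_bounded norm_mangoldt_le) simp
  have c: "Complex \<sigma> 0 = of_real \<sigma>" by (simp add: complex_eq_iff)
  have A: "(\<lambda>n. 3 * (mangoldt (Suc n) / real (Suc n) powr \<sigma> * cos (0 * ln (real (Suc n)))) +
      4 * (mangoldt (Suc n) / real (Suc n) powr \<sigma> * cos (t * ln (real (Suc n)))) +
      mangoldt (Suc n) / real (Suc n) powr \<sigma> * cos (2 * t * ln (real (Suc n)))) sums
     (3 * Re (mangoldt_series (Complex \<sigma> 0)) + 4 * Re (mangoldt_series (Complex \<sigma> t)) + Re (mangoldt_series (Complex \<sigma> (2 * t))))"
    by (rule sums_add[OF sums_add[OF sums_mult[OF S[of 0], of 3] sums_mult[OF S[of t], of 4]] S[of "2 * t"]])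
  have B: "0 \<le> 3 * (mangoldt (Suc n) / real (Suc n) powr \<sigma> * cos (0 * ln (real (Suc n)))) +
      4 * (mangoldt (Suc n) / real (Suc n) powr \<sigma> * cos (t * ln (real (Suc n)))) +
      mangoldt (Suc n) / real (Suc n) powr \<sigma> * cos (2 * t * ln (real (Suc n)))" for n
  proof -
    define m where "m = mangoldt (Suc n) / real (Suc n) powr \<sigma>"
    define x where "x = t * ln (real (Suc n))"
    have "m \<ge> 0" unfolding m_def using mangoldt_bounds(1) by (intro divide_nonneg_nonneg) auto
    then have "0 \<le> m * (2 * (1 + cos x) ^ 2)" by simp
    also have "\<dots> = 3 * (m * cos (0 * ln (real (Suc n)))) + 4 * (m * cos x) + m * cos (2 * x)"
      unfolding cos_double_cos by (simp add: power2_eq_square algebra_simps)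
    finally show ?thesis unfolding m_def x_def by (simp only: mult.assoc)
  qed
  have "0 \<le> 3 * Re (mangoldt_series (Complex \<sigma> 0)) + 4 * Re (mangoldt_series (Complex \<sigma> t)) + Re (mangoldt_series (Complex \<sigma> (2 * t)))"
    by (rule sums_le[OF B sums_zero A])
  then show ?thesis by (simp add: c)
qed

text \<open>The number n is the order of vanishing at a: near a, f is (w - a)^n times a nonvanishing
  function. The point b excludes the zero function.\<close>

lemma log_deriv_order_limit:
  assumes f: "f holomorphic_on S" "open S" "connected S" "a \<in> S" "b \<in> S" "f b \<noteq> 0"
  shows "\<exists>n::nat. ((\<lambda>\<delta>. of_real \<delta> * (deriv f (a + of_real \<delta>) / f (a + of_real \<delta>))) \<longlongrightarrow> of_nat n) (at_right (0::real)) \<and>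
            (f a = 0 \<longrightarrow> n > 0)"
proof -
  obtain g r n where g: "r > 0" "ball a r \<subseteq> S" "g holomorphic_on ball a r"
      "\<And>w. w \<in> ball a r \<Longrightarrow> f w = (w - a) ^ n * g w" "\<And>w. w \<in> ball a r \<Longrightarrow> g w \<noteq> 0" "f a = 0 \<longrightarrow> n > 0"
  proof (cases "f a = 0")
    case True
    have "\<not> f constant_on S" using f(4-6) True unfolding constant_on_def by metis
    then show ?thesis using holomorphic_factor_zero_nonconstant[OF f(1-4) True] that by metis
  next
    case False
    have "continuous_on S f" using f(1) by (rule holomorphic_on_imp_continuous_on)
    then have "open {w \<in> S. f w \<noteq> 0}"
      using f(2) continuous_open_preimage[of S f "- {0}"] by (auto simp: vimage_def Int_def)
    then obtain r where "r > 0" "ball a r \<subseteq> {w \<in> S. f w \<noteq> 0}"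
      using f(4) False open_contains_ball by (metis (mono_tags, lifting) mem_Collect_eq)
    then show ?thesis using f(1) False
      by (intro that[of r f 0]) (auto intro: holomorphic_on_subset)
  qed
  have lim: "((\<lambda>\<delta>. of_nat n + of_real \<delta> * (deriv g (a + of_real \<delta>) / g (a + of_real \<delta>))) \<longlongrightarrow>
      of_nat n + of_real 0 * (deriv g (a + of_real 0) / g (a + of_real 0))) (at_right (0::real))"
  proof (intro tendsto_intros)
    have a: "a \<in> ball a r" using g(1) by simp
    have t: "((\<lambda>\<delta>. a + of_real \<delta>) \<longlongrightarrow> a + of_real 0) (at_right (0::real))" by (intro tendsto_intros)
    have "isCont g a" "isCont (deriv g) a"
      using holomorphic_on_imp_differentiable_at[OF g(3) open_ball a]
        holomorphic_on_imp_differentiable_at[OF holomorphic_deriv[OF g(3) open_ball] open_ball a]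
      by (auto intro: field_differentiable_imp_continuous_at)
    then show "((\<lambda>\<delta>. g (a + of_real \<delta>)) \<longlongrightarrow> g (a + of_real 0)) (at_right (0::real))"
       "((\<lambda>\<delta>. deriv g (a + of_real \<delta>)) \<longlongrightarrow> deriv g (a + of_real 0)) (at_right (0::real))"
      using t by (auto intro!: isCont_tendsto_compose[of a])
    show "g (a + of_real 0) \<noteq> 0" using g(5)[OF a] by simp
  qed
  have "((\<lambda>\<delta>. of_real \<delta> * (deriv f (a + of_real \<delta>) / f (a + of_real \<delta>))) \<longlongrightarrow> of_nat n) (at_right (0::real))"
  proof (rule Lim_transform_eventually)
    show "((\<lambda>\<delta>. of_nat n + of_real \<delta> * (deriv g (a + of_real \<delta>) / g (a + of_real \<delta>))) \<longlongrightarrow> of_nat n) (at_right (0::real))"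
      using lim by simp
    have "eventually (\<lambda>\<delta>. \<delta> \<in> {0<..<r}) (at_right 0)"
      using g(1) by (rule eventually_at_rightI[of 0 r, rotated]) auto
    then show "\<forall>\<^sub>F \<delta> in at_right 0. of_nat n + of_real \<delta> * (deriv g (a + of_real \<delta>) / g (a + of_real \<delta>)) =
        of_real \<delta> * (deriv f (a + of_real \<delta>) / f (a + of_real \<delta>))"
    proof eventually_elim
      case (elim \<delta>)
      define w where "w = a + complex_of_real \<delta>"
      have w: "w \<in> ball a r" using elim by (simp add: w_def dist_norm)
      have wa: "w - a = of_real \<delta>" "w - a \<noteq> 0" using elim by (auto simp: w_def)
      have "(g has_field_derivative deriv g w) (at w)"
        using w by (intro holomorphic_derivI[OF g(3)]) auto
      then have "((\<lambda>w. (w - a) ^ n * g w) has_field_derivative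
          (of_nat n * (w - a) ^ (n - 1) * g w + (w - a) ^ n * deriv g w)) (at w)"
        by (auto intro!: derivative_eq_intros)
      then have "(f has_field_derivative (of_nat n * (w - a) ^ (n - 1) * g w + (w - a) ^ n * deriv g w)) (at w)"
        by (rule has_field_derivative_transform_within_open[of _ _ _ "ball a r"]) (use w g(4) in auto)
      then have d: "deriv f w = of_nat n * (w - a) ^ (n - 1) * g w + (w - a) ^ n * deriv g w"
        by (rule DERIV_imp_deriv)
      have "(w - a) * (of_nat n * (w - a) ^ (n - 1)) = of_nat n * (w - a) ^ n"
        by (cases n) auto
      then have "(w - a) * deriv f w = of_nat n * (w - a) ^ n * g w + (w - a) * ((w - a) ^ n * deriv g w)"
        unfolding d by (simp add: distrib_left flip: mult.assoc)
      then have "(w - a) * (deriv f w / f w) =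
          (of_nat n * (w - a) ^ n * g w + (w - a) * ((w - a) ^ n * deriv g w)) / ((w - a) ^ n * g w)"
        using g(4)[OF w] by simp
      also have "\<dots> = of_nat n + (w - a) * (deriv g w / g w)"
        using g(5)[OF w] wa(2) by (simp add: add_divide_distrib)
      finally have "(w - a) * (deriv f w / f w) = of_nat n + (w - a) * (deriv g w / g w)" .
      then show ?case by (simp only: wa(1) flip: w_def)
    qed
  qed
  then show ?thesis using g(6) by blast
qed

text \<open>For Re s = 1 the 3-4-1 inequality is multiplied by \<delta> and \<delta> tends to 0. The
  limit is 3 - 3 n(0) - 4 n(t) - n(2t), with n(u) the order of vanishing at 1 + iu: the pole of zeta
  contributes 3, whereas a zero at 1 + it costs at least 4.\<close>

lemma zeta_reg_nonzero:
  assumes "Re s \<ge> 1"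
  shows "zeta_reg s \<noteq> 0"
proof (cases "Re s = 1 \<and> Im s \<noteq> 0")
  case False
  then have "s = 1 \<or> Re s > 1" using assms by (auto simp: complex_eq_iff)
  then show ?thesis
  proof
    assume s: "Re s > 1"
    then have "s \<noteq> 1" by auto
    then show ?thesis using zs_nonzero[OF s] by (simp add: zeta_reg_eq_zs[OF s])
  qed simp
next
  case True
  define t where "t = Im s"
  have t: "t \<noteq> 0" "s = Complex 1 t" using True by (auto simp: t_def complex_eq_iff)
  show ?thesis
  proof
    assume z: "zeta_reg s = 0"
    define R where "R = (\<lambda>w. deriv zeta_reg w / zeta_reg w)"
    have ex: "\<exists>n::nat. ((\<lambda>\<delta>. of_real \<delta> * (R (Complex 1 u + of_real \<delta>))) \<longlongrightarrow> of_nat n) (at_right (0::real)) \<and>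
            (zeta_reg (Complex 1 u) = 0 \<longrightarrow> n > 0)" for u
      unfolding R_def
      by (rule log_deriv_order_limit[OF zeta_reg_holomorphic open_halfspace_Re_gt convex_connected[OF convex_halfspace_Re_gt], where b = 1]) auto
    \<comment> \<open>The contribution of the pole at 1, which is seen at ordinate 0 only.\<close>
    have lim0: "((\<lambda>\<delta>. of_real \<delta> / (Complex 0 u + of_real \<delta>)) \<longlongrightarrow> (if u = 0 then 1 else 0)) (at_right (0::real))" for u
    proof (cases "u = 0")
      case True
      have "((\<lambda>\<delta>. 1 :: complex) \<longlongrightarrow> 1) (at_right (0::real))" by simp
      then have "((\<lambda>\<delta>. of_real \<delta> / (Complex 0 0 + of_real \<delta>)) \<longlongrightarrow> 1) (at_right (0::real))"
      proof (rule Lim_transform_eventually)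
        show "\<forall>\<^sub>F \<delta> in at_right (0::real). 1 = of_real \<delta> / (Complex 0 0 + of_real \<delta>)"
          using eventually_at_right_less[of 0] by eventually_elim (simp flip: zero_complex.code)
      qed
      then show ?thesis using True by simp
    next
      case False
      then have "((\<lambda>\<delta>. of_real \<delta> / (Complex 0 u + of_real \<delta>)) \<longlongrightarrow> of_real 0 / (Complex 0 u + of_real 0)) (at_right (0::real))"
        by (intro tendsto_intros) (auto simp: complex_eq_iff)
      then show ?thesis using False by simp
    qed
    obtain n where n: "\<And>u. ((\<lambda>\<delta>. of_real \<delta> * (R (Complex 1 u + of_real \<delta>))) \<longlongrightarrow> of_nat (n u)) (at_right (0::real))"
       "\<And>u. zeta_reg (Complex 1 u) = 0 \<longrightarrow> (n u :: nat) > 0"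
      using ex by metis
    have L: "((\<lambda>\<delta>. of_real \<delta> * mangoldt_series (Complex (1 + \<delta>) u)) \<longlongrightarrow> (if u = 0 then 1 else 0) - of_nat (n u)) (at_right (0::real))" for u
    proof (rule Lim_transform_eventually[OF tendsto_diff[OF lim0[of u] n(1)[of u]]])
      show "\<forall>\<^sub>F \<delta> in at_right (0::real). of_real \<delta> / (Complex 0 u + of_real \<delta>) -
          of_real \<delta> * (R (Complex 1 u + of_real \<delta>)) =
          of_real \<delta> * mangoldt_series (Complex (1 + \<delta>) u)"
        using eventually_at_right_less[of 0]
      proof eventually_elim
        case (elim \<delta>)
        have e: "Complex 1 u + of_real \<delta> = Complex (1 + \<delta>) u" "Complex 0 u + of_real \<delta> = Complex (1 + \<delta>) u - 1"
          by (auto simp: complex_eq_iff)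
        show ?case unfolding e R_def using elim by (subst mangoldt_series_eq) (auto simp: right_diff_distrib)
      qed
    qed
    define A where "A = (\<lambda>\<delta>. Re (3 * (of_real \<delta> * mangoldt_series (Complex (1 + \<delta>) 0)) + 4 * (of_real \<delta> * mangoldt_series (Complex (1 + \<delta>) t)) +
        of_real \<delta> * mangoldt_series (Complex (1 + \<delta>) (2 * t))))"
    define l where "l = (\<lambda>u::real. (if u = 0 then 1 else 0) - complex_of_nat (n u))"
    have "(A \<longlongrightarrow> Re (3 * l 0 + 4 * l t + l (2 * t))) (at_right 0)"
      unfolding A_def l_def by (intro tendsto_intros L)
    moreover have "\<forall>\<^sub>F \<delta> in at_right 0. 0 \<le> A \<delta>"
      using eventually_at_right_less[of 0]
    proof eventually_elim
      case (elim \<delta>)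
      have c: "complex_of_real (1 + \<delta>) = Complex (1 + \<delta>) 0" by (simp add: complex_eq_iff)
      have "0 \<le> \<delta> * Re (3 * mangoldt_series (of_real (1 + \<delta>)) + 4 * mangoldt_series (Complex (1 + \<delta>) t) + mangoldt_series (Complex (1 + \<delta>) (2 * t)))"
        using elim by (intro mult_nonneg_nonneg mangoldt_series_341) auto
      then show ?case unfolding c A_def by (simp add: algebra_simps)
    qed
    ultimately have "0 \<le> Re (3 * l 0 + 4 * l t + l (2 * t))"
      by (intro tendsto_lowerbound) auto
    then have "3 * real (n 0) + 4 * real (n t) + real (n (2 * t)) \<le> 3" using t by (simp add: l_def)
    moreover have "n t > 0" using n(2)[of t] z t by simp
    then have "real (n t) \<ge> 1" by simp
    ultimately show False by linarith
  qed
qed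

lemma zeta_reg_nonzero_RH:
  assumes "riemann_hypothesis" "Re s > 1 / 2"
  shows "zeta_reg s \<noteq> 0"
proof (cases "Re s \<ge> 1")
  case False
  then have "s \<noteq> 1" by auto
  then have e: "zeta_reg s = (s - 1) * riemann_zeta s" using assms by (intro zeta_reg_eq) auto
  have "riemann_zeta s \<noteq> 0" using assms False by (force simp: riemann_hypothesis_def)
  then show ?thesis using \<open>s \<noteq> 1\<close> by (simp add: e)
qed (rule zeta_reg_nonzero)

section \<open>Growth of zeta, and of its inverse under the Riemann hypothesis\<close>

lemma norm_riemann_zeta_le:
  assumes "Re s \<ge> 1 / 2" "\<bar>Im s\<bar> \<ge> 1"
  shows "norm (riemann_zeta s) \<le> 3 * norm s"
proof -
  have s: "Re s > 0" "s \<noteq> 1" using assms by auto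
  have "norm (s - 1) \<ge> 1" using abs_Im_le_cmod[of "s - 1"] assms by simp
  then have "norm (s / (s - 1)) \<le> norm s"
    by (simp add: norm_divide divide_le_eq mult_left_mono[of 1 _ "norm s", simplified])
  moreover have "norm (s * mellin frac_step s) \<le> norm s * 2"
  proof -
    have "norm (mellin frac_step s) \<le> 1 / Re s" by (rule norm_mellin_frac_step_le[OF s(1)])
    also have "\<dots> \<le> 2" using assms by (simp add: field_simps)
    finally show ?thesis by (simp add: norm_mult mult_left_mono)
  qed
  ultimately show ?thesis
    unfolding riemann_zeta_frac[OF s] using norm_triangle_ineq4[of "s / (s - 1)" "s * mellin frac_step s"] by linarith
qed

text \<open>Were the bound false along $s_n$ with ordinates $\tau_n$, Montel's theorem would apply to
  $h_n(z) = \zeta(z + i\tau_n)^{1/\ln|\tau_n|}$: these are bounded because $\zeta$ grows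
  polynomially, and $|h_n| \to 1$ where $\Re z > 2$. Hence every limit has modulus 1 throughout
  $\Re z > 1/2$, whereas $|h_n(\Re s_n)| < e^{-\varepsilon}$. This replaces the classical use of
  the theorems of Borel--Caratheodory and Hadamard.\<close>

lemma riemann_zeta_lower_bound:
  assumes RH: "riemann_hypothesis" and a: "1 / 2 < a" and e: "\<epsilon> > 0"
  shows "\<exists>T. \<forall>s. a \<le> Re s \<and> Re s \<le> b \<and> \<bar>Im s\<bar> \<ge> T \<longrightarrow> \<bar>Im s\<bar> powr (- \<epsilon>) \<le> norm (riemann_zeta s)"
proof (rule ccontr)
  assume "\<not> ?thesis"
  then have "\<forall>T. \<exists>s. a \<le> Re s \<and> Re s \<le> b \<and> \<bar>Im s\<bar> \<ge> T \<and> norm (riemann_zeta s) < \<bar>Im s\<bar> powr (- \<epsilon>)"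
    by (meson not_le)
  \<comment> \<open>The offset 4 makes ln |Im s| at least 1 and keeps the shifted box of height 2
    away from the pole.\<close>
  then have "\<forall>n::nat. \<exists>s. a \<le> Re s \<and> Re s \<le> b \<and> \<bar>Im s\<bar> \<ge> real n + 4 \<and> norm (riemann_zeta s) < \<bar>Im s\<bar> powr (- \<epsilon>)"
    by blast
  then obtain s where s: "\<And>n::nat. a \<le> Re (s n)" "\<And>n. Re (s n) \<le> b" "\<And>n. \<bar>Im (s n)\<bar> \<ge> real n + 4"
      "\<And>n. norm (riemann_zeta (s n)) < \<bar>Im (s n)\<bar> powr (- \<epsilon>)"
    by metis
  define \<tau> where "\<tau> = (\<lambda>n. Im (s n))"
  define l where "l = (\<lambda>n. ln \<bar>\<tau> n\<bar>)"
  have \<tau>: "\<bar>\<tau> n\<bar> \<ge> real n + 4" for n using s(3) by (simp add: \<tau>_def)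
  have \<tau>0: "\<tau> n \<noteq> 0" "\<bar>\<tau> n\<bar> > 0" for n using \<tau>[of n] by auto
  have l1: "l n \<ge> 1" for n
  proof -
    have "exp 1 \<le> \<bar>\<tau> n\<bar>" using \<tau>[of n] exp_le by linarith
    then have "ln (exp 1) \<le> l n" unfolding l_def using \<tau>0[of n] by (subst ln_le_cancel_iff) auto
    then show ?thesis by simp
  qed
  have l_lim: "filterlim l at_top sequentially"
    unfolding l_def
  proof (rule filterlim_compose[OF ln_at_top])
    have "filterlim (\<lambda>n. real n) at_top sequentially" by (rule filterlim_real_sequentially)
    then show "filterlim (\<lambda>n. \<bar>\<tau> n\<bar>) at_top sequentially"
      by (rule filterlim_at_top_mono) (intro always_eventually allI order_trans[OF _ \<tau>], simp)
  qed
  \<comment> \<open>The box has to contain the segment [a, b], where the bound is violated, and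
    points with Re z > 2, where the Dirichlet series controls \<open>h\<close>.\<close>
  define B where "B = max b 3 + 1"
  define S where "S = {z. 1 / 2 < Re z} \<inter> {z. Re z < B} \<inter> ({z. -1 < Im z} \<inter> {z. Im z < 1})"
  have S: "open S" "convex S"
    unfolding S_def by (intro open_Int open_halfspace_Re_gt open_halfspace_Re_lt open_halfspace_Im_gt open_halfspace_Im_lt)
      (intro convex_Int convex_halfspace_Re_gt convex_halfspace_Re_lt convex_halfspace_Im_gt convex_halfspace_Im_lt)
  define f where "f = (\<lambda>n z. riemann_zeta (z + \<i> * of_real (\<tau> n)))"
  have im: "\<bar>Im (z + \<i> * of_real (\<tau> n))\<bar> \<ge> 1" "z + \<i> * of_real (\<tau> n) \<noteq> 1" "Re (z + \<i> * of_real (\<tau> n)) > 1 / 2" if "z \<in> S" for z n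
  proof -
    show "\<bar>Im (z + \<i> * of_real (\<tau> n))\<bar> \<ge> 1" "Re (z + \<i> * of_real (\<tau> n)) > 1 / 2"
      using that \<tau>[of n] by (auto simp: S_def)
    then show "z + \<i> * of_real (\<tau> n) \<noteq> 1" by (metis abs_zero not_one_le_zero one_complex.sel(2))
  qed
  have fh: "f n holomorphic_on S" for n
  proof -
    have "riemann_zeta \<circ> (\<lambda>z. z + \<i> * of_real (\<tau> n)) holomorphic_on S"
      using im by (intro holomorphic_on_compose_gen[OF _ riemann_zeta_holomorphic] holomorphic_intros) auto
    then show ?thesis by (simp add: f_def o_def)
  qed
  have f0: "f n z \<noteq> 0" if "z \<in> S" for n z
    using zeta_reg_nonzero_RH[OF RH im(3)[OF that]] im[OF that, of n] zeta_reg_eq[of "z + \<i> * of_real (\<tau> n)"]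
    by (auto simp: f_def)
  have three: "3 \<in> S" by (simp add: S_def B_def)
  \<comment> \<open>By \<open>f0\<close> the Riemann hypothesis excludes zeros in the convex box, so
    a holomorphic logarithm exists, and with it the power 1/ln |\<tau>|.\<close>
  have "\<exists>L. L holomorphic_on S \<and> (\<forall>z\<in>S. exp (L z) = f n z)" for n
    using holomorphic_logarithm_exists[OF S(2,1) fh f0 three] by metis
  then obtain L where L: "\<And>n. L n holomorphic_on S" "\<And>n z. z \<in> S \<Longrightarrow> exp (L n z) = f n z" by metis
  define h where "h = (\<lambda>n z. exp (L n z / of_real (l n)))"
  have hh: "h n holomorphic_on S" for n
    unfolding h_def using L(1) l1[of n] by (intro holomorphic_intros) auto
  have nh: "norm (h n z) = exp (ln (norm (f n z)) / l n)" if "z \<in> S" for n z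
  proof -
    have "norm (f n z) = exp (Re (L n z))" using L(2)[OF that, of n] by (metis norm_exp_eq_Re)
    then have "ln (norm (f n z)) = Re (L n z)" by simp
    moreover have "norm (h n z) = exp (Re (L n z) / l n)" unfolding h_def by simp
    ultimately show ?thesis by simp
  qed
  have hb: "norm (h n z) \<le> exp (ln (3 * (B + 2)) + 1)" if z: "z \<in> S" for n z
  proof -
    have B: "B \<ge> 4" by (simp add: B_def)
    define w where "w = z + \<i> * of_real (\<tau> n)"
    have "norm w \<le> \<bar>Re w\<bar> + \<bar>Im w\<bar>" by (rule cmod_le)
    also have "\<dots> \<le> B + (\<bar>\<tau> n\<bar> + 1)" using z by (auto simp: w_def S_def)
    also have "\<dots> \<le> B * \<bar>\<tau> n\<bar> + (\<bar>\<tau> n\<bar> + \<bar>\<tau> n\<bar>)"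
      using \<tau>[of n] B by (intro add_mono mult_left_mono[of 1 _ B, simplified]) auto
    also have "\<dots> = (B + 2) * \<bar>\<tau> n\<bar>" by (simp add: algebra_simps)
    finally have nw: "norm w \<le> (B + 2) * \<bar>\<tau> n\<bar>" .
    have "norm (f n z) \<le> 3 * norm w"
      unfolding f_def w_def using im[OF z, of n] by (intro norm_riemann_zeta_le) auto
    also have "\<dots> \<le> 3 * ((B + 2) * \<bar>\<tau> n\<bar>)" using nw by (rule mult_left_mono) simp
    finally have "norm (f n z) \<le> 3 * (B + 2) * \<bar>\<tau> n\<bar>" by (simp only: mult.assoc)
    then have "ln (norm (f n z)) \<le> ln (3 * (B + 2) * \<bar>\<tau> n\<bar>)"
      using f0[OF z, of n] by (subst ln_le_cancel_iff) (use B \<tau>0[of n] in auto)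
    also have "\<dots> = ln (3 * (B + 2)) + l n"
      using B \<tau>0[of n] unfolding l_def by (subst ln_mult) auto
    finally have "ln (norm (f n z)) / l n \<le> (ln (3 * (B + 2)) + l n) / l n"
      using l1[of n] by (intro divide_right_mono) auto
    also have "\<dots> = ln (3 * (B + 2)) / l n + 1" using l1[of n] by (simp add: add_divide_distrib)
    also have "\<dots> \<le> ln (3 * (B + 2)) / 1 + 1"
      using l1[of n] B by (intro add_right_mono divide_left_mono) auto
    finally show ?thesis unfolding nh[OF z] by simp
  qed
  obtain g r where g: "g holomorphic_on S" "strict_mono (r :: nat \<Rightarrow> nat)"
     "\<And>x. x \<in> S \<Longrightarrow> ((\<lambda>n. h (r n) x) \<longlongrightarrow> g x) sequentially"
     "\<And>K. \<lbrakk>compact K; K \<subseteq> S\<rbrakk> \<Longrightarrow> uniform_limit K (h \<circ> r) g sequentially"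
  proof (rule Montel[of S "range h" h])
    show "\<exists>B. \<forall>h\<in>range h. \<forall>z\<in>K. norm (h z) \<le> B" if "compact K" "K \<subseteq> S" for K
      using hb that by blast
  qed (use S(1) hh in auto)
  have g1: "norm (g z) = 1" if z: "z \<in> S" "Re z > 2" for z
  proof -
    define K where "K = Re (zs 2)"
    have bd: "\<bar>ln (norm (f n z))\<bar> \<le> \<bar>ln K\<bar>" for n
    proof -
      define w where "w = z + \<i> * of_real (\<tau> n)"
      have w: "Re w \<ge> 2" using z by (simp add: w_def)
      have fz: "f n z = zs w" using w by (simp add: f_def w_def riemann_zeta_eq_zs)
      have u: "norm (zs w) \<le> K" "norm (mu_sum w) \<le> K" unfolding K_def by (rule norm_zs_le[OF w])+
      have p: "norm (zs w) * norm (mu_sum w) = 1"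
        using zs_mult_mu_sum[of w] w by (simp flip: norm_mult)
      have pos: "norm (zs w) > 0" "norm (mu_sum w) > 0" using p by (auto simp: zero_less_norm_iff simp del: norm_le_zero_iff)
      have "ln (norm (zs w)) \<le> ln K" "ln (norm (mu_sum w)) \<le> ln K"
        using u pos by (subst ln_le_cancel_iff; linarith)+
      moreover have "ln (norm (zs w)) + ln (norm (mu_sum w)) = 0"
        using ln_mult[of "norm (zs w)" "norm (mu_sum w)"] pos p by auto
      ultimately show ?thesis unfolding fz by linarith
    qed
    have "(\<lambda>n. ln (norm (f n z)) / l n) \<longlonglongrightarrow> 0"
    proof (rule Lim_null_comparison)
      show "(\<lambda>n. \<bar>ln K\<bar> / l n) \<longlonglongrightarrow> 0"
        using l_lim by (intro real_tendsto_divide_at_top[OF tendsto_const])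
      show "\<forall>\<^sub>F n in sequentially. norm (ln (norm (f n z)) / l n) \<le> \<bar>ln K\<bar> / l n"
      proof (intro always_eventually allI)
        fix n
        have "l n > 0" using l1[of n] by linarith
        then show "norm (ln (norm (f n z)) / l n) \<le> \<bar>ln K\<bar> / l n"
          using bd[of n] by (simp add: divide_right_mono)
      qed
    qed
    then have "(\<lambda>n. norm (h n z)) \<longlonglongrightarrow> exp 0" unfolding nh[OF z(1)] by (intro tendsto_exp)
    then have "((\<lambda>n. norm (h n z)) \<circ> r) \<longlonglongrightarrow> 1" using g(2) by (simp add: LIMSEQ_subseq_LIMSEQ)
    moreover have "(\<lambda>n. norm (h (r n) z)) \<longlonglongrightarrow> norm (g z)" using g(3)[OF z(1)] by (rule tendsto_norm)
    ultimately show ?thesis using LIMSEQ_unique by (auto simp: o_def)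
  qed
  \<comment> \<open>As |g| = 1 on the open part Re z > 2 of the box, |g| has a local maximum at
    3.\<close>
  have "g constant_on S"
  proof (rule maximum_modulus_principle[OF g(1) S(1) convex_connected[OF S(2)], where U = "S \<inter> {z. Re z > 2}" and \<xi> = 3])
    show "open (S \<inter> {z. Re z > 2})" using S(1) by (intro open_Int open_halfspace_Re_gt)
    show "norm (g z) \<le> norm (g 3)" if "z \<in> S \<inter> {z. Re z > 2}" for z
      using that g1[of z] g1[OF three] by auto
  qed (use three in auto)
  then have g1': "norm (g z) = 1" if "z \<in> S" for z
    using that three g1[OF three] by (auto simp: constant_on_def)
  define K where "K = of_real ` {a..b} \<inter> S"
  have KS: "of_real ` {a..b} \<subseteq> S" using a by (auto simp: S_def B_def)
  have "compact (of_real ` {a..b} :: complex set)"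
    by (intro compact_continuous_image continuous_intros) auto
  \<comment> \<open>Uniformity on the segment is needed because the abscissa Re (s n) changes with
    n.\<close>
  from g(4)[OF this KS] have "\<forall>\<^sub>F n in sequentially. \<forall>x\<in>of_real ` {a..b}. dist ((h \<circ> r) n x) (g x) < 1 - exp (- \<epsilon>)"
    by (rule uniform_limitD) (use e in simp)
  then obtain n where n: "\<And>x. x \<in> of_real ` {a..b} \<Longrightarrow> dist (h (r n) x) (g x) < 1 - exp (- \<epsilon>)"
    by (auto simp: eventually_sequentially)
  define m where "m = r n"
  define x where "x = complex_of_real (Re (s m))"
  have x: "x \<in> of_real ` {a..b}" using s(1,2) by (auto simp: x_def)
  then have xS: "x \<in> S" using KS by blast
  have "norm (g x) \<le> norm (h m x) + dist (h m x) (g x)"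
    by (metis dist_norm norm_triangle_sub norm_minus_commute)
  then have "norm (h m x) > exp (- \<epsilon>)" using n[OF x] g1'[OF xS] unfolding m_def by linarith
  moreover have "norm (h m x) \<le> exp (- \<epsilon>)"
  proof -
    have "x + \<i> * of_real (\<tau> m) = s m" by (simp add: x_def \<tau>_def complex_eq_iff)
    then have fm: "f m x = riemann_zeta (s m)" by (simp add: f_def)
    have "norm (f m x) < \<bar>\<tau> m\<bar> powr (- \<epsilon>)" unfolding fm \<tau>_def by (rule s(4))
    then have "ln (norm (f m x)) \<le> ln (\<bar>\<tau> m\<bar> powr (- \<epsilon>))"
      using f0[OF xS, of m] by (subst ln_le_cancel_iff) (use \<tau>0[of m] in auto)
    also have "\<dots> = - \<epsilon> * l m" using \<tau>0[of m] by (simp add: ln_powr l_def)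
    finally have "ln (norm (f m x)) / l m \<le> - \<epsilon>" using l1[of m] by (simp add: divide_le_eq)
    then show ?thesis unfolding nh[OF xS] by simp
  qed
  ultimately show False by linarith
qed

text \<open>For large ordinates this is \<open>riemann_zeta_lower_bound\<close>, with the additional
  -1 in the exponent coming from the factor s - 1; for bounded ordinates it is nonvanishing on a
  compact box.\<close>

lemma inverse_zeta_reg_bound:
  assumes RH: "riemann_hypothesis" and a: "1 / 2 < a" and e: "0 < \<epsilon>" "\<epsilon> < 1"
  shows "\<exists>C>0. \<forall>s. a \<le> Re s \<and> Re s \<le> b \<longrightarrow> norm (1 / zeta_reg s) \<le> C * (1 + \<bar>Im s\<bar>) powr (\<epsilon> - 1)"
proof -
  obtain T0 where T0: "\<And>s. a \<le> Re s \<Longrightarrow> Re s \<le> b \<Longrightarrow> \<bar>Im s\<bar> \<ge> T0 \<Longrightarrow> \<bar>Im s\<bar> powr (- \<epsilon>) \<le> norm (riemann_zeta s)"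
    using riemann_zeta_lower_bound[OF RH a e(1), of b] by blast
  define T where "T = max T0 1"
  define K where "K = cbox (Complex a (- T)) (Complex b T)"
  have K: "z \<in> K \<longleftrightarrow> a \<le> Re z \<and> Re z \<le> b \<and> \<bar>Im z\<bar> \<le> T" for z
    by (auto simp: K_def in_cbox_complex_iff)
  have "continuous_on {s. Re s > 0} zeta_reg"
    by (intro holomorphic_on_imp_continuous_on zeta_reg_holomorphic)
  moreover have "K \<subseteq> {s. Re s > 0}"
  proof
    fix z assume "z \<in> K"
    then have "a \<le> Re z" using K by blast
    then show "z \<in> {s. Re s > 0}" using a by simp
  qed
  ultimately have cont: "continuous_on K zeta_reg" by (rule continuous_on_subset)
  have nz: "zeta_reg z \<noteq> 0" if "z \<in> K" for z
    using that a K[of z] by (intro zeta_reg_nonzero_RH[OF RH]) linarith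
  have "continuous_on K (\<lambda>z. 1 / zeta_reg z)"
    by (rule continuous_on_divide[OF continuous_on_const cont]) (use nz in blast)
  moreover have "compact K" unfolding K_def by (rule compact_cbox)
  ultimately have "bounded ((\<lambda>z. 1 / zeta_reg z) ` K)"
    by (intro compact_imp_bounded compact_continuous_image)
  then obtain C1 where C1': "C1 > 0" "\<forall>y\<in>(\<lambda>z. 1 / zeta_reg z) ` K. norm y \<le> C1"
    unfolding bounded_pos by blast
  have C1: "C1 > 0" "\<And>z. z \<in> K \<Longrightarrow> norm (1 / zeta_reg z) \<le> C1" using C1' by auto
  \<comment> \<open>The first summand serves large ordinates, where |t| \<ge> (1 + |t|)/2, and the
    second one the compact box.\<close>
  define C where "C = 2 powr (1 - \<epsilon>) + C1 * (1 + T) powr (1 - \<epsilon>)"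
  have T: "T \<ge> 1" "T \<ge> T0" by (auto simp: T_def)
  have C: "C > 0" unfolding C_def using C1 T by (intro add_pos_pos mult_pos_pos) auto
  show ?thesis
  proof (intro exI[of _ C] conjI allI impI C)
    fix s assume s: "a \<le> Re s \<and> Re s \<le> b"
    show "norm (1 / zeta_reg s) \<le> C * (1 + \<bar>Im s\<bar>) powr (\<epsilon> - 1)"
    proof (cases "\<bar>Im s\<bar> \<ge> T")
      case True
      then have im: "\<bar>Im s\<bar> \<ge> 1" "\<bar>Im s\<bar> \<ge> T0" using T by auto
      have s1: "s \<noteq> 1" "Re s > 0" using im s a by auto
      have "\<bar>Im s\<bar> powr (1 - \<epsilon>) = \<bar>Im s\<bar> * \<bar>Im s\<bar> powr (- \<epsilon>)"
        using im by (simp add: powr_diff powr_minus divide_inverse)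
      also have "\<dots> \<le> norm (s - 1) * norm (riemann_zeta s)"
        using abs_Im_le_cmod[of "s - 1"] s im T0[of s] by (intro mult_mono) auto
      also have "\<dots> = norm (zeta_reg s)" using s1 by (simp add: zeta_reg_eq norm_mult)
      finally have "norm (1 / zeta_reg s) \<le> 1 / \<bar>Im s\<bar> powr (1 - \<epsilon>)"
        unfolding norm_divide norm_one using im by (intro divide_left_mono mult_pos_pos) (auto intro: less_le_trans)
      also have "\<dots> \<le> 1 / ((1 + \<bar>Im s\<bar>) / 2) powr (1 - \<epsilon>)"
        using im e by (intro divide_left_mono powr_mono2) auto
      also have "\<dots> = 2 powr (1 - \<epsilon>) * (1 + \<bar>Im s\<bar>) powr (\<epsilon> - 1)"
        using im by (simp add: powr_divide powr_diff)
      also have "\<dots> \<le> C * (1 + \<bar>Im s\<bar>) powr (\<epsilon> - 1)"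
        unfolding C_def using C1 by (intro mult_right_mono) auto
      finally show ?thesis .
    next
      case False
      then have "norm (1 / zeta_reg s) \<le> C1" using s by (intro C1) (auto simp: K)
      also have "\<dots> = C1 * (1 + T) powr (1 - \<epsilon>) * (1 + T) powr (\<epsilon> - 1)"
        using T by (simp flip: powr_add)
      also have "\<dots> \<le> C1 * (1 + T) powr (1 - \<epsilon>) * (1 + \<bar>Im s\<bar>) powr (\<epsilon> - 1)"
        using False e C1 by (intro mult_left_mono powr_mono2') auto
      also have "\<dots> \<le> C * (1 + \<bar>Im s\<bar>) powr (\<epsilon> - 1)"
        unfolding C_def using C1 by (intro mult_right_mono) auto
      finally show ?thesis .
    qed
  qed
qed

subsection \<open>Vertical line integrals and a Perron formula\<close>

text \<open>Links the Lebesgue integral over a whole vertical line with the finite segments that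
  contour integration handles.\<close>

lemma integral_symmetric_interval_tendsto:
  fixes k :: "real \<Rightarrow> complex"
  assumes "integrable lborel k"
  shows "(\<lambda>n. integral {- real n..real n} k) \<longlonglongrightarrow> (\<integral>t. k t \<partial>lborel)"
proof -
  have k [measurable]: "k \<in> borel_measurable lborel" using assms by simp
  have "(\<lambda>n. \<integral>t. indicator {- real n..real n} t *\<^sub>R k t \<partial>lborel) \<longlonglongrightarrow> (\<integral>t. k t \<partial>lborel)"
  proof (rule integral_dominated_convergence[where w = "\<lambda>t. norm (k t)"])
    show "AE t in lborel. (\<lambda>n. indicator {- real n..real n} t *\<^sub>R k t) \<longlonglongrightarrow> k t"
    proof (intro AE_I2 tendsto_eventually)
      fix t :: real
      obtain N :: nat where "real N \<ge> \<bar>t\<bar>" using real_arch_simple by blast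
      then show "\<forall>\<^sub>F n in sequentially. indicator {- real n..real n} t *\<^sub>R k t = k t"
        by (intro eventually_sequentiallyI[of N]) (auto simp: indicator_def)
    qed
    show "AE t in lborel. norm (indicator {- real n..real n} t *\<^sub>R k t) \<le> norm (k t)" for n
      by (intro AE_I2) (auto simp: indicator_def)
  qed (use assms in auto)
  moreover have "(\<integral>t. indicator {- real n..real n} t *\<^sub>R k t \<partial>lborel) = integral {- real n..real n} k" for n
  proof -
    have "set_integrable lborel {- real n..real n} k"
      unfolding set_integrable_def using assms by (intro integrable_mult_indicator) auto
    from set_borel_integral_eq_integral(2)[OF this] show ?thesis
      by (simp add: set_lebesgue_integral_def)
  qed
  ultimately show ?thesis by simp
qed

text \<open>Isolates the vertical sides, the horizontal ones being bounded by length times M. The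
  value I is left open, so that it may be 0 by Cauchy's theorem or come from enclosed poles.\<close>

lemma rectpath_estimate:
  assumes ab: "a < b" and T: "T > 0"
    and I: "(f has_contour_integral I) (rectpath (Complex a (- T)) (Complex b T))"
    and cont: "continuous_on (path_image (rectpath (Complex a (- T)) (Complex b T))) f"
    and M: "\<And>z. a \<le> Re z \<Longrightarrow> Re z \<le> b \<Longrightarrow> \<bar>Im z\<bar> = T \<Longrightarrow> norm (f z) \<le> M"
  shows "norm (I - \<i> * (integral {-T..T} (\<lambda>t. f (Complex b t)) - integral {-T..T} (\<lambda>t. f (Complex a t)))) \<le> 2 * (b - a) * M"
proof -
  define a1 a2 a3 a4 where "a1 = Complex a (- T)" and "a2 = Complex b (- T)" and "a3 = Complex b T" and "a4 = Complex a T"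
  have rp: "rectpath a1 a3 = linepath a1 a2 +++ linepath a2 a3 +++ linepath a3 a4 +++ linepath a4 a1"
    by (simp add: rectpath_def Let_def a1_def a2_def a3_def a4_def)
  have im: "path_image (rectpath a1 a3) = closed_segment a1 a2 \<union> closed_segment a2 a3 \<union> closed_segment a3 a4 \<union> closed_segment a4 a1"
    unfolding rp by (simp add: path_image_join Un_assoc)
  have c: "continuous_on (closed_segment a1 a2) f" "continuous_on (closed_segment a2 a3) f"
     "continuous_on (closed_segment a3 a4) f" "continuous_on (closed_segment a4 a1) f"
    using cont unfolding im[unfolded a1_def a3_def] a1_def a3_def
    by (auto elim!: continuous_on_subset)
  note ci = c[THEN contour_integrable_continuous_linepath]
  have "I = contour_integral (rectpath a1 a3) f"
    using I unfolding a1_def a3_def by (rule contour_integral_unique[symmetric])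
  also have "\<dots> = contour_integral (linepath a1 a2) f + (contour_integral (linepath a2 a3) f
      + (contour_integral (linepath a3 a4) f + contour_integral (linepath a4 a1) f))"
    unfolding rp using ci by (simp add: contour_integrable_join valid_path_join)
  also have "contour_integral (linepath a2 a3) f = \<i> * integral {-T..T} (\<lambda>t. f (Complex b t))"
    by (rule contour_integral_linepath_same_Re) (use T in \<open>auto simp: a2_def a3_def\<close>)
  also have "contour_integral (linepath a4 a1) f = - contour_integral (linepath a1 a4) f"
    by (rule contour_integral_reverse_linepath[OF c(4)])
  also have "contour_integral (linepath a1 a4) f = \<i> * integral {-T..T} (\<lambda>t. f (Complex a t))"
    by (rule contour_integral_linepath_same_Re) (use T in \<open>auto simp: a1_def a4_def\<close>)
  finally have e: "I - \<i> * (integral {-T..T} (\<lambda>t. f (Complex b t)) - integral {-T..T} (\<lambda>t. f (Complex a t)))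
      = contour_integral (linepath a1 a2) f + contour_integral (linepath a3 a4) f"
    by (simp add: algebra_simps)
  have "norm (f (Complex a T)) \<le> M" using ab T by (intro M) auto
  then have M0: "M \<ge> 0" using norm_ge_zero order_trans by blast
  have "norm (contour_integral (linepath a1 a2) f) \<le> M * norm (a2 - a1)"
  proof (rule contour_integral_bound_linepath[OF ci(1) M0])
    fix x assume "x \<in> closed_segment a1 a2"
    then show "norm (f x) \<le> M"
      using ab T by (intro M) (auto simp: a1_def a2_def closed_segment_same_Im closed_segment_eq_real_ivl)
  qed
  moreover have "norm (contour_integral (linepath a3 a4) f) \<le> M * norm (a4 - a3)"
  proof (rule contour_integral_bound_linepath[OF ci(3) M0])
    fix x assume "x \<in> closed_segment a3 a4"
    then show "norm (f x) \<le> M"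
      using ab T by (intro M) (auto simp: a3_def a4_def closed_segment_same_Im closed_segment_eq_real_ivl)
  qed
  moreover have "a2 - a1 = of_real (b - a)" "a4 - a3 = of_real (a - b)"
    by (auto simp: a1_def a2_def a3_def a4_def complex_eq_iff)
  ultimately have "norm (contour_integral (linepath a1 a2) f + contour_integral (linepath a3 a4) f) \<le> M * (b - a) + M * (b - a)"
    using ab by (intro norm_triangle_le add_mono) (simp_all only: norm_of_real, simp_all)
  then show ?thesis unfolding e by (simp add: algebra_simps)
qed

lemma integrable_powr_decay:
  fixes p :: real
  assumes p: "p > 1"
  shows "integrable lborel (\<lambda>t::real. (1 + \<bar>t\<bar>) powr (- p))"
proof -
  have hi: "((\<lambda>x::real. x powr (- p)) has_integral - (1 powr (- p + 1)) / (- p + 1)) {1..}"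
    using p by (intro has_integral_powr_to_inf) auto
  then have "(\<lambda>x::real. x powr (- p)) absolutely_integrable_on {1..}"
    by (intro nonnegative_absolutely_integrable_1) auto
  then have "integrable lebesgue (\<lambda>x::real. indicator {1..} x * x powr (- p))"
    by (simp add: set_integrable_def)
  moreover have "(\<lambda>x::real. indicator {1..} x * x powr (- p)) \<in> borel_measurable lborel"
    by measurable
  ultimately have i: "integrable lborel (\<lambda>x::real. indicator {1..} x * x powr (- p))"
    by (simp add: integrable_completion)
  have i1: "integrable lborel (\<lambda>x. indicator {1..} (1 + 1 * x) * (1 + 1 * x) powr (- p))"
    by (rule lborel_integrable_real_affine[OF i]) simp
  have i2: "integrable lborel (\<lambda>x. indicator {1..} (1 + (- 1) * x) * (1 + (- 1) * x) powr (- p))"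
    by (rule lborel_integrable_real_affine[OF i]) simp
  show ?thesis
  proof (rule Bochner_Integration.integrable_bound[OF Bochner_Integration.integrable_add[OF i1 i2]])
    show "AE x in lborel. norm ((1 + \<bar>x\<bar>) powr (- p)) \<le> norm (indicator {1..} (1 + 1 * x) * (1 + 1 * x) powr (- p)
       + indicator {1..} (1 + (- 1) * x) * (1 + (- 1) * x) powr (- p))"
      by (intro AE_I2) (auto simp: indicator_def abs_if)
  qed measurable
qed

lemma norm_Complex_lower:
  assumes "c > 0"
  shows "norm (Complex c t) \<ge> min c 1 / 2 * (1 + \<bar>t\<bar>)"
proof -
  have "min c 1 * (1 + \<bar>t\<bar>) \<le> c + \<bar>t\<bar>"
    unfolding distrib_left using mult_right_mono[of "min c 1" 1 "\<bar>t\<bar>"] by simp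
  moreover have "c \<le> norm (Complex c t)" "\<bar>t\<bar> \<le> norm (Complex c t)"
    using abs_Re_le_cmod[of "Complex c t"] abs_Im_le_cmod[of "Complex c t"] assms by auto
  ultimately show ?thesis by simp
qed

lemma integrable_vertical:
  assumes "continuous_on UNIV k" "p > 1" "\<And>t. norm (k t :: complex) \<le> C * (1 + \<bar>t\<bar>) powr (- p)"
  shows "integrable lborel k"
proof (rule Bochner_Integration.integrable_bound)
  show "integrable lborel (\<lambda>t. C * (1 + \<bar>t\<bar>) powr (- p))"
    using integrable_powr_decay[OF assms(2)] by simp
  show "k \<in> borel_measurable lborel" using borel_measurable_continuous_onI[OF assms(1)] by simp
  show "AE t in lborel. norm (k t) \<le> norm (C * (1 + \<bar>t\<bar>) powr (- p))"
    by (intro AE_I2 order_trans[OF assms(3)]) simp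
qed

text \<open>The kernel of the first Riesz mean. The factor s + 1 makes its integral over a vertical
  line absolutely convergent, which that of y^s/s is not.\<close>

definition perron_kernel :: "real \<Rightarrow> complex \<Rightarrow> complex" where
  "perron_kernel y s = of_real y powr s / (s * (s + 1))"

lemma norm_perron_kernel:
  assumes "y > 0"
  shows "norm (perron_kernel y s) = y powr Re s / (norm s * norm (s + 1))"
  using assms by (simp add: perron_kernel_def norm_divide norm_mult norm_powr_real_powr)

lemma perron_kernel_continuous: "y > 0 \<Longrightarrow> 0 \<notin> S \<Longrightarrow> -1 \<notin> S \<Longrightarrow> continuous_on S (perron_kernel y)"
  unfolding perron_kernel_def
  by (intro continuous_intros) (auto simp: add_eq_0_iff2)

lemma perron_kernel_bound:
  assumes "y > 0" "c > 0"
  shows "norm (perron_kernel y (Complex c t)) \<le> 4 / (min c 1) ^ 2 * y powr c * (1 + \<bar>t\<bar>) powr (- 2)"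
proof -
  define m where "m = min c 1 / 2"
  have m: "m > 0" using assms by (simp add: m_def)
  have "m * (1 + \<bar>t\<bar>) \<le> norm (Complex c t)" unfolding m_def by (rule norm_Complex_lower[OF assms(2)])
  moreover have "m * (1 + \<bar>t\<bar>) \<le> norm (Complex c t + 1)"
  proof -
    have "norm (Complex c t) \<le> norm (Complex c t + 1)"
      using assms by (simp add: norm_complex_def power2_eq_square algebra_simps)
    with calculation show ?thesis by linarith
  qed
  ultimately have "(m * (1 + \<bar>t\<bar>)) * (m * (1 + \<bar>t\<bar>)) \<le> norm (Complex c t) * norm (Complex c t + 1)"
    using m by (intro mult_mono) auto
  moreover have "(m * (1 + \<bar>t\<bar>)) * (m * (1 + \<bar>t\<bar>)) > 0" using m by (intro mult_pos_pos) auto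
  ultimately have "norm (perron_kernel y (Complex c t)) \<le> y powr c / ((m * (1 + \<bar>t\<bar>)) * (m * (1 + \<bar>t\<bar>)))"
    unfolding norm_perron_kernel[OF assms(1)] complex.sel by (intro frac_le) auto
  also have "\<dots> = 1 / m ^ 2 * y powr c * (1 + \<bar>t\<bar>) powr (- 2)"
    by (simp add: powr_minus divide_inverse power2_eq_square)
  finally show ?thesis by (simp add: m_def power_divide)
qed

lemma continuous_on_Complex_line: "continuous_on A (\<lambda>t. Complex c t)"
  unfolding Complex_eq by (intro continuous_intros)

lemma perron_kernel_integrable:
  assumes "y > 0" "c > 0"
  shows "integrable lborel (\<lambda>t. perron_kernel y (Complex c t))"
proof (rule integrable_vertical)
  have "continuous_on (range (Complex c)) (perron_kernel y)"
    using assms by (intro perron_kernel_continuous) (auto simp: complex_eq_iff)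
  then show "continuous_on UNIV (\<lambda>t. perron_kernel y (Complex c t))"
    by (rule continuous_on_compose2[OF _ continuous_on_Complex_line]) auto
  show "norm (perron_kernel y (Complex c t)) \<le> 4 / (min c 1) ^ 2 * y powr c * (1 + \<bar>t\<bar>) powr (- 2)" for t
    by (rule perron_kernel_bound[OF assms])
qed simp

lemma norm_mult_plus1_lower:
  fixes s :: complex
  assumes "norm s \<ge> R" "R > 1"
  shows "norm s * norm (s + 1) \<ge> R * (R - 1)"
proof -
  have "norm s \<le> norm (s + 1) + 1" using norm_triangle_ineq4[of "s + 1" 1] by simp
  then show ?thesis using assms by (intro mult_mono) auto
qed

text \<open>The line is closed up by a large rectangle, to the right if $y \<le> 1$ and to the left,
  around the poles at $0$ and $-1$, if $y \<ge> 1$.\<close>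

lemma perron_formula:
  assumes y: "y > 0" and c: "c > 0"
  shows "(\<integral>t. perron_kernel y (Complex c t) \<partial>lborel) = of_real (2 * pi * max 0 (1 - 1 / y))"
proof -
  define V where "V = (\<lambda>a T. integral {-T..T} (\<lambda>t. perron_kernel y (Complex a t)))"
  \<comment> \<open>This is 2 pi times the sum of the enclosed residues: 1 at 0 and -1/y at -1 if y
    > 1, and nothing if y \<le> 1.\<close>
  define L where "L = complex_of_real (2 * pi * max 0 (1 - 1 / y))"
  define B where "B = max (y powr c) 1"
  have lim: "(\<lambda>n. V c (real n)) \<longlonglongrightarrow> (\<integral>t. perron_kernel y (Complex c t) \<partial>lborel)"
    unfolding V_def by (rule integral_symmetric_interval_tendsto[OF perron_kernel_integrable[OF y c]])
  \<comment> \<open>The first factor bounds, in both cases, the total length of the three sides of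
    the rectangle other than the line itself.\<close>
  have est: "norm (V c R - L) \<le> (2 * (2 * R + c) + 2 * R) * (y powr c / (R * (R - 1)))" if R: "R > 1" "R > c" for R
  proof -
    define M where "M = y powr c / (R * (R - 1))"
    have M0: "M \<ge> 0" using R by (simp add: M_def)
    have pk: "norm (perron_kernel y z) \<le> M" if "y powr Re z \<le> y powr c" "norm z \<ge> R" for z
    proof -
      have "R * (R - 1) \<le> norm z * norm (z + 1)" using that R by (intro norm_mult_plus1_lower) auto
      moreover have "R * (R - 1) > 0" using R by simp
      ultimately show ?thesis
        unfolding norm_perron_kernel[OF y] M_def using that by (intro frac_le) auto
    qed
    have nz: "norm z \<ge> R" if "\<bar>Im z\<bar> = R \<or> \<bar>Re z\<bar> \<ge> R" for z
      using that abs_Im_le_cmod[of z] abs_Re_le_cmod[of z] by linarith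
    have side: "norm (V a R) \<le> 2 * R * M" if "\<bar>a\<bar> \<ge> R" "y powr a \<le> y powr c" for a
    proof -
      have "norm (V a R) \<le> integral {-R..R} (\<lambda>t. M)"
        unfolding V_def
      proof (rule integral_norm_bound_integral)
        have "continuous_on (range (Complex a)) (perron_kernel y)"
          using that R y by (intro perron_kernel_continuous) (auto simp: complex_eq_iff)
        then have "continuous_on {-R..R} (\<lambda>t. perron_kernel y (Complex a t))"
          by (rule continuous_on_compose2[OF _ continuous_on_Complex_line]) auto
        then show "(\<lambda>t. perron_kernel y (Complex a t)) integrable_on {-R..R}"
          by (rule integrable_continuous_interval)
        show "norm (perron_kernel y (Complex a t)) \<le> M" for t
          using that by (intro pk nz) auto
      qed auto
      then show ?thesis using R by (simp add: mult.commute)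
    qed
    show ?thesis
    proof (cases "y \<le> 1")
      case True
      define b where "b = c + R"
      have pw: "y powr r \<le> y powr c" if "r \<ge> c" for r
        using that True y by (intro powr_mono') auto
      have path: "path_image (rectpath (Complex c (- R)) (Complex b R)) \<subseteq> {z. Re z > 0}"
        using c R by (auto simp: path_image_rectpath b_def)
      have hol: "perron_kernel y holomorphic_on {z. Re z > 0}"
        unfolding perron_kernel_def using y
      proof (intro holomorphic_intros)
        fix s assume "s \<in> {z. Re z > 0}"
        then have "Re s > 0" "Re (s + 1) > 0" by auto
        then have "s \<noteq> 0" "s + 1 \<noteq> 0" by (metis less_irrefl zero_complex.sel(1))+
        then show "s * (s + 1) \<noteq> 0" by simp
      qed
      have "(perron_kernel y has_contour_integral 0) (rectpath (Complex c (- R)) (Complex b R))"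
        by (rule Cauchy_theorem_convex_simple[OF hol convex_halfspace_Re_gt _ path]) auto
      moreover have "continuous_on (path_image (rectpath (Complex c (- R)) (Complex b R))) (perron_kernel y)"
        using holomorphic_on_imp_continuous_on[OF hol] path by (rule continuous_on_subset)
      moreover have "norm (perron_kernel y z) \<le> M" if "c \<le> Re z" "\<bar>Im z\<bar> = R" for z
        using that by (intro pk pw nz) auto
      ultimately have "norm (0 - \<i> * (V b R - V c R)) \<le> 2 * (b - c) * M"
        unfolding V_def using R by (intro rectpath_estimate) (auto simp: b_def)
      then have "norm (V b R - V c R) \<le> 2 * R * M" by (simp add: norm_mult b_def)
      moreover have "norm (V b R) \<le> 2 * R * M" using c R by (intro side pw) (auto simp: b_def)
      moreover have "norm (V c R) \<le> norm (V b R) + norm (V b R - V c R)"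
        by (metis norm_minus_commute norm_triangle_sub)
      moreover have "L = 0" using True y by (simp add: L_def)
      ultimately have "norm (V c R - L) \<le> (2 * R + 2 * R) * M" by (simp add: distrib_right)
      also have "\<dots> \<le> (2 * (2 * R + c) + 2 * R) * M" using M0 R c by (intro mult_right_mono) auto
      finally show ?thesis unfolding M_def .
    next
      case False
      define a where "a = - R"
      define \<gamma> where "\<gamma> = rectpath (Complex a (- R)) (Complex c R)"
      have pw: "y powr r \<le> y powr c" if "r \<le> c" for r
        using that False by (intro powr_mono) auto
      have path: "0 \<notin> path_image \<gamma>" "-1 \<notin> path_image \<gamma>"
        unfolding \<gamma>_def using c R by (auto simp: path_image_rectpath a_def)
      have box: "0 \<in> box (Complex a (- R)) (Complex c R)" "-1 \<in> box (Complex a (- R)) (Complex c R)"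
        using c R by (auto simp: in_box_complex_iff a_def)
      have hol: "(\<lambda>s. of_real y powr s) holomorphic_on UNIV"
        using y by (intro holomorphic_intros) auto
      \<comment> \<open>By 1/(s(s + 1)) = 1/s - 1/(s + 1) the poles are separated, and Cauchy's
        integral formula for y^s handles each of them.\<close>
      have i0: "((\<lambda>s. of_real y powr s / (s - 0)) has_contour_integral (2 * pi * \<i> * winding_number \<gamma> 0 * of_real y powr 0)) \<gamma>"
        using path(1) by (intro Cauchy_integral_formula_convex_simple[OF convex_UNIV hol]) (auto simp: \<gamma>_def)
      have i1: "((\<lambda>s. of_real y powr s / (s - (-1))) has_contour_integral (2 * pi * \<i> * winding_number \<gamma> (-1) * of_real y powr (-1))) \<gamma>"
        using path(2) by (intro Cauchy_integral_formula_convex_simple[OF convex_UNIV hol]) (auto simp: \<gamma>_def)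
      have w: "winding_number \<gamma> 0 = 1" "winding_number \<gamma> (-1) = 1"
        unfolding \<gamma>_def using box by (auto intro: winding_number_rectpath)
      have "((\<lambda>s. of_real y powr s / (s - 0) - of_real y powr s / (s - (-1))) has_contour_integral
          (2 * pi * \<i> * winding_number \<gamma> 0 * of_real y powr 0 - 2 * pi * \<i> * winding_number \<gamma> (-1) * of_real y powr (-1))) \<gamma>"
        by (rule has_contour_integral_diff[OF i0 i1])
      then have "(perron_kernel y has_contour_integral
          (2 * pi * \<i> * winding_number \<gamma> 0 * of_real y powr 0 - 2 * pi * \<i> * winding_number \<gamma> (-1) * of_real y powr (-1))) \<gamma>"
      proof (rule has_contour_integral_eq)
        fix s assume "s \<in> path_image \<gamma>"
        then have "s \<noteq> 0" "s + 1 \<noteq> 0" using path by (auto simp: add_eq_0_iff2)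
        then show "of_real y powr s / (s - 0) - of_real y powr s / (s - (-1)) = perron_kernel y s"
          by (simp add: perron_kernel_def divide_simps) (simp add: algebra_simps)
      qed
      also have "2 * pi * \<i> * winding_number \<gamma> 0 * of_real y powr 0 - 2 * pi * \<i> * winding_number \<gamma> (-1) * of_real y powr (-1) = \<i> * L"
        unfolding w using y False by (simp add: L_def powr_minus_divide algebra_simps)
      finally have "(perron_kernel y has_contour_integral \<i> * L) \<gamma>" .
      moreover have "continuous_on (path_image \<gamma>) (perron_kernel y)"
        using y path by (intro perron_kernel_continuous)
      moreover have "norm (perron_kernel y z) \<le> M" if "Re z \<le> c" "\<bar>Im z\<bar> = R" for z
        using that by (intro pk pw nz) auto
      ultimately have "norm (\<i> * L - \<i> * (V c R - V a R)) \<le> 2 * (c - a) * M"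
        unfolding V_def \<gamma>_def using R c by (intro rectpath_estimate) (auto simp: a_def)
      also have "\<i> * L - \<i> * (V c R - V a R) = \<i> * (L + V a R - V c R)" by (simp add: algebra_simps)
      finally have "norm (L + V a R - V c R) \<le> 2 * (R + c) * M" by (simp add: norm_mult a_def add.commute)
      moreover have "norm (V a R) \<le> 2 * R * M" using c R by (intro side pw) (auto simp: a_def)
      moreover have "norm (V c R - L) \<le> norm (V a R) + norm (L + V a R - V c R)"
      proof -
        have "V c R - L = V a R - (L + V a R - V c R)" by simp
        then show ?thesis by (metis norm_triangle_ineq4)
      qed
      ultimately have "norm (V c R - L) \<le> 2 * R * M + 2 * (R + c) * M" by linarith
      also have "\<dots> = (2 * R + 2 * (R + c)) * M" by (simp add: distrib_right)
      also have "\<dots> \<le> (2 * (2 * R + c) + 2 * R) * M" using M0 R c by (intro mult_right_mono) auto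
      finally show ?thesis unfolding M_def .
    qed
  qed
  have "(\<lambda>n. V c (real n) - L) \<longlonglongrightarrow> 0"
  proof (rule Lim_null_comparison)
    show "\<forall>\<^sub>F n in sequentially. norm (V c (real n) - L) \<le> (2 * (2 * real n + c) + 2 * real n) * (y powr c / (real n * (real n - 1)))"
      using eventually_gt_at_top[of "nat \<lceil>max 1 c\<rceil>"]
    proof eventually_elim
      case (elim n)
      then have "real n > max 1 c" by linarith
      then show ?case by (intro est) auto
    qed
    show "(\<lambda>n. (2 * (2 * real n + c) + 2 * real n) * (y powr c / (real n * (real n - 1)))) \<longlonglongrightarrow> 0"
      by real_asymp
  qed
  then have "(\<lambda>n. V c (real n)) \<longlonglongrightarrow> L" by (rule LIM_zero_cancel)
  with lim show ?thesis unfolding L_def using LIMSEQ_unique by blast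
qed

subsection \<open>The summatory function of the Moebius function under the Riemann hypothesis\<close>

definition mob_coeff :: "nat \<Rightarrow> complex" where "mob_coeff n = of_int (moebius_mu n) / of_nat n"

lemma g_sum_eq_sumfun: "of_real (g_sum t) = sumfun mob_coeff t"
  by (simp add: g_sum_def sumfun_def mob_coeff_def)

lemma norm_mob_coeff_le: "norm (mob_coeff n) \<le> 1 / real n"
  using norm_mu_le[of n] by (simp add: mob_coeff_def norm_divide divide_right_mono)

lemma mob_coeff_dirichlet:
  assumes "Re s > 0"
  shows "dirichlet_conv mob_coeff s" "dirichlet mob_coeff s = mu_sum (s + 1)"
proof -
  have "dirichlet_conv (\<lambda>n. of_int (moebius_mu n)) (s + 1)"
    using assms by (intro dirichlet_conv_bounded[of _ 1] norm_mu_le) auto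
  then show "dirichlet_conv mob_coeff s"
    unfolding dirichlet_conv_def mob_coeff_def by (simp add: norm_divide powr_add mult.commute del: of_nat_Suc)
  show "dirichlet mob_coeff s = mu_sum (s + 1)"
    unfolding dirichlet_def mu_sum_def mob_coeff_def
    by (simp add: powr_add mult.commute del: of_nat_Suc)
qed

lemma mob_coeff_dirichlet_eq_zeta_reg:
  assumes "Re s > 0"
  shows "dirichlet mob_coeff s = s / zeta_reg (s + 1)"
proof -
  have "zs (s + 1) * mu_sum (s + 1) = 1" using assms by (intro zs_mult_mu_sum) simp
  moreover have "zeta_reg (s + 1) = s * zs (s + 1)" using assms by (simp add: zeta_reg_eq_zs)
  moreover have "s \<noteq> 0" using assms by auto
  moreover have "zs (s + 1) \<noteq> 0" using assms by (intro zs_nonzero) simp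
  ultimately show ?thesis
    using mob_coeff_dirichlet(2)[OF assms] by (simp add: eq_divide_eq mult.commute)
qed

text \<open>The factor 1/s from \<open>mellin_sumfun\<close> cancels the zero of 1/zeta(s + 1) at s
  = 0, so the formula for the transform is regular there.\<close>

lemma mellin_g_sum:
  assumes "Re s > 0"
  shows "mellin_conv (\<lambda>t. of_real (g_sum t)) (Re s)" "mellin (\<lambda>t. of_real (g_sum t)) s = 1 / zeta_reg (s + 1)"
proof -
  have "s \<noteq> 0" using assms by auto
  then show "mellin_conv (\<lambda>t. of_real (g_sum t)) (Re s)" "mellin (\<lambda>t. of_real (g_sum t)) s = 1 / zeta_reg (s + 1)"
    using mellin_sumfun[OF mob_coeff_dirichlet(1)[OF assms] assms]
    by (simp_all add: g_sum_eq_sumfun mob_coeff_dirichlet_eq_zeta_reg[OF assms])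
qed

lemma g_sum_measurable [measurable]: "(\<lambda>t. complex_of_real (g_sum t)) \<in> borel_measurable borel"
  unfolding g_sum_eq_sumfun by (rule sumfun_measurable)

text \<open>The Dirichlet series of mu(n)/n times x^s/(s(s + 1)), after cancellation of s.\<close>

definition riesz_integrand :: "real \<Rightarrow> complex \<Rightarrow> complex" where
  "riesz_integrand x s = of_real x powr s / ((s + 1) * zeta_reg (s + 1))"

text \<open>The integral of g over [0, x]; its increment over [x, x + h] is therefore close to h
  g(x).\<close>

definition riesz_sum :: "real \<Rightarrow> complex" where
  "riesz_sum x = sumfun (\<lambda>n. mob_coeff n * of_real (x - real n)) x"

text \<open>Perron's formula with y = x/n, summed over n. The factor x turns 1 - n/x into the weight
  x - n.\<close>

lemma perron_riesz_sum:
  assumes x: "x > 0" and c: "c > 0"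
  shows "of_real x * (\<integral>t. riesz_integrand x (Complex c t) \<partial>lborel) = 2 * of_real pi * riesz_sum x"
proof -
  define f where "f = (\<lambda>n t. mob_coeff (Suc n) * perron_kernel (x / real (Suc n)) (Complex c t))"
  define b where "b = (\<lambda>n. norm (mob_coeff (Suc n)) / real (Suc n) powr c * x powr c)"
  define k where "k = (\<lambda>t::real. 4 / (min c 1) ^ 2 * (1 + \<bar>t\<bar>) powr (- 2))"
  have y: "x / real (Suc n) > 0" for n using x by simp
  have fi: "integrable lborel (f n)" for n
    unfolding f_def by (intro integrable_mult_right perron_kernel_integrable y c)
  have pw: "of_real (x / real (Suc n)) powr s = of_real x powr s * (1 / of_nat (Suc n) powr s)" for n and s :: complex
  proof -
    have "complex_of_real (x / real (Suc n)) = of_real x * of_real (1 / real (Suc n))" by simp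
    also have "\<dots> powr s = of_real x powr s * of_real (1 / real (Suc n)) powr s"
      using x by (subst powr_times_real) auto
    also have "of_real (1 / real (Suc n)) powr s = 1 / of_nat (Suc n) powr s"
      by (subst of_real_inverse_powr) simp_all
    finally show ?thesis .
  qed
  have fsums: "(\<lambda>n. f n t) sums riesz_integrand x (Complex c t)" for t
  proof -
    define s where "s = Complex c t"
    have s: "Re s > 0" using c by (simp add: s_def)
    then have s0: "s \<noteq> 0" by auto
    have "(\<lambda>n. of_real x powr s / (s * (s + 1)) * (mob_coeff (Suc n) / of_nat (Suc n) powr s)) sums
       (of_real x powr s / (s * (s + 1)) * dirichlet mob_coeff s)"
      by (intro sums_mult dirichlet_sums mob_coeff_dirichlet s)
    also have "of_real x powr s / (s * (s + 1)) * dirichlet mob_coeff s = riesz_integrand x s"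
      using s0 unfolding mob_coeff_dirichlet_eq_zeta_reg[OF s] riesz_integrand_def by simp
    also have "(\<lambda>n. of_real x powr s / (s * (s + 1)) * (mob_coeff (Suc n) / of_nat (Suc n) powr s)) = (\<lambda>n. f n t)"
      unfolding f_def perron_kernel_def s_def[symmetric] pw by (simp add: fun_eq_iff mult_ac del: of_nat_Suc)
    finally show ?thesis unfolding s_def .
  qed
  have bd: "norm (f n t) \<le> b n * k t" for n t
  proof -
    have "norm (f n t) \<le> norm (mob_coeff (Suc n)) * (4 / (min c 1) ^ 2 * (x / real (Suc n)) powr c * (1 + \<bar>t\<bar>) powr (- 2))"
      unfolding f_def norm_mult by (intro mult_left_mono perron_kernel_bound y c) auto
    also have "(x / real (Suc n)) powr c = x powr c / real (Suc n) powr c"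
      by (rule powr_divide)
    finally show ?thesis by (simp add: b_def k_def mult_ac del: of_nat_Suc)
  qed
  have sb: "summable b"
    unfolding b_def using mob_coeff_dirichlet(1)[of "Complex c 0"] c by (intro summable_mult2) (simp add: dirichlet_conv_def)
  have as: "summable (\<lambda>n. norm (f n t))" for t
  proof (rule summable_comparison_test')
    show "summable (\<lambda>n. b n * k t)"
      by (rule summable_mult2[OF sb])
    show "norm (norm (f n t)) \<le> b n * k t" for n
      using bd[of n t] by simp
  qed
  have ik: "integrable lborel k"
    unfolding k_def using integrable_powr_decay[of 2] by (intro integrable_mult_right) auto
  have ss: "summable (\<lambda>n. \<integral>t. norm (f n t) \<partial>lborel)"
  proof (rule summable_comparison_test')
    show "summable (\<lambda>n. b n * integral\<^sup>L lborel k)" by (rule summable_mult2[OF sb])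
    show "norm (\<integral>t. norm (f n t) \<partial>lborel) \<le> b n * integral\<^sup>L lborel k" for n
    proof -
      have "(\<integral>t. norm (f n t) \<partial>lborel) \<le> (\<integral>t. b n * k t \<partial>lborel)"
        by (intro integral_mono integrable_norm fi integrable_mult_right ik bd)
      then show ?thesis by (simp only: integral_mult_right_zero) simp
    qed
  qed
  have "(\<lambda>n. integral\<^sup>L lborel (f n)) sums (\<integral>t. (\<Sum>n. f n t) \<partial>lborel)"
    by (intro sums_integral fi AE_I2 as ss)
  also have "(\<lambda>t. \<Sum>n. f n t) = (\<lambda>t. riesz_integrand x (Complex c t))"
    using fsums by (simp add: sums_iff fun_eq_iff)
  finally have S1: "(\<lambda>n. of_real x * integral\<^sup>L lborel (f n)) sums (of_real x * (\<integral>t. riesz_integrand x (Complex c t) \<partial>lborel))"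
    by (rule sums_mult)
  have S2: "of_real x * integral\<^sup>L lborel (f n) =
      2 * of_real pi * (mob_coeff (Suc n) * of_real (x - real (Suc n)) * ustep (x / real (Suc n)))" for n
  proof -
    have i: "integral\<^sup>L lborel (f n) = mob_coeff (Suc n) * of_real (2 * pi * max 0 (1 - 1 / (x / real (Suc n))))"
      unfolding f_def by (simp only: integral_mult_right_zero perron_formula[OF y c])
    have "x * max 0 (1 - 1 / (x / real (Suc n))) = (x - real (Suc n)) * (if x / real (Suc n) \<ge> 1 then 1 else 0)"
      using x by (auto simp: max_def field_simps)
    then have m: "complex_of_real x * of_real (max 0 (1 - 1 / (x / real (Suc n)))) = of_real (x - real (Suc n)) * ustep (x / real (Suc n))"
      unfolding ustep_def by (simp only: of_real_mult[symmetric]) auto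
    have "of_real x * (z * of_real (2 * pi * w)) = 2 * of_real pi * (z * (of_real x * of_real w))"
      for z :: complex and w by simp
    then show ?thesis unfolding i m[symmetric] by (simp only: m mult.assoc)
  qed
  have S3: "(\<lambda>n. 2 * of_real pi * (mob_coeff (Suc n) * of_real (x - real (Suc n)) * ustep (x / real (Suc n)))) sums (2 * of_real pi * riesz_sum x)"
    unfolding riesz_sum_def by (intro sums_mult sumfun_sums)
  show ?thesis by (rule sums_unique2[OF S1[unfolded S2] S3])
qed

lemma vertical_line_shift:
  assumes hol: "F holomorphic_on {s. Re s > \<alpha>}" and ab: "\<alpha> < a" "a < b" and p: "p > 1"
    and bd: "\<And>s. a \<le> Re s \<Longrightarrow> Re s \<le> b \<Longrightarrow> norm (F s) \<le> C * (1 + \<bar>Im s\<bar>) powr (- p)"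
  shows "integrable lborel (\<lambda>t. F (Complex a t))"
    and "(\<integral>t. F (Complex a t) \<partial>lborel) = (\<integral>t. F (Complex b t) \<partial>lborel)"
proof -
  have cF: "continuous_on {s. Re s > \<alpha>} F" using hol by (rule holomorphic_on_imp_continuous_on)
  have int: "integrable lborel (\<lambda>t. F (Complex c t))" if c: "a \<le> c" "c \<le> b" for c
  proof (rule integrable_vertical[OF _ p])
    show "continuous_on UNIV (\<lambda>t. F (Complex c t))"
      by (rule continuous_on_compose2[OF cF continuous_on_Complex_line]) (use c ab in auto)
    show "norm (F (Complex c t)) \<le> C * (1 + \<bar>t\<bar>) powr (- p)" for t
      using bd[of "Complex c t"] c by simp
  qed
  show "integrable lborel (\<lambda>t. F (Complex a t))" using ab by (intro int) auto
  define V where "V = (\<lambda>c T. integral {-T..T} (\<lambda>t. F (Complex c t)))"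
  have lim: "(\<lambda>n. V c (real n)) \<longlonglongrightarrow> (\<integral>t. F (Complex c t) \<partial>lborel)" if "a \<le> c" "c \<le> b" for c
    unfolding V_def by (rule integral_symmetric_interval_tendsto[OF int[OF that]])
  have "(\<lambda>n. V b (real n) - V a (real n)) \<longlonglongrightarrow> 0"
  proof (rule Lim_null_comparison)
    show "\<forall>\<^sub>F n in sequentially. norm (V b (real n) - V a (real n)) \<le> 2 * (b - a) * (C * (1 + real n) powr (- p))"
      using eventually_gt_at_top[of 0]
    proof eventually_elim
      case (elim n)
      have path: "path_image (rectpath (Complex a (- real n)) (Complex b (real n))) \<subseteq> {s. Re s > \<alpha>}"
        using ab by (auto simp: path_image_rectpath)
      have "(F has_contour_integral 0) (rectpath (Complex a (- real n)) (Complex b (real n)))"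
        by (rule Cauchy_theorem_convex_simple[OF hol convex_halfspace_Re_gt _ path]) auto
      moreover have "continuous_on (path_image (rectpath (Complex a (- real n)) (Complex b (real n)))) F"
        using cF path by (rule continuous_on_subset)
      moreover have "norm (F z) \<le> C * (1 + real n) powr (- p)" if "a \<le> Re z" "Re z \<le> b" "\<bar>Im z\<bar> = real n" for z
        using bd[OF that(1,2)] that(3) by simp
      ultimately have "norm (0 - \<i> * (V b (real n) - V a (real n))) \<le> 2 * (b - a) * (C * (1 + real n) powr (- p))"
        unfolding V_def using ab elim by (intro rectpath_estimate) auto
      then show ?case by (simp add: norm_mult)
    qed
    have "(\<lambda>n. (1 + real n) powr (- p)) \<longlonglongrightarrow> 0" using p by real_asymp
    then have "(\<lambda>n. 2 * (b - a) * (C * (1 + real n) powr (- p))) \<longlonglongrightarrow> 2 * (b - a) * (C * 0)"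
      by (intro tendsto_intros)
    then show "(\<lambda>n. 2 * (b - a) * (C * (1 + real n) powr (- p))) \<longlonglongrightarrow> 0" by simp
  qed
  moreover have "(\<lambda>n. V b (real n) - V a (real n)) \<longlonglongrightarrow> (\<integral>t. F (Complex b t) \<partial>lborel) - (\<integral>t. F (Complex a t) \<partial>lborel)"
    using ab by (intro tendsto_diff lim) auto
  ultimately have "(\<integral>t. F (Complex b t) \<partial>lborel) - (\<integral>t. F (Complex a t) \<partial>lborel) = 0"
    using LIMSEQ_unique by blast
  then show "(\<integral>t. F (Complex a t) \<partial>lborel) = (\<integral>t. F (Complex b t) \<partial>lborel)" by simp
qed

lemma riesz_sum_shifted:
  assumes RH: "riemann_hypothesis" and a: "- 1 / 2 < a" "a < 1" and x: "x > 0"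
  shows "integrable lborel (\<lambda>t. riesz_integrand x (Complex a t))"
    and "of_real x * (\<integral>t. riesz_integrand x (Complex a t) \<partial>lborel) = 2 * of_real pi * riesz_sum x"
proof -
  \<comment> \<open>For the shift alone the generous exponent 1/2 suffices: the integrand is then
    O(|t|^(-3/2)). The upper end 2 is the line Re s = 1 translated by 1.\<close>
  obtain C where C: "C > 0" "\<And>s. a + 1 \<le> Re s \<Longrightarrow> Re s \<le> 2 \<Longrightarrow> norm (1 / zeta_reg s) \<le> C * (1 + \<bar>Im s\<bar>) powr (1 / 2 - 1)"
    using inverse_zeta_reg_bound[OF RH, of "a + 1" "1 / 2" 2] a by auto
  define X where "X = x powr a + x powr 1"
  have hol: "riesz_integrand x holomorphic_on {s. Re s > - 1 / 2}"
  proof -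
    have "zeta_reg \<circ> (\<lambda>s. s + 1) holomorphic_on {s. Re s > - 1 / 2}"
      by (intro holomorphic_on_compose_gen[OF _ zeta_reg_holomorphic] holomorphic_intros) auto
    then have z: "(\<lambda>s. zeta_reg (s + 1)) holomorphic_on {s. Re s > - 1 / 2}" by (simp add: o_def)
    have nz: "(s + 1) * zeta_reg (s + 1) \<noteq> 0" if "Re s > - 1 / 2" for s
    proof -
      have re: "Re (s + 1) > 1 / 2" using that by simp
      have "s + 1 \<noteq> 0"
      proof
        assume "s + 1 = 0"
        then have "Re (s + 1) = 0" by simp
        with re show False by simp
      qed
      with zeta_reg_nonzero_RH[OF RH re] show ?thesis by simp
    qed
    have "(\<lambda>s. of_real x powr s) holomorphic_on {s. Re s > - 1 / 2}"
      using x by (intro holomorphic_intros) auto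
    moreover have "(\<lambda>s. (s + 1) * zeta_reg (s + 1)) holomorphic_on {s. Re s > - 1 / 2}"
      by (intro holomorphic_on_mult z holomorphic_intros)
    ultimately show ?thesis
      unfolding riesz_integrand_def by (rule holomorphic_on_divide) (use nz in auto)
  qed
  have bd: "norm (riesz_integrand x s) \<le> X * 4 * C * (1 + \<bar>Im s\<bar>) powr (- (3 / 2))" if s: "a \<le> Re s" "Re s \<le> 1" for s
  proof -
    have 1: "norm (of_real x powr s) \<le> X"
      using powr_between[of x a "Re s" 1] x s by (simp add: X_def norm_powr_real_powr)
    have 2: "norm (1 / zeta_reg (s + 1)) \<le> C * (1 + \<bar>Im s\<bar>) powr (- (1 / 2))"
      using C(2)[of "s + 1"] s by simp
    have 3: "norm (1 / (s + 1)) \<le> 4 * (1 + \<bar>Im s\<bar>) powr (- 1)"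
    proof -
      have "1 / 4 * (1 + \<bar>Im s\<bar>) \<le> min (Re s + 1) 1 / 2 * (1 + \<bar>Im s\<bar>)"
        using s a by (intro mult_right_mono) auto
      also have "\<dots> \<le> norm (Complex (Re s + 1) (Im s))"
        using s a by (intro norm_Complex_lower) auto
      also have "Complex (Re s + 1) (Im s) = s + 1" by (simp add: complex_eq_iff)
      finally have "norm (1 / (s + 1)) \<le> 1 / (1 / 4 * (1 + \<bar>Im s\<bar>))"
        unfolding norm_divide norm_one by (intro frac_le) auto
      then show ?thesis by (simp add: powr_minus_divide)
    qed
    have "norm (riesz_integrand x s) = norm (of_real x powr s) * norm (1 / (s + 1)) * norm (1 / zeta_reg (s + 1))"
      by (simp add: riesz_integrand_def norm_divide norm_mult)
    also have "\<dots> \<le> X * (4 * (1 + \<bar>Im s\<bar>) powr (- 1)) * (C * (1 + \<bar>Im s\<bar>) powr (- (1 / 2)))"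
      by (intro mult_mono 1 2 3) (auto simp: X_def intro: mult_nonneg_nonneg)
    also have "\<dots> = X * 4 * C * ((1 + \<bar>Im s\<bar>) powr (- 1) * (1 + \<bar>Im s\<bar>) powr (- (1 / 2)))"
      by (simp only: mult_ac)
    also have "(1 + \<bar>Im s\<bar>) powr (- 1) * (1 + \<bar>Im s\<bar>) powr (- (1 / 2)) = (1 + \<bar>Im s\<bar>) powr (- (3 / 2))"
      by (simp only: powr_add[symmetric]) simp
    finally show ?thesis .
  qed
  note * = vertical_line_shift[OF hol _ a(2) _ bd]
  show "integrable lborel (\<lambda>t. riesz_integrand x (Complex a t))" using a by (intro *(1)) auto
  have "(\<integral>t. riesz_integrand x (Complex a t) \<partial>lborel) = (\<integral>t. riesz_integrand x (Complex 1 t) \<partial>lborel)"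
    using a by (intro *(2)) auto
  then show "of_real x * (\<integral>t. riesz_integrand x (Complex a t) \<partial>lborel) = 2 * of_real pi * riesz_sum x"
    using perron_riesz_sum[OF x, of 1] by simp
qed

text \<open>The terms with n \<le> x give exactly h g(x); at most h + 1 terms remain, with x < n
  \<le> x + h, each at most h/x.\<close>

lemma riesz_sum_diff:
  assumes x: "x \<ge> 1" and h: "h > 0"
  shows "norm (riesz_sum (x + h) - riesz_sum x - of_real h * of_real (g_sum x)) \<le> h * (h + 1) / x"
proof -
  define A where "A = {n. 1 \<le> n \<and> real n \<le> x}"
  define B where "B = {n. x < real n \<and> real n \<le> x + h}"
  have fA: "finite A" unfolding A_def by (rule finite_le_real)
  have U: "{n. 1 \<le> n \<and> real n \<le> x + h} = A \<union> B" using x h by (auto simp: A_def B_def)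
  have fB: "finite B" using finite_le_real[of "x + h"] unfolding U by simp
  have "riesz_sum (x + h) = (\<Sum>n\<in>A. mob_coeff n * of_real (x + h - real n)) + (\<Sum>n\<in>B. mob_coeff n * of_real (x + h - real n))"
    unfolding riesz_sum_def sumfun_def U using fA fB by (intro sum.union_disjoint) (auto simp: A_def B_def)
  also have "(\<Sum>n\<in>A. mob_coeff n * of_real (x + h - real n)) =
      (\<Sum>n\<in>A. mob_coeff n * of_real (x - real n)) + of_real h * (\<Sum>n\<in>A. mob_coeff n)"
    by (simp add: sum_distrib_left algebra_simps flip: sum.distrib)
  also have "(\<Sum>n\<in>A. mob_coeff n * of_real (x - real n)) = riesz_sum x"
    by (simp add: riesz_sum_def sumfun_def A_def)
  also have "(\<Sum>n\<in>A. mob_coeff n) = of_real (g_sum x)"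
    by (simp add: g_sum_eq_sumfun sumfun_def A_def)
  finally have "riesz_sum (x + h) - riesz_sum x - of_real h * of_real (g_sum x) =
      (\<Sum>n\<in>B. mob_coeff n * of_real (x + h - real n))" by simp
  also have "norm \<dots> \<le> (\<Sum>n\<in>B. h / x)"
  proof (rule sum_norm_le)
    fix n assume n: "n \<in> B"
    have "norm (mob_coeff n) \<le> 1 / real n" by (rule norm_mob_coeff_le)
    also have "\<dots> \<le> 1 / x" using n x by (intro divide_left_mono) (auto simp: B_def)
    finally have "norm (mob_coeff n) * \<bar>x + h - real n\<bar> \<le> 1 / x * h"
      using n h x by (intro mult_mono) (auto simp: B_def)
    then show "norm (mob_coeff n * of_real (x + h - real n)) \<le> h / x" by (simp add: norm_mult del: of_real_diff of_real_add)
  qed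
  also have "\<dots> = real (card B) * (h / x)" by simp
  also have "\<dots> \<le> (h + 1) * (h / x)"
  proof (intro mult_right_mono)
    have "B \<subseteq> {nat \<lfloor>x\<rfloor><..nat \<lfloor>x + h\<rfloor>}"
    proof
      fix n assume n: "n \<in> B"
      then have "\<lfloor>x\<rfloor> < int n" "int n \<le> \<lfloor>x + h\<rfloor>" by (auto simp: B_def floor_less_iff le_floor_iff)
      moreover have "0 \<le> \<lfloor>x\<rfloor>" using x by simp
      ultimately show "n \<in> {nat \<lfloor>x\<rfloor><..nat \<lfloor>x + h\<rfloor>}" by (auto simp: nat_less_iff le_nat_iff)
    qed
    then have "card B \<le> nat \<lfloor>x + h\<rfloor> - nat \<lfloor>x\<rfloor>" using card_mono[of "{nat \<lfloor>x\<rfloor><..nat \<lfloor>x + h\<rfloor>}" B] by simp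
    then have "real (card B) \<le> real (nat \<lfloor>x + h\<rfloor> - nat \<lfloor>x\<rfloor>)" by simp
    also have "\<dots> = of_int \<lfloor>x + h\<rfloor> - of_int \<lfloor>x\<rfloor>"
      using x h floor_mono[of x "x + h"] by (simp add: of_nat_diff nat_mono)
    also have "\<dots> \<le> h + 1" by linarith
    finally show "real (card B) \<le> h + 1" .
  qed (use x h in auto)
  finally show ?thesis by (simp add: mult.commute)
qed

text \<open>The quotient is the integral of u^s over [x, x + h]. The first bound is good for small
  ordinates; the second decays in Im s and is good for large ones.\<close>

lemma powr_difference_quotient_bound:
  assumes x: "x \<ge> 1" and s: "- 1 < Re s" "Re s < 0" and h: "0 < h" "h \<le> x"
  shows "norm ((of_real (x + h) powr (s + 1) - of_real x powr (s + 1)) / (s + 1)) \<le> h * x powr Re s"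
    and "norm ((of_real (x + h) powr (s + 1) - of_real x powr (s + 1)) / (s + 1)) \<le> 4 * x powr (Re s + 1) / norm (s + 1)"
proof -
  have s1: "s + 1 \<noteq> 0"
  proof
    assume "s + 1 = 0"
    then have "Re (s + 1) = 0" by simp
    then show False using s by simp
  qed
  define S where "S = closed_segment (complex_of_real x) (of_real (x + h))"
  have S: "\<exists>u\<ge>x. z = of_real u" if "z \<in> S" for z
  proof -
    obtain w where "0 \<le> w" "w \<le> 1" "z = (1 - w) *\<^sub>R of_real x + w *\<^sub>R of_real (x + h)"
      using \<open>z \<in> S\<close> unfolding S_def closed_segment_def by blast
    then show ?thesis using h by (intro exI[of _ "x + w * h"]) (auto simp: scaleR_conv_of_real algebra_simps)
  qed
  have "norm (of_real (x + h) powr (s + 1) / (s + 1) - of_real x powr (s + 1) / (s + 1)) \<le> x powr Re s * norm (complex_of_real (x + h) - of_real x)"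
  proof (rule field_differentiable_bound[where S = S and f = "\<lambda>z. z powr (s + 1) / (s + 1)" and f' = "\<lambda>z. z powr s"])
    show "convex S" unfolding S_def by (rule convex_closed_segment)
    show "complex_of_real (x + h) \<in> S" "complex_of_real x \<in> S" unfolding S_def by auto
    fix z assume "z \<in> S"
    then obtain u where u: "u \<ge> x" "z = of_real u" using S by blast
    then have "z \<notin> \<real>\<^sub>\<le>\<^sub>0" using x by simp
    then have "((\<lambda>z. z powr (s + 1) / (s + 1)) has_field_derivative ((s + 1) * z powr (s + 1 - 1) / (s + 1))) (at z within S)"
      by (intro DERIV_cdivide has_field_derivative_powr[THEN has_field_derivative_at_within])
    then show "((\<lambda>z. z powr (s + 1) / (s + 1)) has_field_derivative z powr s) (at z within S)"
      using s1 by simp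
    show "norm (z powr s) \<le> x powr Re s"
      using u x s by (simp add: norm_powr_real_powr powr_mono2')
  qed
  then show "norm ((of_real (x + h) powr (s + 1) - of_real x powr (s + 1)) / (s + 1)) \<le> h * x powr Re s"
    using h by (simp add: diff_divide_distrib mult.commute)
  have "norm (of_real (x + h) powr (s + 1) - of_real x powr (s + 1)) \<le> (x + h) powr (Re s + 1) + x powr (Re s + 1)"
    using x h norm_triangle_ineq4[of "of_real (x + h) powr (s + 1)" "of_real x powr (s + 1)"]
    by (simp add: norm_powr_real_powr)
  moreover have "(x + h) powr (Re s + 1) \<le> (2 * x) powr (Re s + 1)"
    using x h s by (intro powr_mono2) auto
  moreover have "(2 * x) powr (Re s + 1) = 2 powr (Re s + 1) * x powr (Re s + 1)" by (rule powr_mult)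
  moreover have "2 powr (Re s + 1) \<le> (2 powr 1 :: real)" using s by (intro powr_mono) auto
  then have "2 powr (Re s + 1) * x powr (Re s + 1) \<le> 2 * x powr (Re s + 1)"
    by (intro mult_right_mono) auto
  moreover have "x powr (Re s + 1) \<ge> 0" by simp
  ultimately have "norm (of_real (x + h) powr (s + 1) - of_real x powr (s + 1)) \<le> 4 * x powr (Re s + 1)"
    by linarith
  then show "norm ((of_real (x + h) powr (s + 1) - of_real x powr (s + 1)) / (s + 1)) \<le> 4 * x powr (Re s + 1) / norm (s + 1)"
    unfolding norm_divide by (rule divide_right_mono) simp
qed

text \<open>Interpolating $|q| \<le> A$ and $|q| \<le> A r$ to $|q| \<le> A r^{\theta}$ with a small $\theta$ makes the
  integrand over the shifted line absolutely integrable at the cost of a factor $x^{\theta/2}$.\<close>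

lemma g_sum_bound:
  assumes RH: "riemann_hypothesis" and e: "0 < \<epsilon>" "\<epsilon> < 1 / 2"
  shows "\<exists>C\<ge>0. \<forall>t>0. \<bar>g_sum t\<bar> \<le> C * t powr (- 1 / 2 + \<epsilon>)"
proof -
  \<comment> \<open>Half of \<epsilon> is the distance of the line of integration from -1/2; the
    other half is the factor h^\<epsilon> = x^\<eta> lost by the interpolation.\<close>
  define \<eta> where "\<eta> = \<epsilon> / 2"
  define a where "a = - 1 / 2 + \<eta>"
  have \<eta>: "0 < \<eta>" "\<eta> < 1" and a: "- 1 / 2 < a" "a < 0" using e by (auto simp: \<eta>_def a_def)
  obtain C where C: "C > 0" "\<And>s. a + 1 \<le> Re s \<Longrightarrow> Re s \<le> 1 \<Longrightarrow> norm (1 / zeta_reg s) \<le> C * (1 + \<bar>Im s\<bar>) powr (\<eta> - 1)"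
    using inverse_zeta_reg_bound[OF RH, of "a + 1" \<eta> 1] a \<eta> by auto
  define J where "J = (\<integral>t. (1 + \<bar>t\<bar>) powr (- (1 + \<eta>)) \<partial>lborel)"
  define K where "K = 16 powr \<epsilon> * C * J / (2 * pi)"
  have J0: "J \<ge> 0" unfolding J_def by (intro Bochner_Integration.integral_nonneg) auto
  have K0: "K \<ge> 0" using J0 C by (simp add: K_def)
  have main: "\<bar>g_sum x\<bar> \<le> (K + 2) * x powr (- 1 / 2 + \<epsilon>)" if x: "x \<ge> 1" for x
  proof -
    \<comment> \<open>After division by h, the terms in (x, x + h] cost (h + 1)/x; this choice makes
      that cost O(x^(-1/2)).\<close>
    define h where "h = sqrt x"
    have h: "h > 0" "h \<le> x" "h * h = x" "h \<ge> 1" using x real_sqrt_le_mono[of x "x * x"] by (auto simp: h_def)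
    have hp: "h powr \<epsilon> = x powr \<eta>" using x by (simp add: h_def \<eta>_def powr_half_sqrt[symmetric] powr_powr mult.commute)
    define q :: "complex \<Rightarrow> complex" where "q = (\<lambda>s. (of_real (x + h) powr (s + 1) - of_real x powr (s + 1)) / (s + 1))"
    define u where "u = (\<lambda>t. q (Complex a t) / zeta_reg (Complex a t + 1))"
    have ri: "of_real y * riesz_integrand y s = of_real y powr (s + 1) / (s + 1) / zeta_reg (s + 1)" if "y > 0" for y s
      using that by (simp add: riesz_integrand_def powr_add mult.commute)
    note i1 = riesz_sum_shifted[OF RH a(1) _ , of x] and i2 = riesz_sum_shifted[OF RH a(1) _ , of "x + h"]
    have a1: "a < 1" using a by simp
    have x0: "x > 0" "x + h > 0" using x h by auto
    have ue: "u = (\<lambda>t. of_real (x + h) * riesz_integrand (x + h) (Complex a t) - of_real x * riesz_integrand x (Complex a t))"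
      unfolding u_def q_def ri[OF x0(1)] ri[OF x0(2)] by (simp add: diff_divide_distrib)
    have ui: "integrable lborel u" unfolding ue
      by (intro Bochner_Integration.integrable_diff integrable_mult_right i1(1)[OF a1 x0(1)] i2(1)[OF a1 x0(2)])
    have "integral\<^sup>L lborel u = of_real (x + h) * (\<integral>t. riesz_integrand (x + h) (Complex a t) \<partial>lborel)
        - of_real x * (\<integral>t. riesz_integrand x (Complex a t) \<partial>lborel)"
      unfolding ue by (subst Bochner_Integration.integral_diff)
        (simp_all only: integrable_mult_right[OF i1(1)[OF a1 x0(1)]] integrable_mult_right[OF i2(1)[OF a1 x0(2)]] integral_mult_right_zero)
    also have "\<dots> = 2 * of_real pi * (riesz_sum (x + h) - riesz_sum x)"
      by (simp only: i1(2)[OF a1 x0(1)] i2(2)[OF a1 x0(2)] right_diff_distrib)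
    finally have U: "integral\<^sup>L lborel u = 2 * of_real pi * (riesz_sum (x + h) - riesz_sum x)" .
    have ub: "norm (u t) \<le> h * x powr a * (16 powr \<epsilon> * x powr \<eta>) * C * (1 + \<bar>t\<bar>) powr (- (1 + \<eta>))" for t
    proof -
      define s where "s = Complex a t"
      \<comment> \<open>The ratio of the two bounds on \<open>q\<close>: 16 is the 4 of the second
        bound times the 4 from |s + 1| \<ge> (1 + |t|)/4, and x = h h leaves one factor h.\<close>
      define r where "r = 16 * h / (1 + \<bar>t\<bar>)"
      have s: "Re s = a" "Im s = t" by (simp_all add: s_def)
      have r0: "r > 0" using h by (simp add: r_def)
      have q1: "norm (q s) \<le> h * x powr a"
        unfolding q_def using x a h s powr_difference_quotient_bound(1)[of x s h] by simp
      have q2: "norm (q s) \<le> h * x powr a * r"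
      proof -
        have "norm (q s) \<le> 4 * x powr (a + 1) / norm (s + 1)"
          unfolding q_def using x a h s powr_difference_quotient_bound(2)[of x s h] by simp
        also have "\<dots> \<le> 4 * x powr (a + 1) / (1 / 4 * (1 + \<bar>t\<bar>))"
        proof (intro frac_le)
          have "1 / 4 * (1 + \<bar>t\<bar>) \<le> min (a + 1) 1 / 2 * (1 + \<bar>t\<bar>)" using a by (intro mult_right_mono) auto
          also have "\<dots> \<le> norm (Complex (a + 1) t)" using a by (intro norm_Complex_lower) auto
          also have "Complex (a + 1) t = s + 1" by (simp add: s_def complex_eq_iff)
          finally show "1 / 4 * (1 + \<bar>t\<bar>) \<le> norm (s + 1)" .
        qed auto
        also have "x powr (a + 1) = x powr a * (h * h)" using x by (simp add: powr_add h)
        finally show ?thesis by (simp add: r_def mult_ac)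
      qed
      have q: "norm (q s) \<le> h * x powr a * r powr \<epsilon>"
      proof (cases "r \<ge> 1")
        case True
        have "norm (q s) \<le> h * x powr a * 1" using q1 by simp
        also have "\<dots> \<le> h * x powr a * r powr \<epsilon>"
          using True e h by (intro mult_left_mono ge_one_powr_ge_zero) auto
        finally show ?thesis .
      next
        case False
        have "r powr 1 \<le> r powr \<epsilon>" using False r0 e by (intro powr_mono') auto
        then have "h * x powr a * r \<le> h * x powr a * r powr \<epsilon>" using r0 h by (intro mult_left_mono) auto
        with q2 show ?thesis by linarith
      qed
      have rp: "r powr \<epsilon> = 16 powr \<epsilon> * x powr \<eta> * (1 + \<bar>t\<bar>) powr (- \<epsilon>)"
      proof -
        have "r powr \<epsilon> = (16 * h) powr \<epsilon> / (1 + \<bar>t\<bar>) powr \<epsilon>"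
          unfolding r_def by (rule powr_divide)
        also have "(16 * h) powr \<epsilon> = 16 powr \<epsilon> * x powr \<eta>" using h by (simp add: powr_mult hp)
        finally show ?thesis by (simp add: powr_minus divide_inverse)
      qed
      have z: "norm (1 / zeta_reg (s + 1)) \<le> C * (1 + \<bar>t\<bar>) powr (\<eta> - 1)"
        using C(2)[of "s + 1"] s a by simp
      have "norm (u t) = norm (q s) * norm (1 / zeta_reg (s + 1))"
        by (simp add: u_def s_def norm_divide)
      also have "\<dots> \<le> (h * x powr a * r powr \<epsilon>) * (C * (1 + \<bar>t\<bar>) powr (\<eta> - 1))"
        using h by (intro mult_mono q z) auto
      also have "\<dots> = h * x powr a * (16 powr \<epsilon> * x powr \<eta>) * C * ((1 + \<bar>t\<bar>) powr (- \<epsilon>) * (1 + \<bar>t\<bar>) powr (\<eta> - 1))"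
        unfolding rp by (simp only: mult_ac)
      also have "(1 + \<bar>t\<bar>) powr (- \<epsilon>) * (1 + \<bar>t\<bar>) powr (\<eta> - 1) = (1 + \<bar>t\<bar>) powr (- (1 + \<eta>))"
      proof -
        have "- \<epsilon> + (\<eta> - 1) = - (1 + \<eta>)" by (simp add: \<eta>_def)
        then show ?thesis by (simp only: powr_add[symmetric])
      qed
      finally show ?thesis .
    qed
    have "norm (integral\<^sup>L lborel u) \<le> (\<integral>t. norm (u t) \<partial>lborel)" by (rule integral_norm_bound)
    also have "\<dots> \<le> (\<integral>t. h * x powr a * (16 powr \<epsilon> * x powr \<eta>) * C * (1 + \<bar>t\<bar>) powr (- (1 + \<eta>)) \<partial>lborel)"
      using \<eta> by (intro integral_mono integrable_norm ui integrable_mult_right integrable_powr_decay ub) auto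
    also have "\<dots> = h * x powr a * (16 powr \<epsilon> * x powr \<eta>) * C * J"
      unfolding J_def by (rule integral_mult_right_zero)
    also have "\<dots> = 2 * pi * (h * (K * (x powr a * x powr \<eta>)))" by (simp add: K_def)
    also have "x powr a * x powr \<eta> = x powr (- 1 / 2 + \<epsilon>)"
      by (simp only: powr_add[symmetric]) (simp add: a_def \<eta>_def)
    finally have "2 * pi * norm (riesz_sum (x + h) - riesz_sum x) \<le> 2 * pi * (h * (K * x powr (- 1 / 2 + \<epsilon>)))"
      unfolding U by (simp add: norm_mult)
    then have 1: "norm (riesz_sum (x + h) - riesz_sum x) \<le> h * (K * x powr (- 1 / 2 + \<epsilon>))" by simp
    have 2: "norm (riesz_sum (x + h) - riesz_sum x - of_real h * of_real (g_sum x)) \<le> h * (h + 1) / x"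
      by (rule riesz_sum_diff[OF x h(1)])
    have "norm (complex_of_real h * of_real (g_sum x)) \<le> norm (riesz_sum (x + h) - riesz_sum x) +
        norm (riesz_sum (x + h) - riesz_sum x - of_real h * of_real (g_sum x))"
      using norm_triangle_ineq4[of "riesz_sum (x + h) - riesz_sum x" "riesz_sum (x + h) - riesz_sum x - of_real h * of_real (g_sum x)"] by simp
    also have "\<dots> \<le> h * (K * x powr (- 1 / 2 + \<epsilon>)) + h * (h + 1) / x" using 1 2 by (rule add_mono)
    also have "norm (complex_of_real h * of_real (g_sum x)) = h * \<bar>g_sum x\<bar>" using h by (simp add: norm_mult)
    finally have "h * \<bar>g_sum x\<bar> \<le> h * (K * x powr (- 1 / 2 + \<epsilon>) + (h + 1) / x)" by (simp add: distrib_left)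
    then have "\<bar>g_sum x\<bar> \<le> K * x powr (- 1 / 2 + \<epsilon>) + (h + 1) / x" using h by simp
    also have "(h + 1) / x \<le> 2 * h / (h * h)" unfolding h(3) using h x by (intro divide_right_mono) auto
    also have "2 * h / (h * h) = 2 * x powr (- 1 / 2)"
    proof -
      have "x powr (- 1 / 2) = x powr (- (1 / 2))" by simp
      also have "\<dots> = 1 / h"
        unfolding powr_minus_divide using x by (simp add: h_def powr_half_sqrt)
      finally show ?thesis using h(1) by simp
    qed
    also have "\<dots> \<le> 2 * x powr (- 1 / 2 + \<epsilon>)" using x e by (intro mult_left_mono powr_mono) auto
    finally show ?thesis by (simp add: algebra_simps)
  qed
  show ?thesis
  proof (intro exI[of _ "K + 2"] conjI allI impI)
    fix t :: real assume t: "t > 0"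
    show "\<bar>g_sum t\<bar> \<le> (K + 2) * t powr (- 1 / 2 + \<epsilon>)"
    proof (cases "t \<ge> 1")
      \<comment> \<open>The sum is empty below 1, so the bound holds for all t > 0, as the
        integration against \<phi> requires.\<close>
      case False
      then have "{n. 1 \<le> n \<and> real n \<le> t} = {}" by auto
      then have "g_sum t = 0" by (simp only: g_sum_def sum.empty)
      then show ?thesis using K0 by simp
    qed (rule main)
  qed (use K0 in simp)
qed

subsection \<open>The equivalence\<close>

lemma G_op_bound_RH:
  assumes "proper \<phi>" and RH: "riemann_hypothesis" and e: "\<epsilon> > 0"
  shows "(\<lambda>x. norm (G_op \<phi> x)) \<in> O[at_top](\<lambda>x::real. x powr (- 1 / 2 + \<epsilon>))"
proof -
  \<comment> \<open>The bound on g is available for exponents below 1/2 only; for x \<ge> 1 a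
    smaller \<delta> gives a stronger bound.\<close>
  define \<delta> where "\<delta> = min \<epsilon> (1 / 4)"
  have \<delta>: "0 < \<delta>" "\<delta> < 1 / 2" "\<delta> \<le> \<epsilon>" using e by (auto simp: \<delta>_def)
  obtain C where C: "C \<ge> 0" "\<And>t. t > 0 \<Longrightarrow> \<bar>g_sum t\<bar> \<le> C * t powr (- 1 / 2 + \<delta>)"
    using g_sum_bound[OF RH \<delta>(1,2)] by blast
  define a where "a = - 1 / 2 + \<delta>"
  have conv: "mellin_conv \<phi> a"
    using assms(1) \<delta> by (intro mellin_conv_proper) (auto simp: a_def)
  define N where "N = (\<integral>u. u powr (- a - 1) * norm (\<phi> u) \<partial>Lpos)"
  have bd: "norm (G_op \<phi> x) \<le> C * N * x powr (- 1 / 2 + \<epsilon>)" if x: "x \<ge> 1" for x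
  proof -
    have x0: "x > 0" using x by simp
    have "norm (G_op \<phi> x) \<le> (\<integral>u. norm (of_real (g_sum (x / u)) * \<phi> u / of_real u) \<partial>Lpos)"
      unfolding G_op_eq_mult_conv[OF x0] mult_conv_def by (rule integral_norm_bound)
    also have "\<dots> \<le> (\<integral>u. C * x powr a * (u powr (- a - 1) * norm (\<phi> u)) \<partial>Lpos)"
    proof (rule integral_mono')
      show "integrable Lpos (\<lambda>u. C * x powr a * (u powr (- a - 1) * norm (\<phi> u)))"
        using conv by (intro integrable_mult_right) (simp add: mellin_conv_def)
      fix u assume "u \<in> space Lpos"
      then have u: "u > 0" by (simp add: space_restrict_space)
      show "0 \<le> C * x powr a * (u powr (- a - 1) * norm (\<phi> u))" using C(1) by simp
      have "norm (of_real (g_sum (x / u)) * \<phi> u / of_real u) = \<bar>g_sum (x / u)\<bar> * (norm (\<phi> u) / u)"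
        using u by (simp add: norm_mult norm_divide)
      also have "\<dots> \<le> C * (x / u) powr a * (norm (\<phi> u) / u)"
        unfolding a_def using u x0 by (intro mult_right_mono C) auto
      also have "\<dots> = C * x powr a * (u powr (- a - 1) * norm (\<phi> u))"
        using u by (simp add: powr_divide powr_diff powr_minus_divide)
      finally show "norm (of_real (g_sum (x / u)) * \<phi> u / of_real u) \<le> C * x powr a * (u powr (- a - 1) * norm (\<phi> u))" .
    qed
    also have "\<dots> = C * x powr a * N" unfolding N_def by (rule integral_mult_right_zero)
    also have "\<dots> = C * N * x powr a" by simp
    also have "\<dots> \<le> C * N * x powr (- 1 / 2 + \<epsilon>)"
    proof (intro mult_left_mono powr_mono mult_nonneg_nonneg C)
      show "0 \<le> N" unfolding N_def by (intro Bochner_Integration.integral_nonneg) auto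
    qed (use x \<delta> in \<open>auto simp: a_def\<close>)
    finally show ?thesis .
  qed
  show ?thesis
  proof (rule bigoI)
    show "\<forall>\<^sub>F x in at_top. norm (norm (G_op \<phi> x)) \<le> C * N * norm (x powr (- 1 / 2 + \<epsilon>))"
      using eventually_ge_at_top[of "1::real"] by eventually_elim (use bd in simp)
  qed
qed

lemma mellin_mult_conv_g_sum:
  assumes "proper \<phi>" "0 < Re s" "Re s \<le> 1"
  shows "mellin_conv (mult_conv (\<lambda>t. of_real (g_sum t)) \<phi>) (Re s)"
    and "mellin (mult_conv (\<lambda>t. of_real (g_sum t)) \<phi>) s = mellin \<phi> s / zeta_reg (s + 1)"
proof -
  note * = mellin_mult_conv[OF g_sum_measurable mellin_g_sum(1)[OF assms(2)] mellin_conv_proper[OF assms(1)]]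
  show "mellin_conv (mult_conv (\<lambda>t. of_real (g_sum t)) \<phi>) (Re s)"
    using assms by (intro *(1)) auto
  have "mellin (mult_conv (\<lambda>t. of_real (g_sum t)) \<phi>) s = mellin (\<lambda>t. of_real (g_sum t)) s * mellin \<phi> s"
    using assms by (intro *(2)) auto
  then show "mellin (mult_conv (\<lambda>t. of_real (g_sum t)) \<phi>) s = mellin \<phi> s / zeta_reg (s + 1)"
    using mellin_g_sum(2)[OF assms(2)] by simp
qed

text \<open>Convergence at exponent 1 controls the convolution near 0, and the assumed growth bound
  controls it at infinity.\<close>

lemma mellin_conv_mult_conv_g_sum:
  assumes \<phi>: "proper \<phi>" and a: "- 1 / 2 < a" "a \<le> 1"
    and O: "\<forall>\<epsilon>>0. (\<lambda>x. norm (G_op \<phi> x)) \<in> O[at_top](\<lambda>x::real. x powr (- 1 / 2 + \<epsilon>))"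
  shows "mellin_conv (mult_conv (\<lambda>t. of_real (g_sum t)) \<phi>) a"
proof -
  define c where "c = mult_conv (\<lambda>t. of_real (g_sum t)) \<phi>"
  have c1: "mellin_conv c 1"
    unfolding c_def using mellin_mult_conv_g_sum(1)[OF \<phi>, of 1] by simp
  \<comment> \<open>Half the distance from -1/2 to a, so that t^(-1/2 + \<epsilon>) is admissible at
    infinity for the exponent a.\<close>
  define \<epsilon> where "\<epsilon> = (a + 1 / 2) / 2"
  have \<epsilon>: "\<epsilon> > 0" "- 1 / 2 + \<epsilon> < a" using a by (auto simp: \<epsilon>_def field_simps)
  obtain K where K: "K > 0" "\<forall>\<^sub>F x in at_top. norm (norm (G_op \<phi> x)) \<le> K * norm (x powr (- 1 / 2 + \<epsilon>))"
    using O \<epsilon>(1) landau_o.bigE by blast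
  then obtain X0 where X0: "\<And>x. x \<ge> X0 \<Longrightarrow> norm (G_op \<phi> x) \<le> K * x powr (- 1 / 2 + \<epsilon>)"
    by (auto simp: eventually_at_top_linorder)
  define X where "X = max X0 1"
  have X: "X \<ge> 1" "X \<ge> X0" by (auto simp: X_def)
  \<comment> \<open>On t < X the factor (X/t)^(1 - a) \<ge> 1 trades the exponent a for 1; on t
    \<ge> X the second summand is the assumed bound.\<close>
  define f where "f = (\<lambda>t. of_real (X powr (1 - a)) * (of_real (t powr (a - 1)) * of_real (norm (c t)))
      + of_real K * (of_real (t powr (- 1 / 2 + \<epsilon>)) * ustep t))"
  have "mellin_conv (\<lambda>t. of_real (norm (c t))) 1"
  proof (rule mellin_conv_bound[OF c1, where C = 1])
    have [measurable]: "c \<in> borel_measurable Lpos" using c1 by (simp add: mellin_conv_def)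
    show "(\<lambda>t. complex_of_real (norm (c t))) \<in> borel_measurable Lpos" by measurable
  qed simp
  then have f1: "mellin_conv (\<lambda>t. of_real (X powr (1 - a)) * (of_real (t powr (a - 1)) * of_real (norm (c t)))) (Re (of_real a))"
    by (intro mellin_cmult(1) mellin_shift(1)) simp
  have f2: "mellin_conv (\<lambda>t. of_real K * (of_real (t powr (- 1 / 2 + \<epsilon>)) * ustep t)) (Re (of_real a))"
    using \<epsilon> by (intro mellin_cmult(1) mellin_shift(1) mellin_conv_ustep) simp
  have f: "mellin_conv f a"
    using mellin_add(1)[OF f1 f2] by (simp add: f_def)
  have "mellin_conv c a"
  proof (rule mellin_conv_bound[OF f, where C = 1])
    show "c \<in> borel_measurable Lpos" using c1 by (simp add: mellin_conv_def)
    fix t :: real assume t: "t > 0"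
    have "f t = of_real (X powr (1 - a) * (t powr (a - 1) * norm (c t)) + K * (t powr (- 1 / 2 + \<epsilon>) * norm (ustep t)))"
      unfolding f_def by (subst (1) ustep_eq_norm) simp
    then have nf: "norm (f t) = X powr (1 - a) * (t powr (a - 1) * norm (c t)) + K * (t powr (- 1 / 2 + \<epsilon>) * norm (ustep t))"
      using K(1) by (simp only: norm_of_real) simp
    have "norm (c t) \<le> norm (f t)"
    proof (cases "t \<ge> X")
      case True
      then have "norm (c t) \<le> K * (t powr (- 1 / 2 + \<epsilon>) * norm (ustep t))"
        using X0[of t] X t G_op_eq_mult_conv[of t \<phi>] by (simp add: c_def ustep_def)
      then show ?thesis unfolding nf by (simp add: add_increasing)
    next
      case False
      then have "1 = X powr (1 - a) * X powr (a - 1)" using X by (simp flip: powr_add)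
      also have "\<dots> \<le> X powr (1 - a) * t powr (a - 1)"
        using False t a by (intro mult_left_mono powr_mono2') auto
      finally have "1 * norm (c t) \<le> X powr (1 - a) * t powr (a - 1) * norm (c t)"
        by (rule mult_right_mono) simp
      then show ?thesis unfolding nf using K(1) by (simp add: add_increasing2 mult.assoc)
    qed
    then show "t powr (- a - 1) * norm (c t) \<le> 1 * (t powr (- a - 1) * norm (f t))"
      by (simp add: mult_left_mono)
  qed
  then show ?thesis by (simp add: c_def)
qed

lemma mellin_zero_of_G_op_bound:
  assumes \<phi>: "proper \<phi>"
    and O: "\<forall>\<epsilon>>0. (\<lambda>x. norm (G_op \<phi> x)) \<in> O[at_top](\<lambda>x::real. x powr (- 1 / 2 + \<epsilon>))"
    and s: "Re s > - 1 / 2" "s \<noteq> 0" "riemann_zeta (s + 1) = 0"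
  shows "mellin \<phi> s = 0"
proof -
  have z: "zeta_reg (s + 1) = 0" using s by (subst zeta_reg_eq) auto
  \<comment> \<open>Nonvanishing on Re \<ge> 1 places s to the left of 0, hence inside the strip S
    below.\<close>
  then have sn: "Re s < 0" using zeta_reg_nonzero[of "s + 1"] by force
  define a where "a = (- 1 / 2 + Re s) / 2"
  have a: "- 1 / 2 < a" "a < Re s" "a < 0" using s sn by (auto simp: a_def field_simps)
  define S where "S = {z. a < Re z \<and> Re z < 1}"
  define c where "c = mult_conv (\<lambda>t. of_real (g_sum t)) \<phi>"
  \<comment> \<open>The product form stays meaningful at the zeros of zeta; division by
    \<open>zeta_reg\<close> takes place only for real x between 1/2 and 1.\<close>
  have "mellin \<phi> s = zeta_reg (s + 1) * mellin c s"
  proof (rule identity_real_interval[where f = "mellin \<phi>" and S = S and a = "1 / 2" and b = 1])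
    show "mellin \<phi> holomorphic_on S"
      unfolding S_def using a by (intro mellin_holomorphic mellin_conv_proper \<phi>) auto
    have "mellin c holomorphic_on S"
      unfolding S_def c_def using a by (intro mellin_holomorphic mellin_conv_mult_conv_g_sum \<phi> O) auto
    moreover have "zeta_reg \<circ> (\<lambda>z. z + 1) holomorphic_on S"
      using a by (intro holomorphic_on_compose_gen[OF _ zeta_reg_holomorphic] holomorphic_intros) (auto simp: S_def)
    ultimately show "(\<lambda>z. zeta_reg (z + 1) * mellin c z) holomorphic_on S"
      unfolding o_def by (rule holomorphic_on_mult[rotated])
    show "open S" "connected S" unfolding S_def by (rule open_Re_strip connected_Re_strip)+
    show "of_real (1 / 2) \<in> S" "s \<in> S" using a sn by (auto simp: S_def)
    show "mellin \<phi> (of_real x) = zeta_reg (of_real x + 1) * mellin c (of_real x)" if "1 / 2 < x" "x < 1" for x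
    proof -
      have "zeta_reg (of_real x + 1) \<noteq> 0" using that by (intro zeta_reg_nonzero) simp
      then show ?thesis
        unfolding c_def using that mellin_mult_conv_g_sum(2)[OF \<phi>, of "of_real x"] by simp
    qed
  qed simp
  with z show ?thesis by simp
qed

lemma RH_of_mellin_zeros:
  assumes "mellin_proper \<phi>"
    and zeros: "\<forall>s. Re s > - 1 / 2 \<and> s \<noteq> 0 \<and> riemann_zeta (s + 1) = 0 \<longrightarrow> mellin \<phi> s = 0"
  shows "riemann_hypothesis"
proof -
  \<comment> \<open>With w = s + 1, the strip -1/2 < Re s < 0 of \<open>mellin_proper\<close> is the
    right half of the critical strip.\<close>
  have *: False if w: "1 / 2 < Re w" "Re w < 1" "riemann_zeta w = 0" for w
  proof -
    have "w \<noteq> 1" using w by auto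
    then have "mellin \<phi> (w - 1) = 0" using zeros[rule_format, of "w - 1"] w by simp
    moreover have "mellin \<phi> (w - 1) \<noteq> 0" using assms(1) w by (simp add: mellin_proper_def)
    ultimately show False by simp
  qed
  show ?thesis
    unfolding riemann_hypothesis_def
  proof (intro allI impI)
    fix s assume s: "0 < Re s \<and> Re s < 1 \<and> riemann_zeta s = 0"
    show "Re s = 1 / 2"
    proof (rule ccontr)
      assume "Re s \<noteq> 1 / 2"
      then consider "Re s > 1 / 2" | "Re s < 1 / 2" by linarith
      then show False
      proof cases
        case 2
        then show False using *[of "1 - s"] s riemann_zeta_zero_reflect[of s] by simp
      qed (use * s in blast)
    qed
  qed
qed

theorem theorem3p5:
  fixes \<phi> :: "real \<Rightarrow> complex"
  assumes "proper \<phi>"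
  shows "(riemann_hypothesis \<longrightarrow>
            (\<forall>\<epsilon>>0. (\<lambda>x. norm (G_op \<phi> x)) \<in> O[at_top](\<lambda>x::real. x powr (- 1 / 2 + \<epsilon>)))) \<and>
         ((\<forall>\<epsilon>>0. (\<lambda>x. norm (G_op \<phi> x)) \<in> O[at_top](\<lambda>x::real. x powr (- 1 / 2 + \<epsilon>))) \<longrightarrow>
            (\<forall>s. Re s > - 1 / 2 \<and> s \<noteq> 0 \<and> riemann_zeta (s + 1) = 0 \<longrightarrow> mellin \<phi> s = 0)) \<and>
         (mellin_proper \<phi> \<longrightarrow>
            (riemann_hypothesis \<longleftrightarrow>
              (\<forall>\<epsilon>>0. (\<lambda>x. norm (G_op \<phi> x)) \<in> O[at_top](\<lambda>x::real. x powr (- 1 / 2 + \<epsilon>)))))"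
proof -
  have 1: "riemann_hypothesis \<longrightarrow>
      (\<forall>\<epsilon>>0. (\<lambda>x. norm (G_op \<phi> x)) \<in> O[at_top](\<lambda>x::real. x powr (- 1 / 2 + \<epsilon>)))"
    using G_op_bound_RH[OF assms] by blast
  have 2: "(\<forall>\<epsilon>>0. (\<lambda>x. norm (G_op \<phi> x)) \<in> O[at_top](\<lambda>x::real. x powr (- 1 / 2 + \<epsilon>))) \<longrightarrow>
      (\<forall>s. Re s > - 1 / 2 \<and> s \<noteq> 0 \<and> riemann_zeta (s + 1) = 0 \<longrightarrow> mellin \<phi> s = 0)"
    using mellin_zero_of_G_op_bound[OF assms] by blast
  show ?thesis
    using 1 2 RH_of_mellin_zeros[of \<phi>] by blast
qed

end
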